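(* Let $\ell\geq 3$ and $n\geq \max\{2.16\times 10^{17},\, 9\times 2^{\ell-1}+3\}$ be integers. Then the graph $K_2+H(2\ell-3,\ell-2)$ (on $n$ vertices) is, up to isomorphism, the unique extremal graph to $\mathrm{spex}_{\mathcal{P}}(n,2C_{\ell})$; that is, it is the unique $n$-vertex $2C_\ell$-free planar graph with maximum spectral radius.
   Context: All graphs are finite and simple. $\rho(G)$ denotes the spectral radius of the adjacency matrix of $G$. A graph is $F$-free if it does not contain $F$ as a (not necessarily induced) subgraph. $\mathrm{spex}_{\mathcal{P}}(n,F)$ is the maximum of $\rho(G)$ over all $n$-vertex $F$-free planar graphs $G$; an extremal graph is one attaining this maximum. $2C_\ell$ is the disjoint union of two cycles of length $\ell$. $G+H$ denotes the join of $G$ and $H$, and $P_m$ is the path on $m$ vertices ($P_1=K_1$). For positive integers $n,n_1,n_2$ with $n_1\geq n_2$ and $n\geq n_1+2n_2+2$, let $\alpha,\beta$ be the integers with $1\leq\beta\leq n_2$ and $n-2=n_1+\alpha n_2+\beta$. Define the $(n-2)$-vertex graph $$H(n_1,n_2):=P_{n_1}\cup \alpha P_{n_2}\cup P_{\beta},$$ the disjoint union of one path on $n_1$ vertices, $\alpha$ paths on $n_2$ vertices, and one path on $\beta$ vertices. *)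

theory Defs
  imports
    "HOL-Analysis.Analysis"
    "Graph_Theory.Graph_Theory"
    "Jordan_Normal_Form.Spectral_Radius"
begin

text \<open>
  A finite simple graph is a \<open>pair_graph\<close> of the Graph-Theory library: a finite symmetric loopless
  arc relation, in which an undirected edge \<open>uv\<close> is the pair of opposite arcs \<open>(u,v)\<close>, \<open>(v,u)\<close>.
\<close>

section \<open>Constructions\<close>

definition complete_graph :: "nat \<Rightarrow> nat pair_pre_digraph" where
  "complete_graph n = \<lparr> pverts = {0..<n}, parcs = {(i, j). i < n \<and> j < n \<and> i \<noteq> j} \<rparr>"

definition path_graph :: "nat \<Rightarrow> nat pair_pre_digraph" where
  "path_graph n = \<lparr> pverts = {0..<n},
     parcs = {(i, j). i < n \<and> j < n \<and> (j = i + 1 \<or> i = j + 1)} \<rparr>"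

text \<open>Only meaningful for \<open>n \<ge> 3\<close>.\<close>

definition cycle_graph :: "nat \<Rightarrow> nat pair_pre_digraph" where
  "cycle_graph n = \<lparr> pverts = {0..<n},
     parcs = {(i, j). i < n \<and> j < n \<and> (j = (i + 1) mod n \<or> i = (j + 1) mod n)} \<rparr>"

definition disjoint_union ::
  "'a pair_pre_digraph \<Rightarrow> 'b pair_pre_digraph \<Rightarrow> ('a + 'b) pair_pre_digraph" where
  "disjoint_union G H = \<lparr> pverts = pverts G <+> pverts H,
     parcs = {(Inl u, Inl v) | u v. (u, v) \<in> parcs G} \<union> {(Inr u, Inr v) | u v. (u, v) \<in> parcs H} \<rparr>"

definition copies :: "nat \<Rightarrow> 'a pair_pre_digraph \<Rightarrow> (nat \<times> 'a) pair_pre_digraph" where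
  "copies k G = \<lparr> pverts = {0..<k} \<times> pverts G,
     parcs = {((i, u), (i, v)) | i u v. i < k \<and> (u, v) \<in> parcs G} \<rparr>"

definition graph_join ::
  "'a pair_pre_digraph \<Rightarrow> 'b pair_pre_digraph \<Rightarrow> ('a + 'b) pair_pre_digraph" where
  "graph_join G H = \<lparr> pverts = pverts G <+> pverts H,
     parcs = parcs (disjoint_union G H)
       \<union> {(Inl u, Inr v) | u v. u \<in> pverts G \<and> v \<in> pverts H}
       \<union> {(Inr v, Inl u) | u v. u \<in> pverts G \<and> v \<in> pverts H} \<rparr>"

text \<open>
  For \<open>n \<ge> n1 + 2 * n2 + 2\<close>, \<open>H_alpha\<close> and \<open>H_beta\<close> are the integers \<open>\<alpha>\<close> and \<open>\<beta>\<close> with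
  \<open>n - 2 = n1 + \<alpha> * n2 + \<beta>\<close> and \<open>1 \<le> \<beta> \<le> n2\<close>; see \<open>H_alpha_beta_iff\<close>.
\<close>

definition H_alpha :: "nat \<Rightarrow> nat \<Rightarrow> nat \<Rightarrow> nat" where
  "H_alpha n n1 n2 = (n - 3 - n1) div n2"

definition H_beta :: "nat \<Rightarrow> nat \<Rightarrow> nat \<Rightarrow> nat" where
  "H_beta n n1 n2 = (n - 3 - n1) mod n2 + 1"

lemma H_alpha_beta_iff:
  assumes "n1 \<ge> 1" "n2 \<ge> 1" "n \<ge> n1 + 2 * n2 + 2"
  shows "(1 \<le> \<beta> \<and> \<beta> \<le> n2 \<and> n - 2 = n1 + \<alpha> * n2 + \<beta>)
           \<longleftrightarrow> \<alpha> = H_alpha n n1 n2 \<and> \<beta> = H_beta n n1 n2"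
proof
  assume *: "1 \<le> \<beta> \<and> \<beta> \<le> n2 \<and> n - 2 = n1 + \<alpha> * n2 + \<beta>"
  then obtain b where b: "\<beta> = Suc b" "b < n2" by (cases \<beta>) auto
  with * have "n - 3 - n1 = b + \<alpha> * n2" by linarith
  with b show "\<alpha> = H_alpha n n1 n2 \<and> \<beta> = H_beta n n1 n2"
    unfolding H_alpha_def H_beta_def by simp
next
  assume *: "\<alpha> = H_alpha n n1 n2 \<and> \<beta> = H_beta n n1 n2"
  define a b where "a = (n - 3 - n1) div n2" and "b = (n - 3 - n1) mod n2"
  have "a * n2 + b = n - 3 - n1" by (simp add: a_def b_def)
  moreover have "b < n2" using assms by (simp add: b_def)
  ultimately show "1 \<le> \<beta> \<and> \<beta> \<le> n2 \<and> n - 2 = n1 + \<alpha> * n2 + \<beta>"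
    using * assms unfolding H_alpha_def H_beta_def a_def[symmetric] b_def[symmetric] by auto
qed

definition H_graph :: "nat \<Rightarrow> nat \<Rightarrow> nat \<Rightarrow> (nat + (nat \<times> nat + nat)) pair_pre_digraph" where
  "H_graph n n1 n2 =
     disjoint_union (path_graph n1)
       (disjoint_union (copies (H_alpha n n1 n2) (path_graph n2)) (path_graph (H_beta n n1 n2)))"

section \<open>Isomorphism and forbidden subgraphs\<close>

definition isomorphic :: "'a pair_pre_digraph \<Rightarrow> 'b pair_pre_digraph \<Rightarrow> bool" where
  "isomorphic G H \<longleftrightarrow> digraph_iso (with_proj G) (with_proj H)"

definition free_of :: "'b pair_pre_digraph \<Rightarrow> 'a pair_pre_digraph \<Rightarrow> bool" where
  "free_of F G \<longleftrightarrow>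
     \<not> (\<exists>K :: 'a pair_pre_digraph. subgraph (with_proj K) (with_proj G) \<and> isomorphic F K)"

section \<open>Planarity\<close>

text \<open>
  A drawing in the plane sends the vertices injectively to points \<open>p v\<close> and each edge \<open>e = {u, v}\<close> to
  a simple arc \<open>\<gamma> e\<close> between \<open>p u\<close> and \<open>p v\<close>, whose interior contains no vertex and no point of
  another edge.
\<close>

definition graph_edges :: "'a pair_pre_digraph \<Rightarrow> 'a set set" where
  "graph_edges G = {{u, v} | u v. (u, v) \<in> parcs G}"

definition planar_drawing ::
  "'a pair_pre_digraph \<Rightarrow> ('a \<Rightarrow> complex) \<Rightarrow> ('a set \<Rightarrow> real \<Rightarrow> complex) \<Rightarrow> bool" where
  "planar_drawing G p \<gamma> \<longleftrightarrow>
     inj_on p (pverts G) \<and>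
     (\<forall>e \<in> graph_edges G.
        Path_Connected.arc (\<gamma> e) \<and>
        {pathstart (\<gamma> e), pathfinish (\<gamma> e)} = p ` e \<and>
        (path_image (\<gamma> e) - p ` e) \<inter> p ` pverts G = {} \<and>
        (\<forall>e' \<in> graph_edges G. e' \<noteq> e \<longrightarrow>
           (path_image (\<gamma> e) - p ` e) \<inter> path_image (\<gamma> e') = {}))"

definition planar :: "'a pair_pre_digraph \<Rightarrow> bool" where
  "planar G \<longleftrightarrow> (\<exists>p \<gamma>. planar_drawing G p \<gamma>)"

section \<open>Spectral radius\<close>

definition adjacency_matrix :: "'a pair_pre_digraph \<Rightarrow> 'a list \<Rightarrow> complex mat" where
  "adjacency_matrix G vs = Matrix.mat (length vs) (length vs)
     (\<lambda>(i, j). if (vs ! i, vs ! j) \<in> parcs G then 1 else 0)"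

text \<open>The choice of the enumeration of the vertices is immaterial; see \<open>graph_spectral_radius_eq\<close>.\<close>

definition graph_spectral_radius :: "'a pair_pre_digraph \<Rightarrow> real" where
  "graph_spectral_radius G =
     spectral_radius (adjacency_matrix G (SOME vs. distinct vs \<and> set vs = pverts G))"

lemma eigenvalue_adjacency_matrix_iff:
  assumes "distinct vs"
  shows "eigenvalue (adjacency_matrix G vs) k \<longleftrightarrow>
    (\<exists>f. (\<exists>u \<in> set vs. f u \<noteq> 0) \<and>
         (\<forall>u \<in> set vs. (\<Sum>v \<in> set vs. (if (u, v) \<in> parcs G then 1 else 0) * f v) = k * f u))"
    (is "?L \<longleftrightarrow> ?R")
proof -
  let ?n = "length vs"
  have bij: "bij_betw ((!) vs) {0..<?n} (set vs)"
    using bij_betw_nth[OF assms, of "{0..<?n}" "set vs"] by (simp add: lessThan_atLeast0)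
  have all: "(\<forall>u \<in> set vs. P u) \<longleftrightarrow> (\<forall>i < ?n. P (vs ! i))" for P
    unfolding set_conv_nth by blast
  have ex: "(\<exists>u \<in> set vs. P u) \<longleftrightarrow> (\<exists>i < ?n. P (vs ! i))" for P
    unfolding set_conv_nth by blast
  have sum: "(\<Sum>v \<in> set vs. g v) = (\<Sum>j = 0..<?n. g (vs ! j))" for g :: "'a \<Rightarrow> complex"
    using sum.reindex_bij_betw[OF bij, of g] by simp
  have key: "eigenvector (adjacency_matrix G vs) x k \<longleftrightarrow>
      dim_vec x = ?n \<and> (\<exists>i < ?n. vec_index x i \<noteq> 0) \<and>
      (\<forall>i < ?n. (\<Sum>j = 0..<?n. (if (vs ! i, vs ! j) \<in> parcs G then 1 else 0) * vec_index x j)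
                = k * vec_index x i)" for x
  proof (cases "dim_vec x = ?n")
    case True
    let ?A = "adjacency_matrix G vs"
    have nz: "x \<noteq> 0\<^sub>v ?n \<longleftrightarrow> (\<exists>i < ?n. vec_index x i \<noteq> 0)"
      using True by (metis dim_vec eq_vecI index_zero_vec)
    have dims: "dim_row ?A = ?n" "dim_col ?A = ?n" by (simp_all add: adjacency_matrix_def)
    have "vec_index (?A *\<^sub>v x) i =
        (\<Sum>j = 0..<?n. (if (vs ! i, vs ! j) \<in> parcs G then 1 else 0) * vec_index x j)"
      if "i < ?n" for i
      using that True
      by (simp add: adjacency_matrix_def scalar_prod_def Matrix.row_def mult_mat_vec_def)
    then have eq: "?A *\<^sub>v x = k \<cdot>\<^sub>v x \<longleftrightarrow>
        (\<forall>i < ?n. (\<Sum>j = 0..<?n. (if (vs ! i, vs ! j) \<in> parcs G then 1 else 0) * vec_index x j)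
                = k * vec_index x i)"
      unfolding Matrix.vec_eq_iff using True by (simp add: dims)
    have "x \<in> carrier_vec ?n" using True by (rule carrier_vecI)
    then show ?thesis
      unfolding eigenvector_def dims eq nz using True by (simp only: simp_thms)
  next
    case False
    then show ?thesis by (auto simp: eigenvector_def adjacency_matrix_def)
  qed
  show ?thesis
  proof
    assume ?L
    then obtain x where x: "eigenvector (adjacency_matrix G vs) x k"
      by (auto simp: eigenvalue_def)
    define f where "f v = vec_index x (the_inv_into {0..<?n} ((!) vs) v)" for v
    have f: "f (vs ! i) = vec_index x i" if "i < ?n" for i
      using that bij by (simp add: f_def the_inv_into_f_f bij_betw_def)
    show ?R
      unfolding all ex sum by (rule exI[of _ f]) (use x f in \<open>auto simp: key\<close>)
  next
    assume ?R
    then obtain f where f: "\<exists>i < ?n. f (vs ! i) \<noteq> 0"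
      "\<forall>i < ?n. (\<Sum>j = 0..<?n. (if (vs ! i, vs ! j) \<in> parcs G then 1 else 0) * f (vs ! j))
         = k * f (vs ! i)"
      unfolding all ex sum by blast
    have "eigenvector (adjacency_matrix G vs) (Matrix.vec ?n (\<lambda>i. f (vs ! i))) k"
      unfolding key using f by auto
    then show ?L unfolding eigenvalue_def by blast
  qed
qed

lemma graph_spectral_radius_eq:
  assumes "distinct vs" "set vs = pverts G"
  shows "graph_spectral_radius G = spectral_radius (adjacency_matrix G vs)"
proof -
  define ws where "ws = (SOME vs. distinct vs \<and> set vs = pverts G)"
  have ws: "distinct ws \<and> set ws = pverts G"
    unfolding ws_def by (rule someI[of _ vs]) (use assms in auto)
  have "eigenvalue (adjacency_matrix G ws) k \<longleftrightarrow> eigenvalue (adjacency_matrix G vs) k" for k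
    unfolding eigenvalue_adjacency_matrix_iff[OF conjunct1[OF ws]]
      eigenvalue_adjacency_matrix_iff[OF assms(1)] assms(2) conjunct2[OF ws] ..
  then have "spectrum (adjacency_matrix G ws) = spectrum (adjacency_matrix G vs)"
    unfolding spectrum_def by (intro Collect_cong)
  then show ?thesis
    by (simp add: graph_spectral_radius_def spectral_radius_def ws_def[symmetric])
qed

section \<open>The planar spectral extremal problem\<close>

definition planar_free_graph :: "nat \<Rightarrow> 'b pair_pre_digraph \<Rightarrow> 'a pair_pre_digraph \<Rightarrow> bool" where
  "planar_free_graph n F G \<longleftrightarrow>
     pair_graph G \<and> card (pverts G) = n \<and> planar G \<and> free_of F G"

text \<open>
  Every finite graph has an isomorphic copy with vertices in \<open>nat\<close>, so it is enough to let the
  maximum range over those. Though there are infinitely many of them, their spectral radii form a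
  finite set; see \<open>finite_spectral_radii\<close>.
\<close>

definition spex_planar :: "nat \<Rightarrow> 'b pair_pre_digraph \<Rightarrow> real" where
  "spex_planar n F =
     Max {graph_spectral_radius G | G :: nat pair_pre_digraph. planar_free_graph n F G}"

lemma finite_spectral_radii:
  "finite {graph_spectral_radius G | G :: nat pair_pre_digraph. planar_free_graph n F G}"
proof -
  let ?M = "\<lambda>R :: nat rel. Matrix.mat n n (\<lambda>p. if p \<in> R then 1 else 0 :: complex)"
  let ?T = "(\<lambda>R. spectral_radius (?M R)) ` Pow ({0..<n} \<times> {0..<n})"
  have "graph_spectral_radius G \<in> ?T" if "planar_free_graph n F G" for G :: "nat pair_pre_digraph"
  proof -
    from that have "finite (pverts G)" and n: "card (pverts G) = n"
      by (auto simp: planar_free_graph_def pair_graph_def pair_digraph_def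
          pair_fin_digraph_def pair_fin_digraph_axioms_def)
    then obtain vs where vs: "set vs = pverts G" "distinct vs"
      using finite_distinct_list by blast
    with n have len: "length vs = n" by (metis distinct_card)
    let ?R = "{(i, j). i < n \<and> j < n \<and> (vs ! i, vs ! j) \<in> parcs G}"
    have "adjacency_matrix G vs = ?M ?R"
      by (rule eq_matI) (auto simp: adjacency_matrix_def len)
    with graph_spectral_radius_eq[OF vs(2,1)]
    have "graph_spectral_radius G = spectral_radius (?M ?R)"
      by (simp only:)
    moreover have "?R \<in> Pow ({0..<n} \<times> {0..<n})" by auto
    ultimately show ?thesis by (rule image_eqI)
  qed
  then have "{graph_spectral_radius G | G :: nat pair_pre_digraph. planar_free_graph n F G} \<subseteq> ?T"
    by blast
  then show ?thesis by (rule finite_subset) simp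
qed

definition extremal_graph :: "nat \<Rightarrow> 'b pair_pre_digraph \<Rightarrow> 'a pair_pre_digraph \<Rightarrow> bool" where
  "extremal_graph n F G \<longleftrightarrow>
     planar_free_graph n F G \<and> graph_spectral_radius G = spex_planar n F"

end

(*
  Let x be the entrywise modulus of an eigenvector of a planar 2C_l-free graph G whose eigenvalue has
  modulus rho(G), scaled to maximum 1; then A x >= rho(G) x. A drawing of G has no K_{3,3} minor, which
  follows from the fact that crossing chords of a Jordan curve lie on different sides. Hence G has linearly
  many edges (Mader) and three vertices have at most two common neighbours. If rho(G) is at least
  that of the fan K_2 + H(2l-3,l-2), then counting walks of length two shows that two vertices u, v carry
  almost all weight. Let A be the set of common neighbours of u and v. Excluding K_{3,3}, subdivisions of
  K_5 and 2C_l makes G[A] a linear forest. Joining all other vertices to exactly u and v does not decrease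
  the quadratic form of x, so G may be compared with a fan K_2 + H for a linear forest H.

  With rho = q + 1/q the eigenvalue equation of such a fan is rho - 1 = sum of F(s) over the orders s of
  the paths of H, where F(s) is a linear function of s minus a positive multiple of the strictly concave
  function g(s) = (1 - q^s) / (1 + q^(s+1)). Moving vertices from shorter to longer paths therefore
  increases rho, and the most unbalanced admissible partition of n - 2 is that of H(2l-3,l-2).
*)
theory Submission
  imports Defs
begin

text \<open>The parameter \<open>q\<close> is fixed once, as a solution of the equation of the
  target fan, and the weights that it defines are then put on the comparison fan, whatever its paths
  are. They satisfy the equations at all path vertices, and the optimal partition makes them a
  supersolution at the apexes. A positive supersolution bounds the Rayleigh quotient of every
  vector, hence also that of x; thus x may vanish somewhere at the outset, and turns out positive
  only in the case of equality. Sparsity is where precision is lost. The sides of a closed curve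
  exclude K_{3,3} minors from a drawing by arbitrary arcs, and Mader's argument turns this into
  fewer than 16 arcs per vertex, against fewer than 6 by Euler's formula. The price is a chain of
  numerical estimates of degrees and weights, carried on until every vertex other than u and v
  weighs less than 1/18 of v. Here 18 = 2 + 16: a vertex outside A has at most two neighbours in A,
  and the edges among such vertices can be removed in an order that meets at most 16 at a
  time.\<close>

hide_const (open) Digraph_Component.connected

section \<open>Crossing chords of a Jordan curve\<close>

text \<open>The chord \<open>c\<close> cuts the inside of the closed curve into two open pieces, one
  bounded by \<open>c1\<close> and \<open>c\<close>, the other by \<open>c2\<close> and
  \<open>c\<close>. As \<open>D\<close> avoids \<open>c\<close>, connectedness puts it in one piece,
  and the closure of that piece misses the open arc on the far side, where \<open>D\<close> should
  accumulate. \<open>D\<close> is only required to be connected, so that the interior of a chord and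
  its image under an inversion qualify alike.\<close>

lemma crossing_inside:
  fixes c1 c2 c :: "real \<Rightarrow> complex"
  assumes c1: "simple_path c1" "pathstart c1 = a" "pathfinish c1 = b"
    and c2: "simple_path c2" "pathstart c2 = a" "pathfinish c2 = b"
    and c: "simple_path c" "pathstart c = a" "pathfinish c = b"
    and "a \<noteq> b"
    and c1c2: "path_image c1 \<inter> path_image c2 = {a,b}"
    and c1c: "path_image c1 \<inter> path_image c = {a,b}"
    and c2c: "path_image c2 \<inter> path_image c = {a,b}"
    and C: "path_image c - {a,b} \<subseteq> inside (path_image c1 \<union> path_image c2)"
    and D: "connected D" "D \<subseteq> inside (path_image c1 \<union> path_image c2)" "D \<inter> path_image c = {}"
    and p: "p \<in> path_image c1 - {a,b}" "p \<in> closure D"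
    and q: "q \<in> path_image c2 - {a,b}" "q \<in> closure D"
  shows False
proof -
  let ?J = "path_image c1 \<union> path_image c2"
  have "path_image c - {a,b} \<noteq> {}"
    using simple_path_endless[OF c(1)] c connected_simple_path_endless[OF c(1)]
    by (metis nonempty_simple_path_endless)
  with C have ne: "path_image c \<inter> inside ?J \<noteq> {}" by blast
  obtain e1: "inside (path_image c1 \<union> path_image c) \<inter> inside (path_image c2 \<union> path_image c) = {}"
    and e2: "inside (path_image c1 \<union> path_image c) \<union> inside (path_image c2 \<union> path_image c) \<union>
           (path_image c - {a,b}) = inside ?J"
    using split_inside_simple_closed_curve[OF c1 c2 c \<open>a \<noteq> b\<close> c1c2 c1c c2c ne] by blast
  have cl: "closed (path_image c1 \<union> path_image c)" "closed (path_image c2 \<union> path_image c)"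
    using c1 c2 c by (auto intro!: closed_Un closed_simple_path_image)
  have o: "open (inside (path_image c1 \<union> path_image c))" "open (inside (path_image c2 \<union> path_image c))"
    using cl open_inside by auto
  have cls: "closure (inside S) \<subseteq> inside S \<union> S" if "closed S" for S :: "complex set"
    using closure_inside_subset[OF that] by blast
  have noJ: "x \<notin> ?J" if "x \<in> inside ?J" for x
    using that inside_no_overlap[of ?J] by blast
  have sub: "D \<subseteq> inside (path_image c1 \<union> path_image c) \<union> inside (path_image c2 \<union> path_image c)"
    using D e2 by blast
  then consider "D \<subseteq> inside (path_image c1 \<union> path_image c)" | "D \<subseteq> inside (path_image c2 \<union> path_image c)"
    using connectedD[OF D(1) o] e1 by blast
  then show False
  proof cases
    case 1
    then have "q \<in> inside (path_image c1 \<union> path_image c) \<union> (path_image c1 \<union> path_image c)"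
      using cls[OF cl(1)] q closure_mono[OF 1] by blast
    then show False using q c1c2 c2c e2 noJ by blast
  next
    case 2
    then have "p \<in> inside (path_image c2 \<union> path_image c) \<union> (path_image c2 \<union> path_image c)"
      using cls[OF cl(2)] p closure_mono[OF 2] by blast
    then show False using p c1c2 c1c e2 noJ by blast
  qed
qed

text \<open>Reduces chords outside a closed curve to chords inside one. The inversion at an inner
  point \<open>z0\<close> sends the punctured inside to an unbounded connected set, hence outside
  the image curve; so the inside of the image curve has to be met by the image of the outside with 0
  added, which is connected.\<close>

lemma inversion_outside_to_inside:
  fixes g :: "real \<Rightarrow> complex"
  assumes g: "simple_path g" "pathfinish g = pathstart g" and z0: "z0 \<in> inside (path_image g)"
  defines "f \<equiv> \<lambda>z. inverse (z - z0)"
  shows "f ` outside (path_image g) \<subseteq> inside (f ` path_image g)"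
proof -
  let ?J = "path_image g"
  have J: "connected (inside ?J)" "open (inside ?J)" "connected (outside ?J)" "\<not> bounded (outside ?J)"
    "inside ?J \<inter> outside ?J = {}" "inside ?J \<union> outside ?J = - ?J"
    using Jordan_inside_outside[OF g] by auto
  have z0J: "z0 \<notin> ?J" "z0 \<notin> outside ?J" using z0 J by blast+
  have cont: "continuous_on (- {z0}) f"
    unfolding f_def by (intro continuous_intros) auto
  \<comment> \<open>\<open>inverse 0 = 0\<close> makes \<open>f\<close> injective on the whole
    plane, with \<open>z0\<close> sent to 0.\<close>
  have inj: "inj f" unfolding f_def inj_on_def by auto
  have fnz: "f z \<noteq> 0" if "z \<noteq> z0" for z using that by (simp add: f_def)
  have g': "simple_path (f \<circ> g)"
  proof (rule simple_path_continuous_image[OF g(1)])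
    show "continuous_on ?J f" using cont z0J by (auto intro: continuous_on_subset)
    show "inj_on f ?J" using inj by (rule inj_on_subset) auto
  qed
  have g'2: "pathfinish (f \<circ> g) = pathstart (f \<circ> g)"
    using g(2) by (simp add: pathfinish_compose pathstart_compose)
  have im: "path_image (f \<circ> g) = f ` ?J" by (simp add: path_image_compose)
  let ?K = "f ` ?J"
  have K: "inside ?K \<noteq> {}" "open (inside ?K)" "open (outside ?K)" "bounded (inside ?K)"
    "inside ?K \<inter> outside ?K = {}" "inside ?K \<union> outside ?K = - ?K"
    using Jordan_inside_outside[OF g' g'2] unfolding im by auto
  have dich: "S \<subseteq> inside ?K \<or> S \<subseteq> outside ?K" if "connected S" "S \<subseteq> - ?K" for S
  proof (rule ccontr)
    assume "\<not> ?thesis"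
    then have "inside ?K \<inter> S \<noteq> {}" "outside ?K \<inter> S \<noteq> {}" using K(6) that(2) by blast+
    moreover have s: "inside ?K \<inter> outside ?K \<inter> S = {}" "S \<subseteq> inside ?K \<union> outside ?K" unfolding K(5,6) using that(2) by simp_all
    ultimately show False using connectedD[OF that(1) K(2,3) s] by simp
  qed
  \<comment> \<open>The added 0 is the image of infinity: it is a limit of values of
    \<open>f\<close> on the unbounded outside, so adding it keeps that image connected.\<close>
  let ?U = "f ` (inside ?J - {z0})" and ?V = "insert 0 (f ` outside ?J)"
  have conU: "connected ?U"
  proof (rule connected_continuous_image)
    show "continuous_on (inside ?J - {z0}) f" using cont by (rule continuous_on_subset) auto
    show "connected (inside ?J - {z0})"
      by (rule connected_open_delete) (use J in auto)
  qed
  have nK: "f z \<notin> ?K" if "z \<notin> ?J" for z using inj that by (simp add: inj_image_mem_iff)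
  have in_out: "z \<in> inside ?J \<or> z \<in> outside ?J \<longleftrightarrow> z \<notin> ?J" for z
    using J(6) by (metis Compl_iff Un_iff)
  have UK: "?U \<subseteq> - ?K"
    unfolding image_subset_iff Compl_iff using nK in_out by (metis DiffD1)
  obtain e where e: "e > 0" "ball z0 e \<subseteq> inside ?J"
    using J(2) z0 openE by blast
  have unb: "\<not> bounded ?U"
  proof
    assume "bounded ?U"
    then obtain B where B: "B > 0" "\<And>x. x \<in> ?U \<Longrightarrow> norm x \<le> B" by (metis bounded_pos)
    define r where "r = min (e/2) (1 / (2 * B))"
    have r: "r > 0" "r < e" "r \<le> 1 / (2*B)" using e B by (auto simp: r_def)
    let ?z = "z0 + of_real r"
    have "?z \<in> ball z0 e" using r by (simp add: dist_norm)
    with e r have "f ?z \<in> ?U" by auto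
    then have "norm (f ?z) \<le> B" by (rule B)
    moreover have "norm (f ?z) = 1 / r" using r by (simp add: f_def norm_inverse inverse_eq_divide norm_divide)
    ultimately have "1 / r \<le> B" by simp
    then have "1 \<le> B * r" using r by (simp add: pos_divide_le_eq)
    moreover have "B * r \<le> B * (1 / (2 * B))" using r B by (intro mult_left_mono) auto
    ultimately show False using B by simp
  qed
  have Uo: "?U \<subseteq> outside ?K"
    using dich[OF conU UK] bounded_subset[OF K(4)] unb by metis
  have "connected (f ` outside ?J)"
    by (rule connected_continuous_image)
      (use J z0J cont in \<open>auto intro: continuous_on_subset\<close>)
  moreover have "0 \<in> closure (f ` outside ?J)"
    unfolding closure_approachable
  proof (intro allI impI)
    fix \<epsilon> :: real assume "\<epsilon> > 0"
    obtain z where z: "z \<in> outside ?J" "norm z > norm z0 + 1 / \<epsilon>"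
      using J(4) unfolding bounded_iff by (meson not_le)
    have "norm (z - z0) > 1 / \<epsilon>" using z(2) norm_triangle_ineq2[of z z0] by linarith
    then have "inverse (norm (z - z0)) < \<epsilon>" using \<open>\<epsilon> > 0\<close>
      by (metis inverse_eq_divide inverse_inverse_eq less_imp_inverse_less positive_imp_inverse_positive)
    then have "dist (f z) 0 < \<epsilon>" by (simp add: f_def norm_inverse)
    with z show "\<exists>y\<in>f ` outside ?J. dist y 0 < \<epsilon>" by blast
  qed
  ultimately have conV: "connected ?V"
    using connected_intermediate_closure[of "f ` outside ?J" ?V] closure_subset[of "f ` outside ?J"] by blast
  have "0 \<notin> ?K" using fnz z0J by force
  then have VK: "?V \<subseteq> - ?K"
    unfolding insert_subset image_subset_iff Compl_iff using nK in_out by metis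
  have "inside ?K \<subseteq> ?U \<union> ?V"
  proof
    fix w assume w: "w \<in> inside ?K"
    show "w \<in> ?U \<union> ?V"
    proof (cases "w = 0")
      case False
      let ?z = "z0 + inverse w"
      have fz: "f ?z = w" by (simp add: f_def)
      then have "?z \<notin> ?J" using w inside_no_overlap[of ?K] by (metis disjoint_iff imageI)
      then have "?z \<in> inside ?J - {z0} \<or> ?z \<in> outside ?J" using in_out False by auto
      then show ?thesis using fz by (metis UnI1 UnI2 imageI insertI2)
    qed auto
  qed
  moreover obtain w where "w \<in> inside ?K" using K(1) by blast
  ultimately have "w \<in> inside ?K" "w \<in> ?V" using Uo K(5) by (metis Un_iff disjoint_iff subsetD)+
  then have "?V \<subseteq> inside ?K" using dich[OF conV VK] K(5) by (metis disjoint_iff subsetD)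
  then show ?thesis by blast
qed

text \<open>An arc is kept as a point set with named ends, since the arguments below only join,
  intersect and compare images; a parametrisation is recovered from the existential.\<close>

definition arc_between :: "complex \<Rightarrow> complex \<Rightarrow> complex set \<Rightarrow> bool" where
  "arc_between a b S \<longleftrightarrow> (\<exists>g. Path_Connected.arc g \<and> pathstart g = a \<and> pathfinish g = b \<and> path_image g = S)"

lemma arc_between_sym: "arc_between a b S \<Longrightarrow> arc_between b a S"
  unfolding arc_between_def
  by (metis arc_reversepath path_image_reversepath pathfinish_reversepath pathstart_reversepath)

lemma arc_between_join:
  assumes "arc_between a b S" "arc_between b c T" "S \<inter> T = {b}"
  shows "arc_between a c (S \<union> T)"
  using assms unfolding arc_between_def
  by (metis arc_join path_image_join pathfinish_join pathstart_join subset_refl)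

lemma arc_between_neq: "arc_between a b S \<Longrightarrow> a \<noteq> b"
  unfolding arc_between_def using arc_distinct_ends by blast

lemma arc_between_ends: "arc_between a b S \<Longrightarrow> a \<in> S \<and> b \<in> S"
  unfolding arc_between_def using pathstart_in_path_image pathfinish_in_path_image by blast

lemma arc_between_open_connected:
  assumes "arc_between a b S" shows "connected (S - {a,b})" "a \<in> closure (S - {a,b})" "b \<in> closure (S - {a,b})"
proof -
  obtain g where g: "Path_Connected.arc g" "pathstart g = a" "pathfinish g = b" "path_image g = S"
    using assms unfolding arc_between_def by blast
  then have sp: "simple_path g" by (simp add: arc_imp_simple_path)
  show con: "connected (S - {a,b})" using connected_simple_path_endless[OF sp] g by simp
  have "S - {a,b} = g ` {0<..<1}" using simple_path_endless[OF sp] g by simp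
  moreover have "g ` closure {0<..<1} \<subseteq> closure (g ` {0<..<1})"
    by (rule image_closure_subset)
      (use sp in \<open>auto simp: simple_path_def path_def closure_subset\<close>)
  ultimately have "S \<subseteq> closure (S - {a,b})"
    using g by (simp add: path_image_def)
  then show "a \<in> closure (S - {a,b})" "b \<in> closure (S - {a,b})"
    using arc_between_ends[OF assms] by auto
qed


lemma arc_between_closed: "arc_between a b S \<Longrightarrow> closed S"
  unfolding arc_between_def using closed_arc_image by blast

text \<open>The ends of \<open>D\<close> separate the ends of \<open>C\<close> on the closed curve.
  Both chords inside contradicts \<open>crossing_inside\<close>; both outside becomes the same case
  after an inversion at an inner point. Stated as an equivalence, crossing turns into a
  propositional parity condition on sides.\<close>

lemma crossing_chords:
  assumes C1: "arc_between a b C1" and C2: "arc_between a b C2" and C12: "C1 \<inter> C2 = {a,b}"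
    and C: "arc_between a b C" "C \<inter> (C1 \<union> C2) = {a,b}"
    and D: "arc_between p q D" "D \<inter> (C1 \<union> C2) = {p,q}"
    and p: "p \<in> C1 - {a,b}" and q: "q \<in> C2 - {a,b}" and CD: "C \<inter> D = {}"
  shows "C - {a,b} \<subseteq> inside (C1 \<union> C2) \<longleftrightarrow> \<not> D - {p,q} \<subseteq> inside (C1 \<union> C2)"
proof -
  let ?J = "C1 \<union> C2"
  obtain g1 where g1: "Path_Connected.arc g1" "pathstart g1 = a" "pathfinish g1 = b" "path_image g1 = C1"
    using C1 unfolding arc_between_def by blast
  obtain g2 where g2: "Path_Connected.arc g2" "pathstart g2 = a" "pathfinish g2 = b" "path_image g2 = C2"
    using C2 unfolding arc_between_def by blast
  obtain g where g: "Path_Connected.arc g" "pathstart g = a" "pathfinish g = b" "path_image g = C"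
    using C unfolding arc_between_def by blast
  have sp: "simple_path g1" "simple_path g2" "simple_path g"
    using g1 g2 g by (simp_all add: arc_imp_simple_path)
  have ab: "a \<noteq> b" using C1 arc_between_neq by blast
  have int: "path_image g1 \<inter> path_image g2 = {a,b}" "path_image g1 \<inter> path_image g = {a,b}"
    "path_image g2 \<inter> path_image g = {a,b}"
    using g1 g2 g C12 C arc_between_ends[OF C1] arc_between_ends[OF C2] by blast+
  define h where "h = g1 +++ reversepath g2"
  have h: "simple_path h" "pathfinish h = pathstart h" "path_image h = ?J"
    using g1 g2 int ab by (auto simp: h_def simple_path_join_loop_eq arc_reversepath path_image_join)
  have J: "open (inside ?J)" "open (outside ?J)" "inside ?J \<inter> outside ?J = {}"
    "inside ?J \<union> outside ?J = - ?J" "inside ?J \<noteq> {}" "outside ?J \<noteq> {}"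
    using Jordan_inside_outside[OF h(1,2)] h(3) by simp_all
  have dich: "S \<subseteq> inside ?J \<or> S \<subseteq> outside ?J" if S: "connected S" "S \<inter> ?J = {}" for S
  proof (rule ccontr)
    assume "\<not> ?thesis"
    moreover have "S \<subseteq> inside ?J \<union> outside ?J" using S(2) J(4) by (simp add: disjoint_eq_subset_Compl)
    ultimately have "inside ?J \<inter> S \<noteq> {}" "outside ?J \<inter> S \<noteq> {}" by blast+
    moreover have "inside ?J \<inter> outside ?J \<inter> S = {}" using J(3) by simp
    ultimately show False
      using connectedD[OF S(1) J(1,2)] \<open>S \<subseteq> inside ?J \<union> outside ?J\<close> by simp
  qed
  note Co = arc_between_open_connected[OF C(1)] and Do = arc_between_open_connected[OF D(1)]
  have CJ: "(C - {a,b}) \<inter> ?J = {}" and DJ: "(D - {p,q}) \<inter> ?J = {}" using C D by blast+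
  have ne: "C - {a,b} \<noteq> {}" "D - {p,q} \<noteq> {}" using Co(2) Do(2) by (metis closure_empty empty_iff)+
  have noin: "\<not> (C - {a,b} \<subseteq> inside ?J \<and> D - {p,q} \<subseteq> inside ?J)"
  proof
    assume A: "C - {a,b} \<subseteq> inside ?J \<and> D - {p,q} \<subseteq> inside ?J"
    show False
      by (rule crossing_inside[OF sp(1) g1(2,3) sp(2) g2(2,3) sp(3) g(2,3) ab int, of "D - {p,q}" p q])
        (use A g1 g2 g p q Do CD in auto)
  qed
  have noout: "\<not> (C - {a,b} \<subseteq> outside ?J \<and> D - {p,q} \<subseteq> outside ?J)"
  proof
    assume A: "C - {a,b} \<subseteq> outside ?J \<and> D - {p,q} \<subseteq> outside ?J"
    obtain z0 where z0: "z0 \<in> inside ?J" using J(5) by blast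
    define f where "f = (\<lambda>z. inverse (z - z0))"
    have oi: "f ` outside ?J \<subseteq> inside (f ` ?J)"
      using inversion_outside_to_inside[OF h(1,2)] h(3) z0 by (simp add: f_def)
    have inj: "inj f" unfolding f_def inj_on_def by auto
    have z0J: "z0 \<notin> ?J" "z0 \<notin> outside ?J" using z0 J(3,4) by blast+
    then have z0CD: "z0 \<notin> C" "z0 \<notin> D" using A C(2) D(2) by blast+
    have cont: "continuous_on S f" if "z0 \<notin> S" for S
      unfolding f_def using that by (intro continuous_intros) auto
    have im: "path_image (f \<circ> k) = f ` path_image k" for k by (simp add: path_image_compose)
    have sp': "simple_path (f \<circ> k)" if "simple_path k" "z0 \<notin> path_image k" for k
      using that cont inj by (intro simple_path_continuous_image) (auto intro: inj_on_subset)
    have fm: "f x \<in> f ` S \<longleftrightarrow> x \<in> S" for x S using inj by (simp add: inj_image_mem_iff)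
    have feq: "f x = f y \<longleftrightarrow> x = y" for x y using inj by (simp add: inj_eq)
    have fI: "f ` S \<inter> f ` T = f ` (S \<inter> T)" for S T using inj by (simp add: image_Int)
    have fD: "f ` S - {f x, f y} = f ` (S - {x, y})" for S x y
      using inj by (auto simp: image_set_diff)
    have fin: "f x \<in> closure (f ` (D - {p,q}))" if "x \<in> closure (D - {p,q})" for x
    proof -
      have "closure (D - {p,q}) \<subseteq> D" using arc_between_closed[OF D(1)] by (intro closure_minimal) auto
      then have "f ` closure (D - {p,q}) \<subseteq> closure (f ` (D - {p,q}))"
        using z0CD by (intro image_closure_subset cont closure_subset closed_closure) auto
      with that show ?thesis by blast
    qed
    show False
    proof (rule crossing_inside[of "f \<circ> g1" "f a" "f b" "f \<circ> g2" "f \<circ> g" "f ` (D - {p,q})" "f p" "f q"])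
      show "simple_path (f \<circ> g1)" "simple_path (f \<circ> g2)" "simple_path (f \<circ> g)"
        using sp g1 g2 g z0J z0CD by (auto intro!: sp')
      show "pathstart (f \<circ> g1) = f a" "pathfinish (f \<circ> g1) = f b" "pathstart (f \<circ> g2) = f a"
        "pathfinish (f \<circ> g2) = f b" "pathstart (f \<circ> g) = f a" "pathfinish (f \<circ> g) = f b"
        using g1 g2 g by (simp_all add: pathstart_compose pathfinish_compose)
      show "f a \<noteq> f b" using ab feq by simp
      show "path_image (f \<circ> g1) \<inter> path_image (f \<circ> g2) = {f a, f b}"
        "path_image (f \<circ> g1) \<inter> path_image (f \<circ> g) = {f a, f b}"
        "path_image (f \<circ> g2) \<inter> path_image (f \<circ> g) = {f a, f b}"
        unfolding im fI int by auto
      show "path_image (f \<circ> g) - {f a, f b} \<subseteq> inside (path_image (f \<circ> g1) \<union> path_image (f \<circ> g2))"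
        unfolding im fD image_Un[symmetric] g1(4) g2(4) g(4) using A oi by blast
      show "connected (f ` (D - {p,q}))"
        using Do(1) z0CD by (intro connected_continuous_image cont) auto
      show "f ` (D - {p,q}) \<subseteq> inside (path_image (f \<circ> g1) \<union> path_image (f \<circ> g2))"
        unfolding im fD image_Un[symmetric] g1(4) g2(4) g(4) using A oi by blast
      show "f ` (D - {p,q}) \<inter> path_image (f \<circ> g) = {}"
        unfolding im fI g(4) using CD by blast
      show "f p \<in> path_image (f \<circ> g1) - {f a, f b}" using p unfolding im fD fm g1(4) by simp
      show "f q \<in> path_image (f \<circ> g2) - {f a, f b}" using q unfolding im fD fm g2(4) by simp
      show "f p \<in> closure (f ` (D - {p,q}))" "f q \<in> closure (f ` (D - {p,q}))"
        using Do by (auto intro: fin)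
    qed
  qed
  show ?thesis
    using noin noout dich[OF Co(1) CJ] dich[OF Do(1) DJ] by blast
qed

lemma no_K33_arcs:
  fixes a b :: "nat \<Rightarrow> complex"
  assumes arcs: "\<And>i j. i < 3 \<Longrightarrow> j < 3 \<Longrightarrow> arc_between (a i) (b j) (P i j)"
    and row: "\<And>i j j'. i < 3 \<Longrightarrow> j < 3 \<Longrightarrow> j' < 3 \<Longrightarrow> j \<noteq> j' \<Longrightarrow> P i j \<inter> P i j' = {a i}"
    and col: "\<And>i i' j. i < 3 \<Longrightarrow> i' < 3 \<Longrightarrow> j < 3 \<Longrightarrow> i \<noteq> i' \<Longrightarrow> P i j \<inter> P i' j = {b j}"
    and off: "\<And>i i' j j'. i < 3 \<Longrightarrow> i' < 3 \<Longrightarrow> j < 3 \<Longrightarrow> j' < 3 \<Longrightarrow> i \<noteq> i' \<Longrightarrow> j \<noteq> j' \<Longrightarrow>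
      P i j \<inter> P i' j' = {}"
  shows False
proof -
  \<comment> \<open>Arbitrary distinct indices let three rotations of the one hexagon give all three
    pairs of long diagonals. The hexagon is cut at \<open>a i0\<close> and \<open>b j1\<close>; the
    second diagonal joins \<open>a i1\<close> on one half to \<open>b j2\<close> on the
    other.\<close>
  have key: "P i0 j1 - {a i0, b j1} \<subseteq> inside (P i0 j0 \<union> P i1 j0 \<union> P i1 j1 \<union> P i2 j1 \<union> P i2 j2 \<union> P i0 j2)
    \<longleftrightarrow> \<not> P i1 j2 - {a i1, b j2} \<subseteq> inside (P i0 j0 \<union> P i1 j0 \<union> P i1 j1 \<union> P i2 j1 \<union> P i2 j2 \<union> P i0 j2)"
    if i: "i0 < 3" "i1 < 3" "i2 < 3" "i0 \<noteq> i1" "i0 \<noteq> i2" "i1 \<noteq> i2"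
    and j: "j0 < 3" "j1 < 3" "j2 < 3" "j0 \<noteq> j1" "j0 \<noteq> j2" "j1 \<noteq> j2" for i0 i1 i2 j0 j1 j2
  proof -
    note ij = i j i(4-6)[symmetric] j(4-6)[symmetric]
    have A: "arc_between (a i0) (b j0) (P i0 j0)" "arc_between (b j0) (a i1) (P i1 j0)"
      "arc_between (a i1) (b j1) (P i1 j1)" "arc_between (b j1) (a i2) (P i2 j1)"
      "arc_between (a i2) (b j2) (P i2 j2)" "arc_between (b j2) (a i0) (P i0 j2)"
      "arc_between (a i0) (b j1) (P i0 j1)" "arc_between (a i1) (b j2) (P i1 j2)"
      using arcs ij arc_between_sym by metis+
    note E = A[THEN arc_between_ends]
    have I: "P i0 j0 \<inter> P i1 j0 = {b j0}" "P i1 j0 \<inter> P i1 j1 = {a i1}" "P i0 j0 \<inter> P i1 j1 = {}"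
      "P i2 j1 \<inter> P i2 j2 = {a i2}" "P i2 j2 \<inter> P i0 j2 = {b j2}" "P i2 j1 \<inter> P i0 j2 = {}"
      "P i0 j0 \<inter> P i2 j1 = {}" "P i0 j0 \<inter> P i2 j2 = {}" "P i0 j0 \<inter> P i0 j2 = {a i0}"
      "P i1 j0 \<inter> P i2 j1 = {}" "P i1 j0 \<inter> P i2 j2 = {}" "P i1 j0 \<inter> P i0 j2 = {}"
      "P i1 j1 \<inter> P i2 j1 = {b j1}" "P i1 j1 \<inter> P i2 j2 = {}" "P i1 j1 \<inter> P i0 j2 = {}"
      "P i0 j1 \<inter> P i0 j0 = {a i0}" "P i0 j1 \<inter> P i1 j0 = {}" "P i0 j1 \<inter> P i1 j1 = {b j1}"
      "P i0 j1 \<inter> P i2 j1 = {b j1}" "P i0 j1 \<inter> P i2 j2 = {}" "P i0 j1 \<inter> P i0 j2 = {a i0}"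
      "P i1 j2 \<inter> P i0 j0 = {}" "P i1 j2 \<inter> P i1 j0 = {a i1}" "P i1 j2 \<inter> P i1 j1 = {a i1}"
      "P i1 j2 \<inter> P i2 j1 = {}" "P i1 j2 \<inter> P i2 j2 = {b j2}" "P i1 j2 \<inter> P i0 j2 = {b j2}"
      "P i0 j1 \<inter> P i1 j2 = {}"
      using ij by (simp_all add: row col off)
    have C1: "arc_between (a i0) (b j1) (P i0 j0 \<union> P i1 j0 \<union> P i1 j1)"
      by (rule arc_between_join[OF arc_between_join[OF A(1,2)] A(3)]) (use I in auto)
    have C2: "arc_between (b j1) (a i0) (P i2 j1 \<union> P i2 j2 \<union> P i0 j2)"
      by (rule arc_between_join[OF arc_between_join[OF A(4,5)] A(6)]) (use I in auto)
    have U: "P i0 j0 \<union> P i1 j0 \<union> P i1 j1 \<union> P i2 j1 \<union> P i2 j2 \<union> P i0 j2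
      = (P i0 j0 \<union> P i1 j0 \<union> P i1 j1) \<union> (P i2 j1 \<union> P i2 j2 \<union> P i0 j2)" by blast
    have c12: "(P i0 j0 \<union> P i1 j0 \<union> P i1 j1) \<inter> (P i2 j1 \<union> P i2 j2 \<union> P i0 j2) = {a i0, b j1}"
      unfolding Int_Un_distrib Int_Un_distrib2 by (simp add: I insert_commute)
    have cc: "P i0 j1 \<inter> ((P i0 j0 \<union> P i1 j0 \<union> P i1 j1) \<union> (P i2 j1 \<union> P i2 j2 \<union> P i0 j2)) = {a i0, b j1}"
      unfolding Int_Un_distrib I by auto
    have dd: "P i1 j2 \<inter> ((P i0 j0 \<union> P i1 j0 \<union> P i1 j1) \<union> (P i2 j1 \<union> P i2 j2 \<union> P i0 j2)) = {a i1, b j2}"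
      unfolding Int_Un_distrib I by auto
    have p: "a i1 \<in> (P i0 j0 \<union> P i1 j0 \<union> P i1 j1) - {a i0, b j1}"
      using E I by (metis Diff_iff Int_iff UnI2 empty_iff insert_iff)
    have q: "b j2 \<in> (P i2 j1 \<union> P i2 j2 \<union> P i0 j2) - {a i0, b j1}"
      using E I by (metis Diff_iff Int_iff UnI2 empty_iff insert_iff)
    show ?thesis
      unfolding U by (rule crossing_chords[OF C1 arc_between_sym[OF C2] c12 A(7) cc A(8) dd p q I(28)])
  qed
  \<comment> \<open>the three long diagonals of the hexagon \<open>?J\<close> pairwise cross, but \<open>?J\<close> has only two sides\<close>
  let ?J = "P 0 0 \<union> P 1 0 \<union> P 1 1 \<union> P 2 1 \<union> P 2 2 \<union> P 0 2"
  have J: "P 1 1 \<union> P 2 1 \<union> P 2 2 \<union> P 0 2 \<union> P 0 0 \<union> P 1 0 = ?J"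
    "P 2 2 \<union> P 0 2 \<union> P 0 0 \<union> P 1 0 \<union> P 1 1 \<union> P 2 1 = ?J" by blast+
  have "P 0 1 - {a 0, b 1} \<subseteq> inside ?J \<longleftrightarrow> \<not> P 1 2 - {a 1, b 2} \<subseteq> inside ?J"
    by (rule key) auto
  moreover have "P 1 2 - {a 1, b 2} \<subseteq> inside ?J \<longleftrightarrow> \<not> P 2 0 - {a 2, b 0} \<subseteq> inside ?J"
    using key[of 1 2 0 1 2 0] unfolding J by simp
  moreover have "P 2 0 - {a 2, b 0} \<subseteq> inside ?J \<longleftrightarrow> \<not> P 0 1 - {a 0, b 1} \<subseteq> inside ?J"
    using key[of 2 0 1 2 0 1] unfolding J by simp
  ultimately show False by argo
qed

lemma no_K5_arcs:
  fixes v :: "nat \<Rightarrow> complex"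
  assumes arcs: "\<And>i j. i < 5 \<Longrightarrow> j < 5 \<Longrightarrow> i \<noteq> j \<Longrightarrow> arc_between (v i) (v j) (P i j)"
    and sym: "\<And>i j. i < 5 \<Longrightarrow> j < 5 \<Longrightarrow> i \<noteq> j \<Longrightarrow> P i j = P j i"
    and inter: "\<And>i j k. i < 5 \<Longrightarrow> j < 5 \<Longrightarrow> k < 5 \<Longrightarrow> i \<noteq> j \<Longrightarrow> i \<noteq> k \<Longrightarrow> j \<noteq> k \<Longrightarrow> P i j \<inter> P i k = {v i}"
    and off: "\<And>i j k m. i < 5 \<Longrightarrow> j < 5 \<Longrightarrow> k < 5 \<Longrightarrow> m < 5 \<Longrightarrow> distinct [i,j,k,m] \<Longrightarrow> P i j \<inter> P k m = {}"
  shows False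
proof -
  \<comment> \<open>Two diagonals of the pentagon \<open>i j k m r\<close> cross when their ends
    interleave, as those of \<open>i k\<close> and \<open>j m\<close> do.\<close>
  have key: "P i k - {v i, v k} \<subseteq> inside (P i j \<union> P j k \<union> P k m \<union> P m r \<union> P r i)
    \<longleftrightarrow> \<not> P j m - {v j, v m} \<subseteq> inside (P i j \<union> P j k \<union> P k m \<union> P m r \<union> P r i)"
    if lt: "i < 5" "j < 5" "k < 5" "m < 5" "r < 5" and d: "distinct [i,j,k,m,r]" for i j k m r
  proof -
    have A: "arc_between (v i) (v j) (P i j)" "arc_between (v j) (v k) (P j k)"
      "arc_between (v k) (v m) (P k m)" "arc_between (v m) (v r) (P m r)"
      "arc_between (v r) (v i) (P r i)" "arc_between (v i) (v k) (P i k)" "arc_between (v j) (v m) (P j m)"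
      using lt d by (auto intro!: arcs)
    note E = A[THEN arc_between_ends]
    have tri: "P x y \<inter> P y z = {v y}" if "x < 5" "y < 5" "z < 5" "distinct [x,y,z]" for x y z
      using inter[of y x z] sym[of x y] that by auto
    have tri2: "P x y \<inter> P z y = {v y}" if "x < 5" "y < 5" "z < 5" "distinct [x,y,z]" for x y z
      using inter[of y x z] sym[of x y] sym[of z y] that by auto
    have tri1: "P x y \<inter> P x z = {v x}" if "x < 5" "y < 5" "z < 5" "distinct [x,y,z]" for x y z
      using inter[of x y z] that by auto
    have tri3: "P x y \<inter> P z x = {v x}" if "x < 5" "y < 5" "z < 5" "distinct [x,y,z]" for x y z
      using inter[of x y z] sym[of z x] that by auto
    have I: "P i j \<inter> P j k = {v j}" "P k m \<inter> P m r = {v m}" "P m r \<inter> P r i = {v r}" "P k m \<inter> P r i = {}"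
      "P i j \<inter> P k m = {}" "P i j \<inter> P m r = {}" "P i j \<inter> P r i = {v i}"
      "P j k \<inter> P k m = {v k}" "P j k \<inter> P m r = {}" "P j k \<inter> P r i = {}"
      "P i k \<inter> P i j = {v i}" "P i k \<inter> P j k = {v k}" "P i k \<inter> P k m = {v k}" "P i k \<inter> P m r = {}"
      "P i k \<inter> P r i = {v i}"
      "P j m \<inter> P i j = {v j}" "P j m \<inter> P j k = {v j}" "P j m \<inter> P k m = {v m}" "P j m \<inter> P m r = {v m}"
      "P j m \<inter> P r i = {}" "P i k \<inter> P j m = {}"
      by (intro tri tri1 tri2 tri3 off; use lt d in force)+
    have C1: "arc_between (v i) (v k) (P i j \<union> P j k)"
      by (rule arc_between_join[OF A(1,2)]) (use I in auto)
    have C2: "arc_between (v k) (v i) (P k m \<union> P m r \<union> P r i)"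
      by (rule arc_between_join[OF arc_between_join[OF A(3,4)] A(5)]) (use I in auto)
    have U: "P i j \<union> P j k \<union> P k m \<union> P m r \<union> P r i = (P i j \<union> P j k) \<union> (P k m \<union> P m r \<union> P r i)" by blast
    have c12: "(P i j \<union> P j k) \<inter> (P k m \<union> P m r \<union> P r i) = {v i, v k}"
      unfolding Int_Un_distrib Int_Un_distrib2 I by auto
    have cc: "P i k \<inter> ((P i j \<union> P j k) \<union> (P k m \<union> P m r \<union> P r i)) = {v i, v k}"
      unfolding Int_Un_distrib I by auto
    have dd: "P j m \<inter> ((P i j \<union> P j k) \<union> (P k m \<union> P m r \<union> P r i)) = {v j, v m}"
      unfolding Int_Un_distrib I by auto
    have ne: "v x \<noteq> v y" if "x < 5" "y < 5" "x \<noteq> y" for x y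
      using arc_between_neq[OF arcs[OF that]] .
    have "v j \<noteq> v i" "v j \<noteq> v k" "v m \<noteq> v i" "v m \<noteq> v k" using lt d ne[of j i] ne[of j k] ne[of m i] ne[of m k] by auto
    then have p: "v j \<in> (P i j \<union> P j k) - {v i, v k}" and q: "v m \<in> (P k m \<union> P m r \<union> P r i) - {v i, v k}"
      using E by auto
    show ?thesis
      unfolding U by (rule crossing_chords[OF C1 arc_between_sym[OF C2] c12 A(6) cc A(7) dd p q I(21)])
  qed
  \<comment> \<open>the crossing graph of the five diagonals of the pentagon \<open>?J\<close> is an odd cycle\<close>
  let ?J = "P 0 1 \<union> P 1 2 \<union> P 2 3 \<union> P 3 4 \<union> P 4 0"
  have J: "P 1 2 \<union> P 2 3 \<union> P 3 4 \<union> P 4 0 \<union> P 0 1 = ?J" "P 2 3 \<union> P 3 4 \<union> P 4 0 \<union> P 0 1 \<union> P 1 2 = ?J"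
    "P 3 4 \<union> P 4 0 \<union> P 0 1 \<union> P 1 2 \<union> P 2 3 = ?J" "P 4 0 \<union> P 0 1 \<union> P 1 2 \<union> P 2 3 \<union> P 3 4 = ?J" by blast+
  define ins where "ins i k \<longleftrightarrow> P i k - {v i, v k} \<subseteq> inside ?J" for i k
  have s: "ins 3 0 = ins 0 3" "ins 4 1 = ins 1 4"
    using sym[of 3 0] sym[of 4 1] by (simp_all add: ins_def insert_commute)
  have "ins 0 2 \<longleftrightarrow> \<not> ins 1 3" unfolding ins_def by (rule key) auto
  moreover have "ins 1 3 \<longleftrightarrow> \<not> ins 2 4" using key[of 1 2 3 4 0] unfolding ins_def J by simp
  moreover have "ins 2 4 \<longleftrightarrow> \<not> ins 3 0" using key[of 2 3 4 0 1] unfolding ins_def J by simp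
  moreover have "ins 3 0 \<longleftrightarrow> \<not> ins 4 1" using key[of 3 4 0 1 2] unfolding ins_def J by simp
  moreover have "ins 4 1 \<longleftrightarrow> \<not> ins 0 2" using key[of 4 0 1 2 3] sym[of 0 2]
    unfolding ins_def J by (simp add: insert_commute)
  ultimately show False by argo
qed

section \<open>Subdivisions in planar drawings\<close>

definition gpath :: "('a \<times> 'a) set \<Rightarrow> 'a list \<Rightarrow> bool" where
  "gpath E p \<longleftrightarrow> p \<noteq> [] \<and> distinct p \<and> successively (\<lambda>x y. (x, y) \<in> E) p"

text \<open>Connectedness by cuts: every proper part has an arc leaving it. In this form it passes
  through contractions without handling paths; paths are extracted by
  \<open>conn_path\<close>.\<close>

definition conn :: "('a \<times> 'a) set \<Rightarrow> 'a set \<Rightarrow> bool" where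
  "conn E S \<longleftrightarrow> S \<noteq> {} \<and> (\<forall>A \<subseteq> S. A \<noteq> {} \<longrightarrow> A \<noteq> S \<longrightarrow> (\<exists>a\<in>A. \<exists>b\<in>S - A. (a, b) \<in> E))"

lemma gpath_rev: "sym E \<Longrightarrow> gpath E p \<Longrightarrow> gpath E (rev p)"
  unfolding gpath_def by (auto simp: successively_rev elim!: successively_mono dest: symD)

lemma gpath_append:
  "gpath E (p @ q) \<longleftrightarrow> (p = [] \<and> gpath E q) \<or> (q = [] \<and> gpath E p) \<or>
     (gpath E p \<and> gpath E q \<and> set p \<inter> set q = {} \<and> (last p, hd q) \<in> E)"
  unfolding gpath_def by (auto simp: successively_append_iff)

lemma gpath_single [simp]: "gpath E [x]"
  by (simp add: gpath_def)

lemma conn_singleton [simp]: "conn E {x}"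
  by (auto simp: conn_def)

lemma conn_path:
  assumes "conn E S" "a \<in> S" "b \<in> S"
  shows "\<exists>p. gpath E p \<and> set p \<subseteq> S \<and> hd p = a \<and> last p = b"
proof -
  define Z where "Z = {z \<in> S. \<exists>p. gpath E p \<and> set p \<subseteq> S \<and> hd p = a \<and> last p = z}"
  have "a \<in> Z" unfolding Z_def using assms by (auto intro!: exI[of _ "[a]"])
  have "Z = S"
  proof (rule ccontr)
    assume "Z \<noteq> S"
    moreover have "Z \<subseteq> S" by (auto simp: Z_def)
    ultimately obtain x y where xy: "x \<in> Z" "y \<in> S - Z" "(x, y) \<in> E"
      using assms \<open>a \<in> Z\<close> unfolding conn_def by blast
    then obtain p where p: "gpath E p" "set p \<subseteq> S" "hd p = a" "last p = x" unfolding Z_def by blast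
    have "p \<noteq> []" using p by (simp add: gpath_def)
    have "y \<notin> set p"
    proof
      assume "y \<in> set p"
      then obtain q r where qr: "p = q @ y # r" by (meson split_list)
      then have "gpath E (q @ [y])" using p(1) gpath_append[of E "q @ [y]" r] by (cases "r = []") auto
      moreover have "hd (q @ [y]) = a" using qr p by (cases q) auto
      ultimately have "y \<in> Z" unfolding Z_def using qr p xy by (auto intro!: exI[of _ "q @ [y]"])
      then show False using xy by simp
    qed
    then have "gpath E (p @ [y])" using p xy by (simp add: gpath_append)
    then have "y \<in> Z" unfolding Z_def using p xy \<open>p \<noteq> []\<close> by (auto intro!: exI[of _ "p @ [y]"])
    then show False using xy by simp
  qed
  then show ?thesis using assms unfolding Z_def by blast
qed

lemma conn_path_to_set:
  assumes "conn E S" "a \<in> S" "X \<subseteq> S" "X \<noteq> {}"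
  shows "\<exists>p. gpath E p \<and> set p \<subseteq> S \<and> hd p = a \<and> set p \<inter> X = {last p}"
proof -
  obtain b where "b \<in> X" "b \<in> S" using assms by blast
  with conn_path[OF assms(1,2)] obtain p where p: "gpath E p" "set p \<subseteq> S" "hd p = a" "last p = b"
    by blast
  have "p \<noteq> []" using p by (simp add: gpath_def)
  then have "\<exists>x\<in>set p. x \<in> X" using p \<open>b \<in> X\<close> last_in_set by blast
  then obtain q x r where q: "p = q @ x # r" "x \<in> X" "\<forall>y\<in>set q. y \<notin> X"
    using split_list_first_prop[of p "\<lambda>x. x \<in> X"] by blast
  have "gpath E (q @ [x])" using p(1) q(1) gpath_append[of E "q @ [x]" r] by (cases "r = []") auto
  moreover have "hd (q @ [x]) = a" using q p by (cases q) auto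
  ultimately show ?thesis using q p by (intro exI[of _ "q @ [x]"]) auto
qed

text \<open>A path from \<open>t0\<close> to \<open>t1\<close>, and a path from \<open>t2\<close>
  stopped at its first vertex \<open>c\<close> on the former, form a tripod with centre
  \<open>c\<close>. Legs may be single vertices, so coinciding ends are covered.\<close>

lemma conn_tripod:
  assumes "sym E" "conn E S" "t0 \<in> S" "t1 \<in> S" "t2 \<in> S"
  shows "\<exists>c T0 T1 T2. gpath E T0 \<and> gpath E T1 \<and> gpath E T2 \<and> set T0 \<subseteq> S \<and> set T1 \<subseteq> S \<and> set T2 \<subseteq> S \<and>
     hd T0 = c \<and> hd T1 = c \<and> hd T2 = c \<and> last T0 = t0 \<and> last T1 = t1 \<and> last T2 = t2 \<and>
     set T0 \<inter> set T1 = {c} \<and> set T0 \<inter> set T2 = {c} \<and> set T1 \<inter> set T2 = {c}"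
proof -
  obtain p where p: "gpath E p" "set p \<subseteq> S" "hd p = t0" "last p = t1"
    using conn_path[OF assms(2-4)] by blast
  have pne: "p \<noteq> []" using p by (simp add: gpath_def)
  obtain q where q: "gpath E q" "set q \<subseteq> S" "hd q = t2" "set q \<inter> set p = {last q}"
    using conn_path_to_set[OF assms(2,5) p(2)] pne by auto
  have qne: "q \<noteq> []" using q by (simp add: gpath_def)
  define c where "c = last q"
  have "c \<in> set p" using q by (auto simp: c_def)
  then obtain p1 p2 where p12: "p = p1 @ c # p2" by (meson split_list)
  have g1: "gpath E (p1 @ [c])" using p(1) p12 gpath_append[of E "p1 @ [c]" p2] by (cases "p2 = []") auto
  have g2: "gpath E (c # p2)" using p(1) p12 gpath_append[of E p1 "c # p2"] by (auto simp: gpath_def)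
  have d: "set p1 \<inter> set p2 = {}" "c \<notin> set p1" "c \<notin> set p2" using p(1) p12 by (auto simp: gpath_def)
  have l1: "last (rev (p1 @ [c])) = t0" using p12 p(3) by (cases p1) auto
  have l0: "hd (rev (p1 @ [c])) = c" by simp
  have l2: "last (c # p2) = t1" using p12 p(4) by auto
  have l3: "last (rev q) = t2" "hd (rev q) = c" using q qne by (auto simp: last_rev hd_rev c_def)
  show ?thesis
    by (rule exI[of _ c], rule exI[of _ "rev (p1 @ [c])"], rule exI[of _ "c # p2"], rule exI[of _ "rev q"])
      (use l0 l1 l2 l3 gpath_rev[OF assms(1) g1] g2 gpath_rev[OF assms(1) q(1)] p q p12 d in
        \<open>auto simp: c_def simp del: rev_append\<close>)
qed

fun pedges :: "'a list \<Rightarrow> 'a set set" where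
  "pedges (x # y # xs) = insert {x, y} (pedges (y # xs))"
| "pedges _ = {}"

lemma pedges_subset: "e \<in> pedges p \<Longrightarrow> e \<subseteq> set p"
  by (induction p rule: pedges.induct) auto

lemma pedges_two: "distinct p \<Longrightarrow> e \<in> pedges p \<Longrightarrow> \<exists>x y. e = {x, y} \<and> x \<noteq> y"
  by (induction p rule: pedges.induct) auto

lemma pedges_cover: "length p \<ge> 2 \<Longrightarrow> v \<in> set p \<Longrightarrow> \<exists>e\<in>pedges p. v \<in> e"
proof (induction p rule: pedges.induct)
  case (1 x y xs)
  then show ?case by (cases xs) auto
qed auto

lemma pedges_graph_edges: "gpath (parcs G) p \<Longrightarrow> pedges p \<subseteq> graph_edges G"
  by (induction p rule: pedges.induct) (auto simp: gpath_def graph_edges_def)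

lemma pedges_disjoint:
  assumes "distinct p" "set p \<inter> set q \<subseteq> {c}"
  shows "pedges p \<inter> pedges q = {}"
proof (rule ccontr)
  assume "pedges p \<inter> pedges q \<noteq> {}"
  then obtain e where e: "e \<in> pedges p" "e \<in> pedges q" by blast
  then have "e \<subseteq> {c}" using pedges_subset[of e] assms by blast
  moreover obtain x y where "e = {x, y}" "x \<noteq> y" using pedges_two[OF assms(1) e(1)] by blast
  ultimately show False by auto
qed

section \<open>Drawn paths and the passage from minors to arcs\<close>

locale drawing =
  fixes G :: "'a pair_pre_digraph" and pt :: "'a \<Rightarrow> complex" and \<gamma> :: "'a set \<Rightarrow> real \<Rightarrow> complex"
  assumes graph: "pair_graph G" and drawing: "planar_drawing G pt \<gamma>"
begin

abbreviation "E \<equiv> parcs G"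
abbreviation "V \<equiv> pverts G"

lemma symE: "sym E"
proof -
  interpret pair_graph G by (rule graph)
  show ?thesis by (rule symI) (metis arcs_symmetric)
qed

lemma edge_verts: "(x, y) \<in> E \<Longrightarrow> x \<in> V \<and> y \<in> V"
proof -
  interpret pair_graph G by (rule graph)
  show "(x, y) \<in> E \<Longrightarrow> x \<in> V \<and> y \<in> V" using in_arcsD1 in_arcsD2 by blast
qed

lemma edge_neq: "(x, y) \<in> E \<Longrightarrow> x \<noteq> y"
proof -
  interpret pair_graph G by (rule graph)
  show "(x, y) \<in> E \<Longrightarrow> x \<noteq> y" using pair_no_loops by force
qed

lemma inj_pt: "inj_on pt V"
  using drawing by (simp add: planar_drawing_def)

lemma edge_arc:
  assumes "(x, y) \<in> E" shows "arc_between (pt x) (pt y) (path_image (\<gamma> {x, y}))"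
proof -
  have "{x, y} \<in> graph_edges G" using assms by (auto simp: graph_edges_def)
  then have *: "Path_Connected.arc (\<gamma> {x, y})" "{pathstart (\<gamma> {x, y}), pathfinish (\<gamma> {x, y})} = {pt x, pt y}"
    using drawing by (auto simp: planar_drawing_def)
  then have "arc_between (pathstart (\<gamma> {x, y})) (pathfinish (\<gamma> {x, y})) (path_image (\<gamma> {x, y}))"
    by (auto simp: arc_between_def)
  with *(2) show ?thesis by (metis arc_between_sym doubleton_eq_iff)
qed

lemma edges_inter:
  assumes "e \<in> graph_edges G" "e' \<in> graph_edges G" "e \<noteq> e'"
  shows "path_image (\<gamma> e) \<inter> path_image (\<gamma> e') \<subseteq> pt ` (e \<inter> e')"
proof
  fix z assume z: "z \<in> path_image (\<gamma> e) \<inter> path_image (\<gamma> e')"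
  have "(path_image (\<gamma> e) - pt ` e) \<inter> path_image (\<gamma> e') = {}"
    "(path_image (\<gamma> e') - pt ` e') \<inter> path_image (\<gamma> e) = {}"
    using assms drawing unfolding planar_drawing_def by metis+
  with z have "z \<in> pt ` e" "z \<in> pt ` e'" by blast+
  moreover have "e \<subseteq> V" "e' \<subseteq> V" using assms edge_verts by (auto simp: graph_edges_def)
  ultimately show "z \<in> pt ` (e \<inter> e')" using inj_pt by (simp add: inj_on_image_Int)
qed

definition img :: "'a list \<Rightarrow> complex set" where
  "img p = (\<Union>e\<in>pedges p. path_image (\<gamma> e))"

lemma pt_in_img:
  assumes "gpath E p" "length p \<ge> 2" "v \<in> set p" shows "pt v \<in> img p"
proof -
  obtain e where e: "e \<in> pedges p" "v \<in> e" using pedges_cover assms by metis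
  then have "e \<in> graph_edges G" using pedges_graph_edges[OF assms(1)] by blast
  then obtain x y where "e = {x, y}" "(x, y) \<in> E" unfolding graph_edges_def by auto
  then have "pt v \<in> path_image (\<gamma> e)" using edge_arc[of x y] e arc_between_ends by blast
  then show ?thesis using e by (auto simp: img_def)
qed

text \<open>Paths with at most one common vertex have no common edge, so drawn edges of the one meet
  those of the other only in images of common vertices. Asking for a subset of a singleton covers
  disjoint paths as well.\<close>

lemma img_inter:
  assumes p: "gpath E p" "length p \<ge> 2" and q: "gpath E q" "length q \<ge> 2"
    and c: "set p \<inter> set q \<subseteq> {c}"
  shows "img p \<inter> img q = pt ` (set p \<inter> set q)"
proof
  show "img p \<inter> img q \<subseteq> pt ` (set p \<inter> set q)"
  proof
    fix z assume "z \<in> img p \<inter> img q"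
    then obtain e e' where e: "e \<in> pedges p" "e' \<in> pedges q" "z \<in> path_image (\<gamma> e) \<inter> path_image (\<gamma> e')"
      by (auto simp: img_def)
    have "distinct p" using p by (simp add: gpath_def)
    then have "e \<noteq> e'" using pedges_disjoint[OF _ c] e by blast
    then have "z \<in> pt ` (e \<inter> e')"
      using edges_inter[of e e'] e pedges_graph_edges[of G] p(1) q(1) by blast
    then show "z \<in> pt ` (set p \<inter> set q)" using pedges_subset e by blast
  qed
  show "pt ` (set p \<inter> set q) \<subseteq> img p \<inter> img q"
    using pt_in_img[OF p] pt_in_img[OF q] by blast
qed

lemma path_arc:
  assumes "gpath E p" "length p \<ge> 2"
  shows "arc_between (pt (hd p)) (pt (last p)) (img p)"
  using assms
proof (induction p rule: pedges.induct)
  case (1 x y xs)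
  have xy: "(x, y) \<in> E" using 1 by (simp add: gpath_def)
  show ?case
  proof (cases xs)
    case Nil
    then show ?thesis using edge_arc[OF xy] by (simp add: img_def)
  next
    case (Cons z zs)
    have g: "gpath E (y # xs)" "gpath E [x, y]" using 1 Cons by (auto simp: gpath_def)
    have "img [x, y] \<inter> img (y # xs) = pt ` (set [x, y] \<inter> set (y # xs))"
      by (rule img_inter[of _ _ y]) (use 1 g Cons in \<open>auto simp: gpath_def\<close>)
    also have "set [x, y] \<inter> set (y # xs) = {y}" using 1 by (auto simp: gpath_def)
    finally have I: "img [x, y] \<inter> img (y # xs) = {pt y}" by simp
    have "arc_between (pt y) (pt (last (y # xs))) (img (y # xs))" using 1 g Cons by simp
    then have "arc_between (pt x) (pt (last (y # xs))) (img [x, y] \<union> img (y # xs))"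
      using arc_between_join[OF _ _ I] edge_arc[OF xy] by (simp add: img_def)
    then show ?thesis by (simp add: img_def)
  qed
qed auto

text \<open>K_{3,3} is cubic, so a tripod in each branch set reaches its three contact vertices and
  the minor turns into a subdivision, which \<open>no_K33_arcs\<close> excludes. For K_5 this
  passage fails, which is why K_5 is excluded below in subdivided form only.\<close>

lemma no_K33_model:
  assumes A: "\<And>i. i < 3 \<Longrightarrow> conn E (A i)" and B: "\<And>j. j < 3 \<Longrightarrow> conn E (B j)"
    and AA: "\<And>i i'. i < 3 \<Longrightarrow> i' < 3 \<Longrightarrow> i \<noteq> i' \<Longrightarrow> A i \<inter> A i' = {}"
    and BB: "\<And>j j'. j < 3 \<Longrightarrow> j' < 3 \<Longrightarrow> j \<noteq> j' \<Longrightarrow> B j \<inter> B j' = {}"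
    and AB: "\<And>i j. i < 3 \<Longrightarrow> j < (3::nat) \<Longrightarrow> A i \<inter> B j = {}"
    and adj: "\<And>i j. i < (3::nat) \<Longrightarrow> j < 3 \<Longrightarrow> \<exists>a\<in>A i. \<exists>b\<in>B j. (a, b) \<in> E"
  shows False
proof -
  have "\<forall>i j. \<exists>a b. i < 3 \<and> j < 3 \<longrightarrow> a \<in> A i \<and> b \<in> B j \<and> (a, b) \<in> E" using adj by blast
  then obtain s t where st: "\<And>i j. i < 3 \<Longrightarrow> j < 3 \<Longrightarrow> s i j \<in> A i \<and> t i j \<in> B j \<and> (s i j, t i j) \<in> E"
    by metis
  have less3: "(j::nat) < 3 \<longleftrightarrow> j = 0 \<or> j = 1 \<or> j = 2" for j by auto
  have tripod: "\<exists>c T. \<forall>j<3. gpath E (T j) \<and> set (T j) \<subseteq> S \<and> hd (T j) = c \<and> last (T j) = r j \<and>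
      (\<forall>j'<3. j \<noteq> j' \<longrightarrow> set (T j) \<inter> set (T j') = {c})"
    if S: "conn E S" "\<And>j. j < 3 \<Longrightarrow> r j \<in> S" for S and r :: "nat \<Rightarrow> 'a"
  proof -
    obtain c T0 T1 T2 where T: "gpath E T0" "gpath E T1" "gpath E T2" "set T0 \<subseteq> S" "set T1 \<subseteq> S" "set T2 \<subseteq> S"
      "hd T0 = c" "hd T1 = c" "hd T2 = c" "last T0 = r 0" "last T1 = r 1" "last T2 = r 2"
      "set T0 \<inter> set T1 = {c}" "set T0 \<inter> set T2 = {c}" "set T1 \<inter> set T2 = {c}"
      using conn_tripod[OF symE S(1), of "r 0" "r 1" "r 2"] S(2) by auto
    define T where "T j = (if j = 0 then T0 else if j = 1 then T1 else T2)" for j :: nat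
    have "\<forall>j<3. gpath E (T j) \<and> set (T j) \<subseteq> S \<and> hd (T j) = c \<and> last (T j) = r j \<and>
      (\<forall>j'<3. j \<noteq> j' \<longrightarrow> set (T j) \<inter> set (T j') = {c})"
      unfolding less3 by (auto simp: T_def T Int_commute)
    then show ?thesis by blast
  qed
  have "\<forall>i. \<exists>c T. i < 3 \<longrightarrow> (\<forall>j<3. gpath E (T j) \<and> set (T j) \<subseteq> A i \<and> hd (T j) = c \<and> last (T j) = s i j \<and>
      (\<forall>j'<3. j \<noteq> j' \<longrightarrow> set (T j) \<inter> set (T j') = {c}))"
  proof
    fix i
    show "\<exists>c T. i < 3 \<longrightarrow> (\<forall>j<3. gpath E (T j) \<and> set (T j) \<subseteq> A i \<and> hd (T j) = c \<and> last (T j) = s i j \<and>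
      (\<forall>j'<3. j \<noteq> j' \<longrightarrow> set (T j) \<inter> set (T j') = {c}))"
      using tripod[of "A i" "s i"] A[of i] st[of i] by (cases "i < 3") simp_all
  qed
  then obtain a T where T: "\<And>i j. i < 3 \<Longrightarrow> j < 3 \<Longrightarrow> gpath E (T i j) \<and> set (T i j) \<subseteq> A i \<and>
      hd (T i j) = a i \<and> last (T i j) = s i j"
    and TT: "\<And>i j j'. i < 3 \<Longrightarrow> j < 3 \<Longrightarrow> j' < 3 \<Longrightarrow> j \<noteq> j' \<Longrightarrow> set (T i j) \<inter> set (T i j') = {a i}"
    by metis
  have "\<forall>j. \<exists>c U. j < 3 \<longrightarrow> (\<forall>i<3. gpath E (U i) \<and> set (U i) \<subseteq> B j \<and> hd (U i) = c \<and> last (U i) = t i j \<and>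
      (\<forall>i'<3. i \<noteq> i' \<longrightarrow> set (U i) \<inter> set (U i') = {c}))"
  proof
    fix j
    show "\<exists>c U. j < 3 \<longrightarrow> (\<forall>i<3. gpath E (U i) \<and> set (U i) \<subseteq> B j \<and> hd (U i) = c \<and> last (U i) = t i j \<and>
      (\<forall>i'<3. i \<noteq> i' \<longrightarrow> set (U i) \<inter> set (U i') = {c}))"
      using tripod[of "B j" "\<lambda>i. t i j"] B[of j] st[of _ j] by (cases "j < 3") simp_all
  qed
  then obtain b U where U: "\<And>j i. j < 3 \<Longrightarrow> i < 3 \<Longrightarrow> gpath E (U j i) \<and> set (U j i) \<subseteq> B j \<and>
      hd (U j i) = b j \<and> last (U j i) = t i j"
    and UU: "\<And>j i i'. j < 3 \<Longrightarrow> i < 3 \<Longrightarrow> i' < 3 \<Longrightarrow> i \<noteq> i' \<Longrightarrow> set (U j i) \<inter> set (U j i') = {b j}"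
    by metis
  \<comment> \<open>Out along a leg from the centre \<open>a i\<close>, over the contact edge, and
    back along a leg to the centre \<open>b j\<close>.\<close>
  define L where "L i j = T i j @ rev (U j i)" for i j
  have ne: "T i j \<noteq> []" "U j i \<noteq> []" if "i < 3" "j < 3" for i j
    using T[OF that] U[OF that(2,1)] by (auto simp: gpath_def)
  have L: "gpath E (L i j)" "length (L i j) \<ge> 2" "hd (L i j) = a i" "last (L i j) = b j"
    "set (L i j) = set (T i j) \<union> set (U j i)" if ij: "i < 3" "j < 3" for i j
  proof -
    note T' = T[OF ij] and U' = U[OF ij(2,1)] and n = ne[OF ij]
    show "set (L i j) = set (T i j) \<union> set (U j i)" by (simp add: L_def)
    have "set (T i j) \<inter> set (rev (U j i)) = {}" using T' U' AB[OF ij] by auto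
    then show "gpath E (L i j)"
      unfolding L_def gpath_append using T' U' n st[OF ij] gpath_rev[OF symE] by (simp add: hd_rev)
    show "hd (L i j) = a i" "last (L i j) = b j" using T' U' n by (simp_all add: L_def last_rev)
    show "length (L i j) \<ge> 2" using n by (cases "T i j"; cases "U j i") (auto simp: L_def)
  qed
  have Lrow: "set (L i j) \<inter> set (L i j') = {a i}" if ij: "i < 3" "j < 3" "j' < 3" "j \<noteq> j'" for i j j'
  proof -
    have "set (T i j) \<inter> set (U j' i) = {}" "set (T i j') \<inter> set (U j i) = {}" "set (U j i) \<inter> set (U j' i) = {}"
      using T U AB BB ij by (meson disjoint_iff subsetD)+
    then show ?thesis using TT[OF ij] L(5) ij by (simp add: Int_Un_distrib Int_Un_distrib2 Int_commute)
  qed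
  have Lcol: "set (L i j) \<inter> set (L i' j) = {b j}" if ij: "i < 3" "i' < 3" "j < 3" "i \<noteq> i'" for i i' j
  proof -
    have "set (T i j) \<inter> set (U j i') = {}" "set (T i' j) \<inter> set (U j i) = {}" "set (T i j) \<inter> set (T i' j) = {}"
      using T U AB AA ij by (meson disjoint_iff subsetD)+
    then show ?thesis using UU[of j i i'] L(5) ij by (simp add: Int_Un_distrib Int_Un_distrib2 Int_commute)
  qed
  have Loff: "set (L i j) \<inter> set (L i' j') = {}"
    if ij: "i < 3" "i' < 3" "j < 3" "j' < 3" "i \<noteq> i'" "j \<noteq> j'" for i i' j j'
  proof -
    have "set (T i j) \<inter> set (U j' i') = {}" "set (T i' j') \<inter> set (U j i) = {}" "set (T i j) \<inter> set (T i' j') = {}"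
      "set (U j i) \<inter> set (U j' i') = {}"
      using T U AB AA BB ij by (meson disjoint_iff subsetD)+
    then show ?thesis using L(5) ij by (simp add: Int_Un_distrib Int_Un_distrib2 Int_commute)
  qed
  show False
  proof (rule no_K33_arcs[of "\<lambda>i. pt (a i)" "\<lambda>j. pt (b j)" "\<lambda>i j. img (L i j)"])
    fix i j :: nat assume ij: "i < 3" "j < 3"
    show "arc_between (pt (a i)) (pt (b j)) (img (L i j))"
      using path_arc[OF L(1,2)[OF ij]] L(3,4)[OF ij] by simp
  next
    fix i j j' :: nat assume ij: "i < 3" "j < 3" "j' < 3" "j \<noteq> j'"
    show "img (L i j) \<inter> img (L i j') = {pt (a i)}"
      using img_inter[OF L(1,2)[OF ij(1,2)] L(1,2)[OF ij(1,3)], of "a i"] Lrow[OF ij] by simp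
  next
    fix i i' j :: nat assume ij: "i < 3" "i' < 3" "j < 3" "i \<noteq> i'"
    show "img (L i j) \<inter> img (L i' j) = {pt (b j)}"
      using img_inter[OF L(1,2)[OF ij(1,3)] L(1,2)[OF ij(2,3)], of "b j"] Lcol[OF ij] by simp
  next
    fix i i' j j' :: nat assume ij: "i < 3" "i' < 3" "j < 3" "j' < 3" "i \<noteq> i'" "j \<noteq> j'"
    show "img (L i j) \<inter> img (L i' j') = {}"
      \<comment> \<open>The paths are disjoint, so any value serves as the possible common
        vertex.\<close>
      using img_inter[OF L(1,2)[OF ij(1,3)] L(1,2)[OF ij(2,4)], of undefined] Loff[OF ij] by simp
  qed
qed

lemma common_neighbours:
  assumes abc: "distinct [a, b, c]" and xyz: "distinct [x, y, z]"
    and edges: "\<And>v. v \<in> {x, y, z} \<Longrightarrow> (a, v) \<in> E \<and> (b, v) \<in> E \<and> (c, v) \<in> E"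
  shows False
proof (rule no_K33_model[of "\<lambda>i. {[a, b, c] ! i}" "\<lambda>i. {[x, y, z] ! i}"])
  fix i j :: nat
  assume i: "i < 3"
  show "conn E {[a, b, c] ! i}" "conn E {[x, y, z] ! i}" by simp_all
  assume j: "j < 3"
  have "[a, b, c] ! i \<in> set [a, b, c]" "[x, y, z] ! j \<in> set [x, y, z]" using i j by (intro nth_mem; simp)+
  then have e: "([a, b, c] ! i, [x, y, z] ! j) \<in> E" using edges[of "[x, y, z] ! j"] by auto
  then show "{[a, b, c] ! i} \<inter> {[x, y, z] ! j} = {}" using edge_neq by blast
  show "\<exists>p\<in>{[a, b, c] ! i}. \<exists>q\<in>{[x, y, z] ! j}. (p, q) \<in> E" using e by blast
  assume ij: "i \<noteq> j"
  show "{[a, b, c] ! i} \<inter> {[a, b, c] ! j} = {}" "{[x, y, z] ! i} \<inter> {[x, y, z] ! j} = {}"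
    using i j ij nth_eq_iff_index_eq[OF abc, of i j] nth_eq_iff_index_eq[OF xyz, of i j] by auto
qed

text \<open>\<open>X i j\<close> holds the inner vertices of the path between the branch vertices
  \<open>w i\<close> and \<open>w j\<close>. Paths are given for \<open>i < j\<close> only, one per
  unordered pair; \<open>P\<close> extends them symmetrically for \<open>no_K5_arcs\<close>.\<close>

lemma no_K5_subdivision:
  fixes w :: "nat \<Rightarrow> 'a"
  assumes w: "inj_on w {..<5}"
    and L: "\<And>i j. i < j \<Longrightarrow> j < 5 \<Longrightarrow> gpath E (L i j) \<and> hd (L i j) = w i \<and> last (L i j) = w j"
    and X: "\<And>i j. i < j \<Longrightarrow> j < 5 \<Longrightarrow> set (L i j) = {w i, w j} \<union> X i j"
    and Xw: "\<And>i j k. i < j \<Longrightarrow> j < 5 \<Longrightarrow> k < 5 \<Longrightarrow> w k \<notin> X i j"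
    and XX: "\<And>i j k m. i < j \<Longrightarrow> j < 5 \<Longrightarrow> k < m \<Longrightarrow> m < 5 \<Longrightarrow> (i, j) \<noteq> (k, m) \<Longrightarrow> X i j \<inter> X k m = {}"
  shows False
proof -
  have weq: "w i = w j \<longleftrightarrow> i = j" if "i < 5" "j < 5" for i j
    using w that by (auto dest: inj_onD)
  define P where "P i j = img (L (min i j) (max i j))" for i j
  have len: "length (L i j) \<ge> 2" if "i < j" "j < 5" for i j
  proof -
    have "hd (L i j) \<noteq> last (L i j)" using L[OF that] weq[of i j] that by simp
    moreover have "L i j \<noteq> []" using L[OF that] by (simp add: gpath_def)
    ultimately show ?thesis by (cases "L i j" rule: pedges.cases) auto
  qed
  have I: "set (L i j) \<inter> set (L k m) = w ` ({i, j} \<inter> {k, m})"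
    if ij: "i < j" "j < 5" "k < m" "m < 5" "(i, j) \<noteq> (k, m)" for i j k m
  proof -
    have "w i \<notin> X k m" "w j \<notin> X k m" "w k \<notin> X i j" "w m \<notin> X i j" "X i j \<inter> X k m = {}"
      using Xw[of k m] Xw[of i j] XX[OF ij] ij by auto
    then have "set (L i j) \<inter> set (L k m) = w ` {i, j} \<inter> w ` {k, m}"
      using X[of i j] X[of k m] ij by auto
    also have "\<dots> = w ` ({i, j} \<inter> {k, m})"
      by (rule inj_on_image_Int[OF w, symmetric]) (use ij in auto)
    finally show ?thesis .
  qed
  have PI: "P i j \<inter> P k m = pt ` w ` ({i, j} \<inter> {k, m})"
    if ij: "i < 5" "j < 5" "k < 5" "m < 5" "i \<noteq> j" "k \<noteq> m" "{i, j} \<noteq> {k, m}" for i j k m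
  proof -
    have mm: "{min i j, max i j} = {i, j}" "{min k m, max k m} = {k, m}" by (auto simp: min_def max_def)
    have ne: "(min i j, max i j) \<noteq> (min k m, max k m)" using ij(7) mm by (metis prod.inject)
    have lt: "min i j < max i j" "max i j < 5" "min k m < max k m" "max k m < 5" using ij by auto
    note S = I[OF lt ne, unfolded mm]
    obtain c where "{i, j} \<inter> {k, m} \<subseteq> {c}" 
    proof (cases "i \<in> {k, m}")
      case True
      then have "j \<notin> {k, m}" using ij(5-7) by auto
      then show ?thesis using that[of i] by auto
    next
      case False
      then show ?thesis using that[of j] by auto
    qed
    then have "set (L (min i j) (max i j)) \<inter> set (L (min k m) (max k m)) \<subseteq> {w c}" unfolding S by blast
    then show ?thesis
      using img_inter[of "L (min i j) (max i j)" "L (min k m) (max k m)" "w c"] L len lt S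
      unfolding P_def by metis
  qed
  show False
  proof (rule no_K5_arcs[of "\<lambda>i. pt (w i)" P])
    fix i j :: nat assume ij: "i < 5" "j < 5" "i \<noteq> j"
    have lt: "min i j < max i j" "max i j < 5" using ij by auto
    have "arc_between (pt (w (min i j))) (pt (w (max i j))) (P i j)"
      using path_arc[of "L (min i j) (max i j)"] L[OF lt] len[OF lt] by (simp add: P_def)
    then show "arc_between (pt (w i)) (pt (w j)) (P i j)"
      using arc_between_sym by (cases "i < j") (auto simp: min_def max_def split: if_splits)
    show "P i j = P j i" by (simp add: P_def min.commute max.commute)
  next
    fix i j k :: nat assume "i < 5" "j < 5" "k < 5" "i \<noteq> j" "i \<noteq> k" "j \<noteq> k"
    then show "P i j \<inter> P i k = {pt (w i)}" using PI[of i j i k] by (auto simp: doubleton_eq_iff)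
  next
    fix i j k m :: nat assume "i < 5" "j < 5" "k < 5" "m < 5" "distinct [i, j, k, m]"
    then show "P i j \<inter> P k m = {}" using PI[of i j k m] by (auto simp: doubleton_eq_iff)
  qed
qed

text \<open>Branch vertices of a K_5 subdivision are \<open>u\<close>, \<open>v\<close> and the
  first three vertices of the cycle. Eight connections are edges; \<open>u\<close> and
  \<open>v\<close> are linked by \<open>L\<close>, and \<open>c0\<close> and \<open>c2\<close> by
  the rest of the cycle, which is a single edge for a triangle.\<close>

lemma no_linked_apexes_over_cycle:
  assumes c: "gpath E c" "length c \<ge> 3" "(last c, hd c) \<in> E"
    and u: "\<And>x. x \<in> set c \<Longrightarrow> (u, x) \<in> E" and v: "\<And>x. x \<in> set c \<Longrightarrow> (v, x) \<in> E"
    and L: "gpath E L" "hd L = u" "last L = v" "set L \<inter> set c = {}" and uv: "u \<noteq> v"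
  shows False
proof -
  obtain c0 c1 c2 r where cr: "c = c0 # c1 # c2 # r"
    using c(2) by (metis One_nat_def Suc_1 Suc_le_length_iff numeral_3_eq_3)
  have dc: "distinct c" using c by (simp add: gpath_def)
  have Lne: "L \<noteq> []" using L by (simp add: gpath_def)
  have uL: "u \<in> set L" "v \<in> set L" using L Lne hd_in_set last_in_set by blast+
  define w where "w i = [u, v, c0, c1, c2] ! i" for i
  have dw: "distinct [u, v, c0, c1, c2]" using dc cr uL L uv by auto
  have w: "inj_on w {..<5}"
    unfolding w_def inj_on_def using nth_eq_iff_index_eq[OF dw] by auto
  have ws: "w 0 = u" "w (Suc 0) = v" "w 2 = c0" "w 3 = c1" "w 4 = c2" by (simp_all add: w_def numeral_eq_Suc)
  have less5: "(j::nat) < 5 \<longleftrightarrow> j = 0 \<or> j = 1 \<or> j = 2 \<or> j = 3 \<or> j = 4" for j by auto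
  have c02: "gpath E (c0 # rev (c2 # r))"
  proof -
    have "gpath E (c2 # r)" "c0 \<notin> set (c2 # r)" using c(1) cr by (auto simp: gpath_def)
    then have "gpath E (rev (c2 # r))" using gpath_rev[OF symE] by blast
    moreover have "(last (c2 # r), c0) \<in> E" using c(3) cr by simp
    then have "(c0, hd (rev (c2 # r))) \<in> E" unfolding hd_rev using symE by (auto dest: symD)
    ultimately show ?thesis using gpath_append[of E "[c0]" "rev (c2 # r)"] \<open>c0 \<notin> set (c2 # r)\<close>
      by (auto simp del: rev.simps(2))
  qed
  have e2: "(w i, w j) \<in> E" if "i < j" "j < 5" "(i, j) \<noteq> (0, 1)" "(i, j) \<noteq> (2, 4)" for i j
  proof -
    have "(c0, c1) \<in> E" "(c1, c2) \<in> E" using c(1) cr by (auto simp: gpath_def)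
    then show ?thesis using that u v cr unfolding less5 by (auto simp: ws less_Suc_eq numeral_eq_Suc w_def)
  qed
  define LL where "LL i j = (if (i, j) = (0, 1) then L else if (i, j) = (2, 4) then c0 # rev (c2 # r) else [w i, w j])"
    for i j :: nat
  define X where "X i j = (if (i, j) = (0, 1) then set L - {u, v} else if (i, j) = (2, 4) then set r else {})"
    for i j :: nat
  have wr: "w k \<notin> set r" "w k \<notin> set L - {u, v}" if "k < 5" for k
    using that dc L uL cr unfolding less5 by (auto simp: ws)
  have rL: "set r \<inter> set L = {}" using L cr by auto
  show False
  proof (rule no_K5_subdivision[OF w, of LL X])
    fix i j :: nat assume ij: "i < j" "j < 5"
    show "gpath E (LL i j) \<and> hd (LL i j) = w i \<and> last (LL i j) = w j"
    proof -
      have "w i \<noteq> w j" using w ij by (auto dest!: inj_onD)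
      then show ?thesis
        using L c02 e2[OF ij] by (auto simp: LL_def ws gpath_def)
    qed
    show "set (LL i j) = {w i, w j} \<union> X i j"
      using uL by (auto simp: LL_def X_def ws)
    fix k :: nat assume "k < 5"
    then show "w k \<notin> X i j" using wr by (auto simp: X_def)
  next
    fix i j k m :: nat assume "(i, j) \<noteq> (k, m)"
    then show "X i j \<inter> X k m = {}" using rL by (auto simp: X_def)
  qed
qed

end

section \<open>Sparsity from excluded minors\<close>

definition Kmodel :: "('a \<times> 'a) set \<Rightarrow> 'a set \<Rightarrow> nat \<Rightarrow> bool" where
  "Kmodel E V r \<longleftrightarrow> (\<exists>B. (\<forall>i<r. B i \<subseteq> V \<and> conn E (B i)) \<and>
     (\<forall>i<r. \<forall>j<r. i \<noteq> j \<longrightarrow> B i \<inter> B j = {} \<and> (\<exists>a\<in>B i. \<exists>b\<in>B j. (a, b) \<in> E)))"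

text \<open>\<open>x\<close> inherits the neighbours of \<open>y\<close>, so no new vertex name is
  needed and the contracted graph lives on \<open>V - {y}\<close>.\<close>

definition contract :: "('a \<times> 'a) set \<Rightarrow> 'a set \<Rightarrow> 'a \<Rightarrow> 'a \<Rightarrow> ('a \<times> 'a) set" where
  "contract E V x y = (E \<inter> (V - {y}) \<times> (V - {y})) \<union>
     {(x, z) | z. z \<in> V - {x, y} \<and> (y, z) \<in> E} \<union> {(z, x) | z. z \<in> V - {x, y} \<and> (y, z) \<in> E}"

text \<open>Every arc that the contraction creates has \<open>x\<close> as an end and stems from an
  arc at \<open>y\<close>; returning \<open>y\<close> to a set that contains \<open>x\<close>
  therefore keeps every cut crossed. Only parts containing \<open>x\<close> are examined, the others
  being their complements by symmetry.\<close>

lemma conn_uncontract: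
  assumes "sym E" "(x, y) \<in> E" "conn (contract E V x y) S"
  shows "conn E (if x \<in> S then insert y S else S)"
proof (cases "x \<in> S")
  case False
  have "(a, b) \<in> E" if "(a, b) \<in> contract E V x y" "a \<in> S" "b \<in> S" for a b
    using that False by (auto simp: contract_def)
  then show ?thesis using assms(3) False unfolding conn_def
    by simp (metis (no_types, lifting) DiffD1 subsetD)
next
  case True
  have S: "S \<noteq> {}" and cut: "\<And>A. A \<subseteq> S \<Longrightarrow> A \<noteq> {} \<Longrightarrow> A \<noteq> S \<Longrightarrow> \<exists>a\<in>A. \<exists>b\<in>S - A. (a, b) \<in> contract E V x y"
    using assms(3) by (auto simp: conn_def)
  have E: "(a, b) \<in> E \<longleftrightarrow> (b, a) \<in> E" for a b using assms(1) by (meson symD)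
  have cutx: "\<exists>a\<in>A. \<exists>b\<in>insert y S - A. (a, b) \<in> E" if A: "A \<subseteq> insert y S" "A \<noteq> insert y S" "x \<in> A" for A
  proof (cases "y \<in> A")
    case False
    then show ?thesis using assms(2) A by blast
  next
    case yA: True
    show ?thesis
    proof (cases "A - {y} = S \<or> S \<subseteq> A")
      case True
      then show ?thesis using A yA by blast
    next
      case False
      obtain a b where ab: "a \<in> A \<inter> S" "b \<in> S - A \<inter> S" "(a, b) \<in> contract E V x y"
        using cut[of "A \<inter> S"] False A \<open>x \<in> S\<close> by auto
      then have "(a, b) \<in> E \<or> (a = x \<and> (y, b) \<in> E)" using A by (auto simp: contract_def)
      then show ?thesis using ab yA by blast
    qed
  qed
  show ?thesis
    unfolding conn_def if_P[OF True]
  proof (intro conjI allI impI)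
    fix A assume A: "A \<subseteq> insert y S" "A \<noteq> {}" "A \<noteq> insert y S"
    show "\<exists>a\<in>A. \<exists>b\<in>insert y S - A. (a, b) \<in> E"
    proof (cases "x \<in> A")
      case True
      then show ?thesis using cutx A by blast
    next
      case False
      have "\<exists>a\<in>insert y S - A. \<exists>b\<in>insert y S - (insert y S - A). (a, b) \<in> E"
        by (rule cutx) (use A False \<open>x \<in> S\<close> in auto)
      then show ?thesis using E by blast
    qed
  qed simp
qed

lemma Kmodel_uncontract:
  assumes "sym E" "(x, y) \<in> E" "x \<in> V" "y \<in> V" "Kmodel (contract E V x y) (V - {y}) r"
  shows "Kmodel E V r"
proof -
  obtain B where B: "\<And>i. i < r \<Longrightarrow> B i \<subseteq> V - {y} \<and> conn (contract E V x y) (B i)"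
    "\<And>i j. i < r \<Longrightarrow> j < r \<Longrightarrow> i \<noteq> j \<Longrightarrow> B i \<inter> B j = {} \<and> (\<exists>a\<in>B i. \<exists>b\<in>B j. (a, b) \<in> contract E V x y)"
    using assms(5) unfolding Kmodel_def by metis
  have E: "(a, b) \<in> E \<longleftrightarrow> (b, a) \<in> E" for a b using assms(1) by (meson symD)
  define C where "C i = (if x \<in> B i then insert y (B i) else B i)" for i
  have C1: "C i \<subseteq> V \<and> conn E (C i)" if "i < r" for i
    using B(1)[OF that] conn_uncontract[OF assms(1,2), of V "B i"] assms(4) by (auto simp: C_def)
  have C2: "C i \<inter> C j = {} \<and> (\<exists>a\<in>C i. \<exists>b\<in>C j. (a, b) \<in> E)" if ij: "i < r" "j < r" "i \<noteq> j" for i j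
  proof
    show "C i \<inter> C j = {}" using B(2)[OF ij] B(1)[OF ij(1)] B(1)[OF ij(2)] by (auto simp: C_def)
    obtain a b where ab: "a \<in> B i" "b \<in> B j" "(a, b) \<in> contract E V x y" using B(2)[OF ij] by blast
    then consider "(a, b) \<in> E" | "a = x" "(y, b) \<in> E" | "b = x" "(a, y) \<in> E"
      using E by (auto simp: contract_def)
    then show "\<exists>a\<in>C i. \<exists>b\<in>C j. (a, b) \<in> E"
      using ab by cases (auto simp: C_def)
  qed
  show ?thesis unfolding Kmodel_def using C1 C2 by (intro exI[of _ C]) blast
qed

text \<open>Arcs from \<open>y\<close> to a neighbour of \<open>x\<close> are lost, since they
  coincide with arcs at \<open>x\<close> after the contraction, and so is the edge \<open>xy\<close>
  itself; arcs to the other neighbours \<open>M\<close> of \<open>y\<close> survive at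
  \<open>x\<close>. Arcs are counted in both directions, whence the factor 2.\<close>

lemma contract_arcs:
  assumes "finite V" "sym E" "irrefl E" "(x, y) \<in> E" "x \<in> V" "y \<in> V"
  shows "card (E \<inter> V \<times> V) \<le> card (contract E V x y \<inter> (V - {y}) \<times> (V - {y}))
    + 2 * (1 + card {z \<in> V. (x, z) \<in> E \<and> (y, z) \<in> E})"
proof -
  let ?W = "V - {y}" and ?T = "{z \<in> V. (x, z) \<in> E \<and> (y, z) \<in> E}"
  define N M where "N = {z \<in> V. (y, z) \<in> E}" and "M = {z \<in> V - {x}. (y, z) \<in> E \<and> (x, z) \<notin> E}"
  have E: "(a, b) \<in> E \<longleftrightarrow> (b, a) \<in> E" for a b using assms(2) by (meson symD)
  have I: "(a, a) \<notin> E" for a using assms(3) by (auto simp: irrefl_def)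
  have xy: "x \<noteq> y" using assms I by auto
  have fin: "finite N" "finite M" "finite ?T" using assms by (auto simp: N_def M_def)
  have "N = insert x (?T \<union> M)" using assms E by (auto simp: N_def M_def)
  moreover have "x \<notin> ?T \<union> M" "?T \<inter> M = {}" using I by (auto simp: M_def)
  ultimately have N: "card N = 1 + card ?T + card M" using fin by (simp add: card_Un_disjoint)
  have "E \<inter> V \<times> V = (E \<inter> ?W \<times> ?W) \<union> ({y} \<times> N \<union> N \<times> {y})"
    using assms E by (auto simp: N_def)
  also have "card \<dots> \<le> card (E \<inter> ?W \<times> ?W) + card ({y} \<times> N \<union> N \<times> {y})" by (rule card_Un_le)
  also have "card ({y} \<times> N \<union> N \<times> {y}) \<le> card ({y} \<times> N) + card (N \<times> {y})" by (rule card_Un_le)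
  also have "\<dots> = 2 * card N" by (simp add: card_cartesian_product)
  finally have le: "card (E \<inter> V \<times> V) \<le> card (E \<inter> ?W \<times> ?W) + 2 * card N" by simp
  have dis: "(E \<inter> ?W \<times> ?W) \<inter> ({x} \<times> M) = {}" "((E \<inter> ?W \<times> ?W) \<union> {x} \<times> M) \<inter> (M \<times> {x}) = {}"
    using E by (auto simp: M_def)
  have "card (E \<inter> ?W \<times> ?W) + 2 * card M = card ((E \<inter> ?W \<times> ?W) \<union> {x} \<times> M \<union> M \<times> {x})"
    using dis assms(1) fin by (simp add: card_Un_disjoint card_cartesian_product)
  also have "\<dots> \<le> card (contract E V x y \<inter> ?W \<times> ?W)"
  proof (rule card_mono)
    show "finite (contract E V x y \<inter> ?W \<times> ?W)" using assms(1) by simp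
    have "y \<notin> M" using I by (auto simp: M_def)
    then show "(E \<inter> ?W \<times> ?W) \<union> {x} \<times> M \<union> M \<times> {x} \<subseteq> contract E V x y \<inter> ?W \<times> ?W"
      using xy assms by (auto simp: contract_def M_def)
  qed
  finally show ?thesis using le N by simp
qed

lemma card_arcs_sum:
  assumes "finite S"
  shows "card (E \<inter> S \<times> S) = (\<Sum>y\<in>S. card {z \<in> S. (y, z) \<in> E})"
proof -
  have "E \<inter> S \<times> S = Sigma S (\<lambda>y. {z \<in> S. (y, z) \<in> E})" by auto
  then show ?thesis using assms by simp
qed

text \<open>Mader's argument: either some edge lies in few triangles and contracting it preserves the density,
  or every neighbourhood is dense enough to contain the smaller complete minor.\<close>

lemma mader_step:
  fixes E :: "('a \<times> 'a) set"
  assumes IH: "\<And>(E :: ('a \<times> 'a) set) V. finite V \<Longrightarrow> V \<noteq> {} \<Longrightarrow> sym E \<Longrightarrow> irrefl E \<Longrightarrow>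
      c * card V \<le> card (E \<inter> V \<times> V) \<Longrightarrow> Kmodel E V r"
    and c: "c > 0" and V: "finite V" "V \<noteq> {}" "sym E" "irrefl E" "2 * c * card V \<le> card (E \<inter> V \<times> V)"
  shows "Kmodel E V (Suc r)"
  using V
proof (induction "card V" arbitrary: E V rule: less_induct)
  case less
  note V = less.prems
  have E: "(a, b) \<in> E \<longleftrightarrow> (b, a) \<in> E" for a b using V(3) by (meson symD)
  have I: "(a, a) \<notin> E" for a using V(4) by (auto simp: irrefl_def)
  show ?case
  proof (cases "\<exists>x\<in>V. \<exists>y\<in>V. (x, y) \<in> E \<and> card {z \<in> V. (x, z) \<in> E \<and> (y, z) \<in> E} < c")
    case True
    then obtain x y where xy: "x \<in> V" "y \<in> V" "(x, y) \<in> E" "card {z \<in> V. (x, z) \<in> E \<and> (y, z) \<in> E} < c" by blast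
    let ?E = "contract E V x y" and ?W = "V - {y}"
    have cW: "card V = card ?W + 1" using card_Suc_Diff1[OF V(1) xy(2)] by simp
    have "Kmodel ?E ?W (Suc r)"
    proof (rule less.hyps)
      show "card ?W < card V" using cW by simp
      show "finite ?W" "?W \<noteq> {}" using V xy I by auto
      show "sym ?E" using E by (auto simp: sym_def contract_def)
      show "irrefl ?E" using I by (auto simp: irrefl_def contract_def)
      \<comment> \<open>The edge and its fewer than \<open>c\<close> triangles cost at most
        \<open>2 * c\<close> arcs, exactly the share of the one vertex that disappears.\<close>
      have "2 * c * card V \<le> card (?E \<inter> ?W \<times> ?W) + 2 * c"
      proof -
        have "2 * (1 + card {z \<in> V. (x, z) \<in> E \<and> (y, z) \<in> E}) \<le> 2 * c" using xy(4) by simp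
        then have "card (E \<inter> V \<times> V) \<le> card (?E \<inter> ?W \<times> ?W) + 2 * c"
          using contract_arcs[OF V(1,3,4) xy(3,1,2)] by linarith
        then show ?thesis using V(5) by (rule order_trans[rotated])
      qed
      then show "2 * c * card ?W \<le> card (?E \<inter> ?W \<times> ?W)" using cW by (simp add: algebra_simps)
    qed
    then show ?thesis using Kmodel_uncontract[OF V(3) xy(3,1,2)] by blast
  next
    case False
    have "card V > 0" using V by (simp add: card_gt_0_iff)
    then have "card (E \<inter> V \<times> V) > 0" using c V(5) by (meson less_le_trans mult_pos_pos zero_less_numeral)
    then have "E \<inter> V \<times> V \<noteq> {}" by force
    then obtain x y where xy: "x \<in> V" "y \<in> V" "(x, y) \<in> E" by blast
    \<comment> \<open>Each vertex of this neighbourhood has at least \<open>c\<close> neighbours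
      within it, since its edge to \<open>x\<close> lies in that many triangles; \<open>{x}\<close>
      is the additional branch set.\<close>
    define N where "N = {z \<in> V. (x, z) \<in> E}"
    have N: "finite N" "N \<noteq> {}" "x \<notin> N" "N \<subseteq> V" using V xy I by (auto simp: N_def)
    have deg: "c \<le> card {z \<in> N. (w, z) \<in> E}" if "w \<in> N" for w
    proof -
      have "{z \<in> N. (w, z) \<in> E} = {z \<in> V. (x, z) \<in> E \<and> (w, z) \<in> E}" by (auto simp: N_def)
      then show ?thesis using False that xy by (auto simp: N_def not_less)
    qed
    have "c * card N \<le> card (E \<inter> N \<times> N)"
      unfolding card_arcs_sum[OF N(1)] using sum_mono[of N "\<lambda>_. c", OF deg] by (simp add: mult.commute)
    then have "Kmodel E N r" by (rule IH[OF N(1,2) V(3,4)])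
    then obtain B where B: "\<And>i. i < r \<Longrightarrow> B i \<subseteq> N \<and> conn E (B i)"
      "\<And>i j. i < r \<Longrightarrow> j < r \<Longrightarrow> i \<noteq> j \<Longrightarrow> B i \<inter> B j = {} \<and> (\<exists>a\<in>B i. \<exists>b\<in>B j. (a, b) \<in> E)"
      unfolding Kmodel_def by metis
    define C where "C = B(r := {x})"
    have xB: "B i \<inter> {x} = {} \<and> {x} \<inter> B i = {} \<and> (\<exists>a\<in>B i. (a, x) \<in> E \<and> (x, a) \<in> E)" if i: "i < r" for i
    proof -
      obtain a where "a \<in> B i" using B(1)[OF i] by (auto simp: conn_def)
      then show ?thesis using B(1)[OF i] N E by (auto simp: N_def)
    qed
    show ?thesis unfolding Kmodel_def
    proof (intro exI[of _ C] conjI allI impI)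
      fix i assume "i < Suc r"
      then show "C i \<subseteq> V" "conn E (C i)" using B(1)[of i] N xy by (auto simp: C_def less_Suc_eq)
      fix j assume "j < Suc r" "i \<noteq> j"
      with \<open>i < Suc r\<close> consider "i < r" "j < r" | "i = r" "j < r" | "i < r" "j = r" by linarith
      then have "C i \<inter> C j = {} \<and> (\<exists>a\<in>C i. \<exists>b\<in>C j. (a, b) \<in> E)"
        using B(2)[of i j] xB[of i] xB[of j] \<open>i \<noteq> j\<close> by cases (auto simp: C_def)
      then show "C i \<inter> C j = {}" "\<exists>a\<in>C i. \<exists>b\<in>C j. (a, b) \<in> E" by simp_all
    qed
  qed
qed

lemma Kmodel_2:
  assumes "finite V" "V \<noteq> {}" "1 * card V \<le> card (E \<inter> V \<times> V)" "irrefl E" "sym E"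
  shows "Kmodel E V 2"
proof -
  have "card V > 0" using assms by (simp add: card_gt_0_iff)
  then have "E \<inter> V \<times> V \<noteq> {}" using assms(3) by force
  then obtain x y where xy: "x \<in> V" "y \<in> V" "(x, y) \<in> E" by blast
  then have "x \<noteq> y" "(y, x) \<in> E" using assms by (auto simp: irrefl_def dest: symD)
  then show ?thesis unfolding Kmodel_def
    using xy by (intro exI[of _ "\<lambda>i. if i = 0 then {x} else {y}"]) (auto simp: less_2_cases_iff)
qed

text \<open>The threshold starts at one arc per vertex for K_2 and doubles with each further branch
  set, which gives 16 for K_6. Six branch sets are wanted because, split into three and three, they
  contain a K_{3,3} model.\<close>

lemma dense_imp_K6_model:
  fixes E :: "('a \<times> 'a) set"
  assumes "finite V" "V \<noteq> {}" "sym E" "irrefl E" "16 * card V \<le> card (E \<inter> V \<times> V)"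
  shows "Kmodel E V 6"
proof -
  have 3: "Kmodel E V 3" if "finite V" "V \<noteq> {}" "sym E" "irrefl E" "2 * card V \<le> card (E \<inter> V \<times> V)"
    for E :: "('a \<times> 'a) set" and V
  proof -
    have "Kmodel E V (Suc 2)" by (rule mader_step[where c = 1]) (use Kmodel_2 that in auto)
    then show ?thesis by (simp add: numeral_eq_Suc)
  qed
  have 4: "Kmodel E V 4" if "finite V" "V \<noteq> {}" "sym E" "irrefl E" "4 * card V \<le> card (E \<inter> V \<times> V)"
    for E :: "('a \<times> 'a) set" and V
  proof -
    have "Kmodel E V (Suc 3)" by (rule mader_step[where c = 2]) (use 3 that in auto)
    then show ?thesis by (simp add: numeral_eq_Suc)
  qed
  have 5: "Kmodel E V 5" if "finite V" "V \<noteq> {}" "sym E" "irrefl E" "8 * card V \<le> card (E \<inter> V \<times> V)"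
    for E :: "('a \<times> 'a) set" and V
  proof -
    have "Kmodel E V (Suc 4)" by (rule mader_step[where c = 4]) (use 4 that in auto)
    then show ?thesis by (simp add: numeral_eq_Suc)
  qed
  show ?thesis
  proof -
    have "Kmodel E V (Suc 5)" by (rule mader_step[where c = 8]) (use 5 assms in auto)
    then show ?thesis by (simp add: numeral_eq_Suc)
  qed
qed

context drawing
begin

lemma finiteV: "finite V"
proof -
  interpret pair_graph G by (rule graph)
  show ?thesis by (rule pair_finite_verts)
qed

lemma irreflE: "irrefl E"
  using edge_neq by (auto simp: irrefl_def)

lemma sparse:
  assumes "S \<subseteq> V" "S \<noteq> {}"
  shows "card (E \<inter> S \<times> S) < 16 * card S"
proof (rule ccontr)
  assume "\<not> ?thesis"
  then have "Kmodel E S 6"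
    using dense_imp_K6_model[OF finite_subset[OF assms(1) finiteV] assms(2) symE irreflE] by simp
  then obtain B where B: "\<And>i::nat. i < 6 \<Longrightarrow> B i \<subseteq> S \<and> conn E (B i)"
      "\<And>i j::nat. i < 6 \<Longrightarrow> j < 6 \<Longrightarrow> i \<noteq> j \<Longrightarrow> B i \<inter> B j = {} \<and> (\<exists>a\<in>B i. \<exists>b\<in>B j. (a, b) \<in> E)"
    unfolding Kmodel_def by metis
  show False
    by (rule no_K33_model[of B "\<lambda>j. B (3 + j)"]) (use B in auto)
qed

lemma codegree3:
  assumes "distinct [a, b, c]"
  shows "card {v \<in> V. (a, v) \<in> E \<and> (b, v) \<in> E \<and> (c, v) \<in> E} \<le> 2"
proof (rule ccontr)
  let ?S = "{v \<in> V. (a, v) \<in> E \<and> (b, v) \<in> E \<and> (c, v) \<in> E}"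
  assume "\<not> ?thesis"
  then have "3 \<le> card ?S" by simp
  then obtain T where "T \<subseteq> ?S" "card T = 3" by (rule obtain_subset_with_card_n)
  moreover from this obtain x y z where "T = {x, y, z}" "distinct [x, y, z]" by (auto simp: card_3_iff)
  ultimately show False by (intro common_neighbours[OF assms, of x y z]) auto
qed

end

section \<open>Spectral radius and test vectors\<close>

definition nbs :: "('a \<times> 'a) set \<Rightarrow> 'a set \<Rightarrow> 'a \<Rightarrow> 'a set" where
  "nbs E V v = {w \<in> V. (v, w) \<in> E}"

lemma finite_nbs [simp]: "finite V \<Longrightarrow> finite (nbs E V v)"
  by (simp add: nbs_def)

definition qform :: "('a \<times> 'a) set \<Rightarrow> 'a set \<Rightarrow> ('a \<Rightarrow> real) \<Rightarrow> real" where
  "qform E V x = (\<Sum>v\<in>V. \<Sum>w\<in>nbs E V v. x v * x w)"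

lemma sum_nbs:
  assumes "finite V"
  shows "(\<Sum>w\<in>nbs E V v. f w) = (\<Sum>w\<in>V. if (v, w) \<in> E then f w else (0::'b::comm_monoid_add))"
  unfolding nbs_def using assms by (simp add: sum.inter_filter)

lemma sum_nbs_swap:
  fixes f :: "'a \<Rightarrow> 'a \<Rightarrow> 'b::comm_monoid_add"
  assumes "finite V" "sym E"
  shows "(\<Sum>v\<in>V. \<Sum>w\<in>nbs E V v. f v w) = (\<Sum>v\<in>V. \<Sum>w\<in>nbs E V v. f w v)"
proof -
  have E: "(a, b) \<in> E \<longleftrightarrow> (b, a) \<in> E" for a b using assms(2) by (meson symD)
  have "(\<Sum>v\<in>V. \<Sum>w\<in>nbs E V v. f v w) = (\<Sum>v\<in>V. \<Sum>w\<in>V. if (v, w) \<in> E then f v w else 0)"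
    by (simp add: sum_nbs[OF assms(1)])
  also have "\<dots> = (\<Sum>w\<in>V. \<Sum>v\<in>V. if (v, w) \<in> E then f v w else 0)" by (rule sum.swap)
  also have "\<dots> = (\<Sum>w\<in>V. \<Sum>v\<in>V. if (w, v) \<in> E then f v w else 0)" using E by (intro sum.cong) auto
  also have "\<dots> = (\<Sum>v\<in>V. \<Sum>w\<in>nbs E V v. f w v)" by (simp add: sum_nbs[OF assms(1)])
  finally show ?thesis .
qed

text \<open>A discrete Picone identity. Each edge square expands into two diagonal terms and a mixed
  one, and the two diagonal sums agree after exchanging the ends of every edge.\<close>

lemma qform_identity:
  fixes x y :: "'a \<Rightarrow> real"
  assumes V: "finite V" "sym E" and y: "\<And>v. v \<in> V \<Longrightarrow> y v > 0"
  shows "(\<Sum>v\<in>V. \<Sum>w\<in>nbs E V v. (x v * y w - x w * y v)\<^sup>2 / (y v * y w))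
    = 2 * (\<Sum>v\<in>V. (x v)\<^sup>2 / y v * (\<Sum>w\<in>nbs E V v. y w)) - 2 * qform E V x"
proof -
  have "(\<Sum>v\<in>V. \<Sum>w\<in>nbs E V v. (x v * y w - x w * y v)\<^sup>2 / (y v * y w))
    = (\<Sum>v\<in>V. \<Sum>w\<in>nbs E V v. (x v)\<^sup>2 / y v * y w + (x w)\<^sup>2 / y w * y v - 2 * (x v * x w))"
  proof (intro sum.cong refl)
    fix v w assume "v \<in> V" "w \<in> nbs E V v"
    then have "y v > 0" "y w > 0" using y by (auto simp: nbs_def)
    then show "(x v * y w - x w * y v)\<^sup>2 / (y v * y w)
      = (x v)\<^sup>2 / y v * y w + (x w)\<^sup>2 / y w * y v - 2 * (x v * x w)"
      by (simp add: field_simps power2_eq_square)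
  qed
  also have "\<dots> = (\<Sum>v\<in>V. \<Sum>w\<in>nbs E V v. (x v)\<^sup>2 / y v * y w)
      + (\<Sum>v\<in>V. \<Sum>w\<in>nbs E V v. (x w)\<^sup>2 / y w * y v) - 2 * qform E V x"
    by (simp add: sum.distrib sum_subtractf qform_def sum_distrib_left)
  also have "(\<Sum>v\<in>V. \<Sum>w\<in>nbs E V v. (x w)\<^sup>2 / y w * y v) = (\<Sum>v\<in>V. \<Sum>w\<in>nbs E V v. (x v)\<^sup>2 / y v * y w)"
    by (rule sum_nbs_swap[OF V])
  finally show ?thesis by (simp add: sum_distrib_left)
qed

text \<open>A positive supersolution \<open>y\<close> takes the role of Perron-Frobenius theory. The
  equality clause gives proportionality along edges, on which the uniqueness of the extremal graph
  rests.\<close>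

lemma qform_le:
  fixes x y :: "'a \<Rightarrow> real"
  assumes V: "finite V" "sym E" and y: "\<And>v. v \<in> V \<Longrightarrow> y v > 0"
    and super: "\<And>v. v \<in> V \<Longrightarrow> (\<Sum>w\<in>nbs E V v. y w) \<le> \<mu> * y v"
  shows "qform E V x \<le> \<mu> * (\<Sum>v\<in>V. (x v)\<^sup>2)"
    and "qform E V x = \<mu> * (\<Sum>v\<in>V. (x v)\<^sup>2) \<Longrightarrow> (v, w) \<in> E \<Longrightarrow> v \<in> V \<Longrightarrow> w \<in> V \<Longrightarrow> x v * y w = x w * y v"
proof -
  \<comment> \<open>the defect in the Rayleigh bound is a sum of squares over the edges\<close>
  let ?S = "\<Sum>v\<in>V. \<Sum>w\<in>nbs E V v. (x v * y w - x w * y v)\<^sup>2 / (y v * y w)"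
  have pos: "(x v * y w - x w * y v)\<^sup>2 / (y v * y w) \<ge> 0" if "v \<in> V" "w \<in> nbs E V v" for v w
    using that y[of v] y[of w] by (auto simp: nbs_def)
  have "(\<Sum>v\<in>V. (x v)\<^sup>2 / y v * (\<Sum>w\<in>nbs E V v. y w)) \<le> (\<Sum>v\<in>V. \<mu> * (x v)\<^sup>2)"
  proof (rule sum_mono)
    fix v assume v: "v \<in> V"
    have "(x v)\<^sup>2 / y v * (\<Sum>w\<in>nbs E V v. y w) \<le> (x v)\<^sup>2 / y v * (\<mu> * y v)"
      using super[OF v] y[OF v] by (intro mult_left_mono) auto
    then show "(x v)\<^sup>2 / y v * (\<Sum>w\<in>nbs E V v. y w) \<le> \<mu> * (x v)\<^sup>2"
      using y[OF v] by (simp add: field_simps)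
  qed
  then have S: "?S \<le> 2 * (\<mu> * (\<Sum>v\<in>V. (x v)\<^sup>2)) - 2 * qform E V x"
    using qform_identity[where V = V and E = E and x = x and y = y, OF V y]
    unfolding sum_distrib_left[symmetric] by linarith
  have "?S \<ge> 0" using pos by (intro sum_nonneg) auto
  with S show "qform E V x \<le> \<mu> * (\<Sum>v\<in>V. (x v)\<^sup>2)" by linarith
  assume eq: "qform E V x = \<mu> * (\<Sum>v\<in>V. (x v)\<^sup>2)" and vw: "(v, w) \<in> E" "v \<in> V" "w \<in> V"
  then have w: "w \<in> nbs E V v" by (simp add: nbs_def)
  have "?S = 0" using S eq \<open>?S \<ge> 0\<close> by linarith
  then have "(\<Sum>w\<in>nbs E V v. (x v * y w - x w * y v)\<^sup>2 / (y v * y w)) = 0"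
    using vw V(1) pos by (subst (asm) sum_nonneg_eq_0_iff) (auto intro!: sum_nonneg)
  then have "(x v * y w - x w * y v)\<^sup>2 / (y v * y w) = 0"
    using w V(1) pos[OF vw(2)] by (subst (asm) sum_nonneg_eq_0_iff) auto
  then show "x v * y w = x w * y v" using y[OF vw(2)] y[OF vw(3)] by auto
qed

section \<open>The spectral radius between subsolutions and supersolutions\<close>

lemma graph_spectral_radius_cases:
  assumes "finite (pverts G)" "pverts G \<noteq> {}"
  shows "\<exists>k f. graph_spectral_radius G = cmod k \<and> (\<exists>u\<in>pverts G. f u \<noteq> 0) \<and>
           (\<forall>u\<in>pverts G. (\<Sum>v\<in>nbs (parcs G) (pverts G) u. f v) = k * f u)"
    and "(\<exists>u\<in>pverts G. f u \<noteq> 0) \<Longrightarrow> (\<And>u. u \<in> pverts G \<Longrightarrow> (\<Sum>v\<in>nbs (parcs G) (pverts G) u. f v) = k * f u)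
      \<Longrightarrow> cmod k \<le> graph_spectral_radius G"
proof -
  obtain vs where vs: "set vs = pverts G" "distinct vs"
    using finite_distinct_list assms by blast
  let ?A = "adjacency_matrix G vs"
  have A: "?A \<in> carrier_mat (length vs) (length vs)" by (simp add: adjacency_matrix_def)
  have n: "length vs > 0" using vs assms by auto
  note sr = graph_spectral_radius_eq[OF vs(2,1)]
  have iff: "eigenvalue ?A k \<longleftrightarrow> (\<exists>f. (\<exists>u\<in>pverts G. f u \<noteq> 0) \<and>
      (\<forall>u\<in>pverts G. (\<Sum>v\<in>nbs (parcs G) (pverts G) u. f v) = k * f u))" for k
    unfolding eigenvalue_adjacency_matrix_iff[OF vs(2)] vs(1) sum_nbs[OF assms(1)]
    by (simp add: if_distrib[of "\<lambda>c. c * _"] cong: if_cong)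
  show "\<exists>k f. graph_spectral_radius G = cmod k \<and> (\<exists>u\<in>pverts G. f u \<noteq> 0) \<and>
           (\<forall>u\<in>pverts G. (\<Sum>v\<in>nbs (parcs G) (pverts G) u. f v) = k * f u)"
    using spectral_radius_mem_max(1)[OF A n] iff unfolding sr spectrum_def by blast
  assume "\<exists>u\<in>pverts G. f u \<noteq> 0" "\<And>u. u \<in> pverts G \<Longrightarrow> (\<Sum>v\<in>nbs (parcs G) (pverts G) u. f v) = k * f u"
  then have "eigenvalue ?A k" unfolding iff by blast
  then show "cmod k \<le> graph_spectral_radius G"
    using spectral_radius_mem_max(2)[OF A n] unfolding sr spectrum_def by blast
qed

lemma graph_spectral_radius_subsolution:
  assumes "finite (pverts G)" "pverts G \<noteq> {}"
  obtains x :: "'a \<Rightarrow> real" where "\<And>v. x v \<ge> 0" "\<exists>v\<in>pverts G. x v \<noteq> 0"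
    "\<And>v. v \<in> pverts G \<Longrightarrow> graph_spectral_radius G * x v \<le> (\<Sum>w\<in>nbs (parcs G) (pverts G) v. x w)"
proof -
  obtain k f where kf: "graph_spectral_radius G = cmod k" "\<exists>u\<in>pverts G. f u \<noteq> 0"
    "\<And>u. u \<in> pverts G \<Longrightarrow> (\<Sum>v\<in>nbs (parcs G) (pverts G) u. f v) = k * f u"
    using graph_spectral_radius_cases(1)[OF assms] by blast
  show thesis
  proof (rule that[of "\<lambda>v. cmod (f v)"])
    fix v assume "v \<in> pverts G"
    then have "graph_spectral_radius G * cmod (f v) = cmod (\<Sum>w\<in>nbs (parcs G) (pverts G) v. f w)"
      using kf by (simp add: norm_mult)
    also have "\<dots> \<le> (\<Sum>w\<in>nbs (parcs G) (pverts G) v. cmod (f w))" by (rule norm_sum)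
    finally show "graph_spectral_radius G * cmod (f v) \<le> (\<Sum>w\<in>nbs (parcs G) (pverts G) v. cmod (f w))" .
  qed (use kf in auto)
qed

lemma qform_ge:
  assumes "\<And>v. v \<in> V \<Longrightarrow> x v \<ge> 0" "\<And>v. v \<in> V \<Longrightarrow> \<rho> * x v \<le> (\<Sum>w\<in>nbs E V v. x w)"
  shows "\<rho> * (\<Sum>v\<in>V. (x v)\<^sup>2) \<le> qform E V x"
proof -
  have "\<rho> * (\<Sum>v\<in>V. (x v)\<^sup>2) = (\<Sum>v\<in>V. x v * (\<rho> * x v))"
    by (simp add: sum_distrib_left power2_eq_square algebra_simps)
  also have "\<dots> \<le> (\<Sum>v\<in>V. x v * (\<Sum>w\<in>nbs E V v. x w))"
    using assms by (intro sum_mono mult_left_mono) auto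
  finally show ?thesis by (simp add: qform_def sum_distrib_left)
qed

lemma graph_spectral_radius_le:
  assumes G: "finite (pverts G)" "pverts G \<noteq> {}" "sym (parcs G)"
    and y: "\<And>v. v \<in> pverts G \<Longrightarrow> y v > 0"
    and super: "\<And>v. v \<in> pverts G \<Longrightarrow> (\<Sum>w\<in>nbs (parcs G) (pverts G) v. y w) \<le> \<mu> * y v"
  shows "graph_spectral_radius G \<le> \<mu>"
proof -
  obtain x where x: "\<And>v. x v \<ge> 0" "\<exists>v\<in>pverts G. x v \<noteq> 0"
    "\<And>v. v \<in> pverts G \<Longrightarrow> graph_spectral_radius G * x v \<le> (\<Sum>w\<in>nbs (parcs G) (pverts G) v. x w)"
    using graph_spectral_radius_subsolution[OF G(1,2)] by blast
  have "graph_spectral_radius G * (\<Sum>v\<in>pverts G. (x v)\<^sup>2) \<le> qform (parcs G) (pverts G) x"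
    by (rule qform_ge) (use x in auto)
  also have "\<dots> \<le> \<mu> * (\<Sum>v\<in>pverts G. (x v)\<^sup>2)" by (rule qform_le(1)[OF G(1,3) y super])
  finally have "graph_spectral_radius G * (\<Sum>v\<in>pverts G. (x v)\<^sup>2) \<le> \<mu> * (\<Sum>v\<in>pverts G. (x v)\<^sup>2)" .
  moreover obtain v where "v \<in> pverts G" "x v \<noteq> 0" using x(2) by blast
  then have "0 < (\<Sum>v\<in>pverts G. (x v)\<^sup>2)" using G(1) by (intro sum_pos2[of _ v]) auto
  ultimately show ?thesis by simp
qed

lemma graph_spectral_radius_eqI:
  assumes G: "finite (pverts G)" "pverts G \<noteq> {}" "sym (parcs G)"
    and y: "\<And>v. v \<in> pverts G \<Longrightarrow> y v > (0::real)" and \<mu>: "\<mu> \<ge> 0"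
    and eig: "\<And>v. v \<in> pverts G \<Longrightarrow> (\<Sum>w\<in>nbs (parcs G) (pverts G) v. y w) = \<mu> * y v"
  shows "graph_spectral_radius G = \<mu>"
proof (rule antisym)
  show "graph_spectral_radius G \<le> \<mu>"
    by (rule graph_spectral_radius_le[OF G y]) (use eig in auto)
  have "cmod (of_real \<mu>) \<le> graph_spectral_radius G"
  proof (rule graph_spectral_radius_cases(2)[OF G(1,2), where f = "\<lambda>v. complex_of_real (y v)"])
    show "\<exists>u\<in>pverts G. complex_of_real (y u) \<noteq> 0" using G(2) y by fastforce
    show "(\<Sum>v\<in>nbs (parcs G) (pverts G) u. complex_of_real (y v)) = complex_of_real \<mu> * complex_of_real (y u)"
      if "u \<in> pverts G" for u
      using arg_cong[OF eig[OF that], of complex_of_real] by simp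
  qed
  then show "\<mu> \<le> graph_spectral_radius G" using \<mu> by simp
qed

section \<open>Two dominating vertices\<close>

text \<open>For charging: \<open>d - 2\<close> is the excess over two neighbours,
  \<open>d choose 3\<close> the number of triples among them.\<close>

lemma minus_2_le_choose_3: "d - 2 \<le> d choose 3"
proof (induction d)
  case (Suc d)
  show ?case
  proof (cases "d \<ge> 2")
    case True
    then have "d choose 2 \<ge> 1" by (simp add: Suc_leI)
    then show ?thesis using Suc by (simp add: numeral_eq_Suc)
  qed auto
qed auto

text \<open>All that the weight estimates use of planarity is \<open>sparse\<close> and
  \<open>codeg3\<close>. The bound \<rho>^2 \<ge> 2 n - 4 is attained by K_{2,n-2}; \<open>u\<close>
  is a vertex of maximum weight, normalised to 1.\<close>

locale sparse_subsolution =
  fixes V :: "'a set" and E :: "('a \<times> 'a) set" and x :: "'a \<Rightarrow> real" and \<rho> :: real and u :: 'a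
  assumes fin: "finite V" and symE: "sym E" and irreflE: "irrefl E"
    and sparse: "\<And>S. S \<subseteq> V \<Longrightarrow> card (E \<inter> S \<times> S) \<le> 16 * card S"
    and codeg3: "\<And>a b c. distinct [a, b, c] \<Longrightarrow> card {v \<in> V. (a, v) \<in> E \<and> (b, v) \<in> E \<and> (c, v) \<in> E} \<le> 2"
    and x0: "\<And>v. v \<in> V \<Longrightarrow> 0 \<le> x v" and x1: "\<And>v. v \<in> V \<Longrightarrow> x v \<le> 1"
    and u: "u \<in> V" "x u = 1"
    and sub: "\<And>v. v \<in> V \<Longrightarrow> \<rho> * x v \<le> (\<Sum>w\<in>nbs E V v. x w)"
    and \<rho>: "\<rho> > 0" "\<rho>\<^sup>2 \<ge> 2 * real (card V) - 4"
    and n: "real (card V) \<ge> 2.16 * 10 ^ 17"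
begin

abbreviation "N \<equiv> nbs E V"
abbreviation "n \<equiv> real (card V)"
abbreviation "d v \<equiv> real (card (N v))"

lemma NV: "N v \<subseteq> V" by (auto simp: nbs_def)

lemma finN [simp]: "finite (N v)" using fin by simp

lemma E_sym: "(a, b) \<in> E \<longleftrightarrow> (b, a) \<in> E" using symE by (meson symD)

lemma d_le_n: "d v \<le> n" using card_mono[OF fin NV] by simp

lemma pairs_le:
  assumes "S \<subseteq> V" "L \<subseteq> V"
  shows "(\<Sum>y\<in>S. real (card (N y \<inter> L))) \<le> 16 * (real (card S) + real (card L))"
proof -
  have f: "finite S" "finite L" using assms fin finite_subset by blast+
  have "(\<Sum>y\<in>S. card (N y \<inter> L)) = card (Sigma S (\<lambda>y. N y \<inter> L))" using f by simp
  also have "\<dots> \<le> card (E \<inter> (S \<union> L) \<times> (S \<union> L))"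
    by (rule card_mono) (use f in \<open>auto simp: nbs_def\<close>)
  also have "\<dots> \<le> 16 * card (S \<union> L)" by (rule sparse) (use assms in auto)
  also have "\<dots> \<le> 16 * (card S + card L)" using card_Un_le[of S L] by simp
  finally show ?thesis by (metis of_nat_add of_nat_le_iff of_nat_mult of_nat_numeral of_nat_sum)
qed

lemma degsum: "(\<Sum>y\<in>V. d y) \<le> 16 * n"
proof -
  have "(\<Sum>y\<in>V. card (N y)) = card (Sigma V N)" using fin by simp
  also have "\<dots> \<le> card (E \<inter> V \<times> V)" by (rule card_mono) (use fin in \<open>auto simp: nbs_def\<close>)
  also have "\<dots> \<le> 16 * card V" by (rule sparse) auto
  finally show ?thesis by (metis of_nat_le_iff of_nat_mult of_nat_numeral of_nat_sum)
qed

lemma degsum_subset: "S \<subseteq> V \<Longrightarrow> (\<Sum>y\<in>S. d y) \<le> 16 * n"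
  using degsum sum_mono2[OF fin, of S d] by fastforce

text \<open>A vertex exceeds two neighbours in \<open>L\<close> by no more than the number of
  triples of \<open>L\<close> that it sees, and each triple is seen by at most two vertices. For
  bounded \<open>L\<close> the slope in the size of \<open>S\<close> is 2, as in K_{2,m}, instead of
  the 16 of \<open>pairs_le\<close>.\<close>

lemma pairs_le_refined:
  assumes "S \<subseteq> V" "L \<subseteq> V"
  shows "(\<Sum>y\<in>S. real (card (N y \<inter> L))) \<le> 2 * real (card S) + real (card L) ^ 3 / 3"
proof -
  have f: "finite S" "finite L" using assms fin finite_subset by blast+
  let ?T = "{T. T \<subseteq> L \<and> card T = 3}"
  have fT: "finite ?T" using f by simp
  have "(\<Sum>y\<in>S. card (N y \<inter> L) - 2) \<le> (\<Sum>y\<in>S. card {T \<in> ?T. T \<subseteq> N y})"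
  proof (rule sum_mono)
    fix y assume "y \<in> S"
    have "card (N y \<inter> L) - 2 \<le> card (N y \<inter> L) choose 3" by (rule minus_2_le_choose_3)
    also have "\<dots> = card {T. T \<subseteq> N y \<inter> L \<and> card T = 3}" using n_subsets[of "N y \<inter> L" 3] by simp
    also have "{T. T \<subseteq> N y \<inter> L \<and> card T = 3} = {T \<in> ?T. T \<subseteq> N y}" by auto
    finally show "card (N y \<inter> L) - 2 \<le> card {T \<in> ?T. T \<subseteq> N y}" .
  qed
  also have "\<dots> = (\<Sum>T\<in>?T. card {y \<in> S. T \<subseteq> N y})"
    using sum_multicount_gen[OF f(1) fT, of "\<lambda>y T. T \<subseteq> N y" "\<lambda>T. card {y \<in> S. T \<subseteq> N y}"] by simp
  also have "\<dots> \<le> (\<Sum>T\<in>?T. 2)"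
  proof (rule sum_mono)
    fix T assume T: "T \<in> ?T"
    then obtain a b c where abc: "T = {a, b, c}" "distinct [a, b, c]" by (auto simp: card_3_iff)
    have "card {y \<in> S. T \<subseteq> N y} \<le> card {v \<in> V. (a, v) \<in> E \<and> (b, v) \<in> E \<and> (c, v) \<in> E}"
      by (rule card_mono) (use fin assms abc E_sym in \<open>auto simp: nbs_def\<close>)
    also have "\<dots> \<le> 2" by (rule codeg3[OF abc(2)])
    finally show "card {y \<in> S. T \<subseteq> N y} \<le> 2" .
  qed
  also have "\<dots> = 2 * (card L choose 3)" using n_subsets[OF f(2), of 3] by simp
  finally have 1: "(\<Sum>y\<in>S. card (N y \<inter> L) - 2) \<le> 2 * (card L choose 3)" .
  have "(\<Sum>y\<in>S. card (N y \<inter> L)) \<le> (\<Sum>y\<in>S. (card (N y \<inter> L) - 2) + 2)" by (rule sum_mono) simp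
  also have "\<dots> = (\<Sum>y\<in>S. card (N y \<inter> L) - 2) + 2 * card S" unfolding sum.distrib by simp
  finally have 2: "(\<Sum>y\<in>S. card (N y \<inter> L)) \<le> 2 * card S + 2 * (card L choose 3)" using 1 by simp
  have "6 * (card L choose 3) \<le> card L ^ 3"
    using binomial_fact_pow[of "card L" 3] by (simp add: fact_numeral mult.commute)
  then have "real (6 * (card L choose 3)) \<le> real (card L ^ 3)" by (simp only: of_nat_le_iff)
  then have 3: "2 * real (card L choose 3) \<le> real (card L) ^ 3 / 3" by simp
  have "real (\<Sum>y\<in>S. card (N y \<inter> L)) \<le> real (2 * card S + 2 * (card L choose 3))"
    using 2 by (simp only: of_nat_le_iff)
  then show ?thesis using 3 by simp
qed

text \<open>Two applications of \<open>sub\<close> count walks of length two, and \<rho>^2 is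
  replaced by its lower bound. Walks that end at a weight below \<epsilon> cost at most \<epsilon>
  times the degree sum.\<close>

lemma two_step:
  assumes w: "w \<in> V" and \<epsilon>: "\<epsilon> \<ge> 0"
  shows "(2 * n - 4) * x w \<le> (\<Sum>y\<in>N w. \<Sum>z\<in>N y \<inter> {z \<in> V. x z \<ge> \<epsilon>}. x z) + 16 * \<epsilon> * n"
proof -
  let ?L = "{z \<in> V. x z \<ge> \<epsilon>}"
  have "(2 * n - 4) * x w \<le> \<rho>\<^sup>2 * x w" using \<rho> x0[OF w] by (intro mult_right_mono) auto
  also have "\<dots> = \<rho> * (\<rho> * x w)" by (simp add: power2_eq_square)
  also have "\<dots> \<le> \<rho> * (\<Sum>y\<in>N w. x y)" using sub[OF w] \<rho> by (intro mult_left_mono) auto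
  also have "\<dots> = (\<Sum>y\<in>N w. \<rho> * x y)" by (rule sum_distrib_left)
  also have "\<dots> \<le> (\<Sum>y\<in>N w. \<Sum>z\<in>N y. x z)" using NV by (intro sum_mono sub) auto
  also have "\<dots> \<le> (\<Sum>y\<in>N w. (\<Sum>z\<in>N y \<inter> ?L. x z) + \<epsilon> * d y)"
  proof (rule sum_mono)
    fix y
    have "(\<Sum>z\<in>N y. x z) = (\<Sum>z\<in>N y \<inter> ?L. x z) + (\<Sum>z\<in>N y - ?L. x z)"
      by (rule sum.Int_Diff) simp
    also have "(\<Sum>z\<in>N y - ?L. x z) \<le> (\<Sum>z\<in>N y - ?L. \<epsilon>)" by (rule sum_mono) (auto simp: nbs_def)
    also have "\<dots> = \<epsilon> * real (card (N y - ?L))" by simp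
    also have "\<dots> \<le> \<epsilon> * d y" using \<epsilon> by (intro mult_left_mono) (auto intro!: card_mono)
    finally show "(\<Sum>z\<in>N y. x z) \<le> (\<Sum>z\<in>N y \<inter> ?L. x z) + \<epsilon> * d y" by simp
  qed
  also have "\<dots> = (\<Sum>y\<in>N w. \<Sum>z\<in>N y \<inter> ?L. x z) + \<epsilon> * (\<Sum>y\<in>N w. d y)"
    by (simp add: sum.distrib sum_distrib_left)
  also have "\<epsilon> * (\<Sum>y\<in>N w. d y) \<le> \<epsilon> * (16 * n)" using \<epsilon> degsum_subset[OF NV] by (intro mult_left_mono)
  finally show ?thesis by (simp add: algebra_simps)
qed

lemma inner_sum_le:
  assumes "L \<subseteq> V"
  shows "(\<Sum>y\<in>S. \<Sum>z\<in>N y \<inter> L. x z) \<le> (\<Sum>y\<in>S. real (card (N y \<inter> L)))"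
proof (rule sum_mono)
  fix y
  have "(\<Sum>z\<in>N y \<inter> L. x z) \<le> (\<Sum>z\<in>N y \<inter> L. 1)" using assms x1 by (intro sum_mono) auto
  then show "(\<Sum>z\<in>N y \<inter> L. x z) \<le> real (card (N y \<inter> L))" by simp
qed

text \<open>Carries out the substitution of n / \<rho> \<le> n / 650000000 in
  \<open>degree_lower_bound\<close>, isolated over free reals.\<close>

lemma linear_combination_bound:
  fixes q m D :: real
  assumes "(m - 4) * s - c * q \<le> 16 * D" "q \<le> m / 650000000" "c \<ge> 0"
  shows "m * (s - c / 650000000) \<le> 16 * D + 4 * s"
proof -
  have "c * q \<le> c * (m / 650000000)" using assms(2,3) by (rule mult_left_mono)
  with assms(1) show ?thesis by (simp add: algebra_simps)
qed

lemma degree_lower_bound: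
  assumes X: "\<rho> * (\<Sum>v\<in>V. x v) \<le> \<kappa> * n" and \<delta>: "\<delta> > 0" and w: "w \<in> V" "x w \<ge> \<delta>"
  shows "16 * d w \<ge> (n - 4) * \<delta> - 256 * \<kappa> / \<delta> * (n / \<rho>)"
proof -
  \<comment> \<open>At threshold \<delta> / 16 the light walks cost \<delta> n, half of the 2 n
    \<delta> on the left, while the total weight bounds the size of \<open>?L\<close> by 16 \<kappa>
    n / (\<delta> \<rho>).\<close>
  let ?L = "{z \<in> V. x z \<ge> \<delta> / 16}"
  have "\<delta> / 16 * real (card ?L) = (\<Sum>z\<in>?L. \<delta> / 16)" by simp
  also have "\<dots> \<le> (\<Sum>z\<in>?L. x z)" by (rule sum_mono) auto
  also have "\<dots> \<le> (\<Sum>v\<in>V. x v)" using fin x0 by (intro sum_mono2) auto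
  finally have "\<delta> / 16 * real (card ?L) * \<rho> \<le> (\<Sum>v\<in>V. x v) * \<rho>" using \<rho> by (intro mult_right_mono) auto
  also have "\<dots> \<le> \<kappa> * n" using X by (simp add: mult.commute)
  finally have "16 * real (card ?L) \<le> 256 * \<kappa> / \<delta> * (n / \<rho>)" using \<delta> \<rho> by (simp add: field_simps)
  moreover have "(2 * n - 4) * x w \<le> (\<Sum>y\<in>N w. \<Sum>z\<in>N y \<inter> ?L. x z) + 16 * (\<delta> / 16) * n"
    by (rule two_step[OF w(1)]) (use \<delta> in auto)
  moreover have "(\<Sum>y\<in>N w. \<Sum>z\<in>N y \<inter> ?L. x z) \<le> 16 * (d w + real (card ?L))"
    using inner_sum_le[of ?L "N w"] pairs_le[OF NV, of ?L w] by fastforce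
  moreover have "(2 * n - 4) * \<delta> \<le> (2 * n - 4) * x w" using w n by (intro mult_left_mono) auto
  ultimately show ?thesis by (simp add: algebra_simps)
qed

lemma rho_sum: "\<rho> * (\<Sum>v\<in>V. x v) \<le> (\<Sum>v\<in>V. d v * x v)"
proof -
  have "\<rho> * (\<Sum>v\<in>V. x v) \<le> (\<Sum>v\<in>V. \<Sum>w\<in>N v. x w)"
    unfolding sum_distrib_left by (intro sum_mono sub)
  also have "\<dots> = (\<Sum>v\<in>V. \<Sum>w\<in>N v. x v)" by (rule sum_nbs_swap[OF fin symE])
  finally show ?thesis by simp
qed

lemma card_heavy:
  assumes deg: "\<And>w. w \<in> V \<Longrightarrow> x w \<ge> \<delta> \<Longrightarrow> d w \<ge> c * n" and c: "c > 0"
  shows "real (card {z \<in> V. x z \<ge> \<delta>}) \<le> 16 / c"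
proof -
  let ?L = "{z \<in> V. x z \<ge> \<delta>}"
  have "real (card ?L) * (c * n) = (\<Sum>z\<in>?L. c * n)" by simp
  also have "\<dots> \<le> (\<Sum>z\<in>?L. d z)" using deg by (intro sum_mono) auto
  also have "\<dots> \<le> 16 * n" by (rule degsum_subset) auto
  finally have "real (card ?L) * c * n \<le> 16 * n" by (simp add: algebra_simps)
  then have "real (card ?L) * c \<le> 16" using n by simp
  then show ?thesis using c by (simp add: field_simps)
qed

section \<open>Numerical estimates from the lower bound on the number of vertices\<close>

lemma rho_lower: "\<rho> \<ge> 6.5 * 10 ^ 8"
proof (rule power2_le_imp_le)
  \<comment> \<open>The left side is 4.225 * 10^17, the right side just below 4.32 * 10^17.\<close>
  have "(6.5 * 10 ^ 8 :: real)\<^sup>2 \<le> 2 * (2.16 * 10 ^ 17) - 4" by (simp add: power2_eq_square)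
  then show "(6.5 * 10 ^ 8)\<^sup>2 \<le> \<rho>\<^sup>2" using n \<rho>(2) by linarith
qed (use \<rho> in auto)

lemma n_lower: "n \<ge> 216000000000000000"
  using n by simp

lemma n_div_rho: "n / \<rho> \<le> n / 650000000"
  using rho_lower by (intro divide_left_mono) auto

text \<open>The bound on the total weight improves from \<open>16 n / \<rho>\<close> to \<open>2.2 n / \<rho>\<close> because all but few vertices have
  at most two heavy neighbours; only then does the threshold \<open>1/400\<close> below leave boundedly many heavy vertices.\<close>

lemma sum_weights_1: "\<rho> * (\<Sum>v\<in>V. x v) \<le> 16 * n"
proof -
  have "(\<Sum>v\<in>V. d v * x v) \<le> (\<Sum>v\<in>V. d v)"
    using x0 x1 by (intro sum_mono) (auto intro: mult_left_le)
  then show ?thesis using rho_sum degsum by linarith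
qed

lemma card_heavy_1: "real (card {z \<in> V. x z \<ge> 1/100}) \<le> 28800"
proof -
  \<comment> \<open>(1/100 - 409600/650000000) / 16 exceeds 1/1800, with room for the constant
    terms.\<close>
  have "d w \<ge> 1/1800 * n" if w: "w \<in> V" "x w \<ge> 1/100" for w
  proof -
    have "16 * d w \<ge> (n - 4) * (1/100) - 256 * 16 / (1/100) * (n / \<rho>)"
      by (rule degree_lower_bound[OF sum_weights_1 _ w]) auto
    from linear_combination_bound[OF this n_div_rho] show ?thesis using n_lower by simp
  qed
  from card_heavy[of "1/100" "1/1800", OF this] show ?thesis by simp
qed

lemma sum_weights_2: "\<rho> * (\<Sum>v\<in>V. x v) \<le> (11/5) * n"
proof -
  let ?L = "{z \<in> V. x z \<ge> 1/100}"
  have "(\<Sum>v\<in>V. d v * x v) = (\<Sum>v\<in>V \<inter> ?L. d v * x v) + (\<Sum>v\<in>V - ?L. d v * x v)"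
    by (rule sum.Int_Diff[OF fin])
  also have "V \<inter> ?L = ?L" by auto
  also have "(\<Sum>v\<in>?L. d v * x v) \<le> (\<Sum>v\<in>?L. d v)"
    using x0 x1 by (intro sum_mono) (auto intro: mult_left_le)
  also have "\<dots> = real (card (Sigma ?L N))" using fin by simp
  \<comment> \<open>Double counting: arcs leaving heavy vertices are counted at their other ends,
    where \<open>pairs_le_refined\<close> applies.\<close>
  also have "card (Sigma ?L N) = card (Sigma V (\<lambda>y. N y \<inter> ?L))"
  proof (rule bij_betw_same_card[of prod.swap])
    show "bij_betw prod.swap (Sigma ?L N) (Sigma V (\<lambda>y. N y \<inter> ?L))"
      unfolding bij_betw_def using E_sym by (auto simp: nbs_def image_iff)
  qed
  also have "real \<dots> = (\<Sum>y\<in>V. real (card (N y \<inter> ?L)))" using fin by simp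
  also have "\<dots> \<le> 2 * n + real (card ?L) ^ 3 / 3" by (rule pairs_le_refined) auto
  also have "real (card ?L) ^ 3 \<le> 28800 ^ 3" using card_heavy_1 by (intro power_mono) auto
  also have "(\<Sum>v\<in>V - ?L. d v * x v) \<le> (\<Sum>v\<in>V - ?L. d v * (1/100))"
    by (intro sum_mono mult_left_mono) auto
  also have "\<dots> = (\<Sum>v\<in>V - ?L. d v) / 100" by (simp add: sum_divide_distrib)
  also have "(\<Sum>v\<in>V - ?L. d v) \<le> 16 * n" by (rule degsum_subset) auto
  \<comment> \<open>28800^3 / 3 is below 10^13, hence below n / 20000, and the light vertices add
    0.16 n; together they stay under the 0.2 n that is allowed beyond 2 n.\<close>
  finally have "(\<Sum>v\<in>V. d v * x v) \<le> 2 * n + 28800 ^ 3 / 3 + 16 * n / 100" by simp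
  then show ?thesis using rho_sum n by simp
qed

lemma card_heavy_2: "real (card {z \<in> V. x z \<ge> 1/400}) \<le> 120000"
proof -
  \<comment> \<open>(1/400 - 225280/650000000) / 16 is about 1.346 * 10^-4, just above
    4/30000.\<close>
  have "d w \<ge> 4/30000 * n" if w: "w \<in> V" "x w \<ge> 1/400" for w
  proof -
    have "16 * d w \<ge> (n - 4) * (1/400) - 256 * (11/5) / (1/400) * (n / \<rho>)"
      by (rule degree_lower_bound[OF sum_weights_2 _ w]) auto
    from linear_combination_bound[OF this n_div_rho] show ?thesis using n_lower by simp
  qed
  from card_heavy[of "1/400" "4/30000", OF this] show ?thesis by simp
qed

abbreviation "H \<equiv> {z \<in> V. x z \<ge> 1/400}"

text \<open>The lower bound on \<open>n\<close> is 600000^3 and there are at most 120000 heavy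
  vertices, so that the cubic term 120000^3 / 3 is at most n / 375, below 0.0027 n.\<close>

lemma pairs_heavy: "S \<subseteq> V \<Longrightarrow> (\<Sum>y\<in>S. real (card (N y \<inter> H))) \<le> 2 * real (card S) + (27/10000) * n"
proof -
  assume "S \<subseteq> V"
  then have "(\<Sum>y\<in>S. real (card (N y \<inter> H))) \<le> 2 * real (card S) + real (card H) ^ 3 / 3"
    by (rule pairs_le_refined) auto
  moreover have "real (card H) ^ 3 \<le> 120000 ^ 3" using card_heavy_2 by (intro power_mono) auto
  ultimately show ?thesis using n by simp
qed

lemma two_step_heavy: "w \<in> V \<Longrightarrow> (2 * n - 4) * x w \<le> (\<Sum>y\<in>N w. \<Sum>z\<in>N y \<inter> H. x z) + (1/25) * n"
  using two_step[of w "1/400"] by simp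

text \<open>The error 0.0427 is the sum of 0.0027 from \<open>pairs_heavy\<close> and 0.04 from the
  light walks in \<open>two_step_heavy\<close>.\<close>

lemma degree_from_weight:
  assumes "w \<in> V" shows "(2 * n - 4) * x w \<le> 2 * d w + (427/10000) * n"
proof -
  have "(\<Sum>y\<in>N w. \<Sum>z\<in>N y \<inter> H. x z) \<le> 2 * d w + (27/10000) * n"
    using inner_sum_le[of H "N w"] pairs_heavy[OF NV, of w] by fastforce
  then show ?thesis using two_step_heavy[OF assms] by simp
qed

text \<open>A vertex is counted at most twice, except for the at most two vertices adjacent to all
  three.\<close>

lemma common_nbs_le:
  assumes "v \<noteq> w" "v \<noteq> u" "w \<noteq> u"
  shows "d u + d v + d w \<le> 2 * n + 2"
proof -
  let ?I = "\<lambda>S y. if y \<in> S then 1 else 0 :: nat"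
  have dd: "card S = (\<Sum>y\<in>V. ?I S y)" if "S \<subseteq> V" for S
    using fin that by (simp add: sum.If_cases Int_absorb1)
  have "card (N u) + card (N v) + card (N w) = (\<Sum>y\<in>V. ?I (N u) y + ?I (N v) y + ?I (N w) y)"
    unfolding sum.distrib by (simp only: dd[OF NV])
  also have "\<dots> \<le> (\<Sum>y\<in>V. 2 + ?I (N u \<inter> N v \<inter> N w) y)" by (rule sum_mono) auto
  also have "\<dots> = 2 * card V + card (N u \<inter> N v \<inter> N w)"
    unfolding sum.distrib using dd[of "N u \<inter> N v \<inter> N w"] NV[of u] by (simp add: le_infI1)
  also have "N u \<inter> N v \<inter> N w = {y \<in> V. (u, y) \<in> E \<and> (v, y) \<in> E \<and> (w, y) \<in> E}" by (auto simp: nbs_def)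
  also have "card \<dots> \<le> 2" by (rule codeg3) (use assms in auto)
  finally have "card (N u) + card (N v) + card (N w) \<le> 2 * card V + 2" by simp
  then show ?thesis by linarith
qed

text \<open>Each bound feeds the next: the degree of \<open>u\<close> (0.9786 n), the second largest
  weight \<open>x v\<close> (0.957), the degree of \<open>v\<close> (0.9356 n). The three-vertex
  degree bound then leaves any other vertex a degree of at most 0.0859 n and a weight of at most
  0.108. This is still too large for the factor 18 demanded by the exchange of edges, so the
  vertices outside the common neighbourhood are estimated once more, which lowers the weight to
  0.039.\<close>

lemma dominating_pair:
  obtains v M where "v \<in> V" "v \<noteq> u" "0 \<le> M" "18 * M < x v" "\<And>z. z \<in> V - {u, v} \<Longrightarrow> x z \<le> M"
    "2 * real (card (N u \<inter> N v)) \<ge> n"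
proof -
  have u': "u \<in> H" using u by auto
  have "n > 1" using n_lower by linarith
  then have card2: "card V > 1" by simp
  then have ne: "V - {u} \<noteq> {}" using u(1) fin
    by (metis One_nat_def card.empty card_Suc_Diff1 less_irrefl)
  have fx: "finite (x ` (V - {u}))" "x ` (V - {u}) \<noteq> {}" using fin ne by auto
  have "Max (x ` (V - {u})) \<in> x ` (V - {u})" using fx by (rule Max_in)
  then obtain v where "v \<in> V - {u}" "Max (x ` (V - {u})) = x v" by (rule imageE) blast
  then have v: "v \<in> V" "v \<noteq> u" "x v = Max (x ` (V - {u}))" by auto
  have vmax: "x z \<le> x v" if "z \<in> V" "z \<noteq> u" for z
    unfolding v(3) using fx that by (intro Max_ge) auto
  have xv0: "0 \<le> x v" "x v \<le> 1" using x0[OF v(1)] x1[OF v(1)] by simp_all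
  have du: "d u \<ge> (4893/5000) * n" using degree_from_weight[OF u(1)] u(2) n by simp
  have uN: "u \<in> N y \<inter> H" if "y \<in> N u" for y using that u' E_sym by (auto simp: nbs_def)
  have split_u: "(\<Sum>z\<in>N y \<inter> H. f z) = f u + (\<Sum>z\<in>N y \<inter> H - {u}. f z)" if "y \<in> N u" for y and f :: "'a \<Rightarrow> real"
    by (rule sum.remove) (use uN[OF that] in auto)
  have cu: "(\<Sum>y\<in>N u. real (card (N y \<inter> H - {u}))) \<le> d u + (27/10000) * n"
  proof -
    have "real (card (N y \<inter> H - {u})) = real (card (N y \<inter> H)) - 1" if "y \<in> N u" for y
      using split_u[OF that, of "\<lambda>_. 1"] by simp
    then have "(\<Sum>y\<in>N u. real (card (N y \<inter> H - {u}))) = (\<Sum>y\<in>N u. real (card (N y \<inter> H)) - 1)"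
      by (intro sum.cong) auto
    also have "\<dots> = (\<Sum>y\<in>N u. real (card (N y \<inter> H))) - d u" by (simp add: sum_subtractf)
    finally show ?thesis using pairs_heavy[OF NV, of u] by simp
  qed
  have inner_u: "(\<Sum>y\<in>N u. \<Sum>z\<in>N y \<inter> H. x z) = d u + (\<Sum>y\<in>N u. \<Sum>z\<in>N y \<inter> H - {u}. x z)"
  proof -
    have "(\<Sum>y\<in>N u. \<Sum>z\<in>N y \<inter> H. x z) = (\<Sum>y\<in>N u. 1 + (\<Sum>z\<in>N y \<inter> H - {u}. x z))"
      by (rule sum.cong) (use split_u[of _ x] u in auto)
    then show ?thesis by (simp add: sum.distrib)
  qed
  have two_u: "2 * n - 4 \<le> (\<Sum>y\<in>N u. \<Sum>z\<in>N y \<inter> H. x z) + (1/25) * n"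
    using two_step_heavy[OF u(1)] u(2) by simp
  \<comment> \<open>Walks returning to \<open>u\<close> contribute \<open>d u\<close>, at most n;
    the other walks to heavy ends number at most 1.0027 n and weigh at most \<open>x v\<close> each.
    With 0.04 n for the light ends, 0.9599 n \<le> 1.0027 n \<open>x v\<close> remains once the
    constant 4 is absorbed.\<close>
  have xv: "x v \<ge> (957/1000)"
  proof -
    have "(\<Sum>y\<in>N u. \<Sum>z\<in>N y \<inter> H - {u}. x z) \<le> (\<Sum>y\<in>N u. \<Sum>z\<in>N y \<inter> H - {u}. x v)"
      using vmax by (intro sum_mono) auto
    also have "\<dots> = x v * (\<Sum>y\<in>N u. real (card (N y \<inter> H - {u})))" by (simp add: sum_distrib_left mult.commute)
    also have "\<dots> \<le> x v * ((10027/10000) * n)" using cu d_le_n[of u] xv0 by (intro mult_left_mono) auto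
    finally have "2 * n - 4 \<le> n + x v * ((10027/10000) * n) + (1/25) * n"
      using two_step_heavy[OF u(1)] inner_u u(2) d_le_n[of u] by simp
    moreover have "x v * ((10027/10000) * n) = (10027/10000) * (x v * n)" "(x v * (10027/10000)) * n = (10027/10000) * (x v * n)" by simp_all
    ultimately have "(9599/10000) * n \<le> (x v * (10027/10000)) * n" using n_lower by linarith
    then have "(9599/10000) \<le> x v * (10027/10000)" using n by (subst (asm) mult_le_cancel_right) auto
    then show ?thesis by simp
  qed
  have v': "v \<in> H" using v xv by auto
  have dv: "d v \<ge> (2339/2500) * n"
  proof -
    have "(2 * n - 4) * (957/1000) \<le> (2 * n - 4) * x v" using xv n by (intro mult_left_mono) auto
    then show ?thesis using degree_from_weight[OF v(1)] n by simp
  qed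
  have small: "x z \<le> (27/250)" if z: "z \<in> V" "z \<noteq> u" "z \<noteq> v" for z
  proof -
    have "d z \<le> (859/10000) * n" using common_nbs_le[of v z] z v du dv n by simp
    then have "(2 * n - 4) * x z \<le> (429/2000) * n" using degree_from_weight[OF z(1)] by simp
    moreover have "(2 * n - 4) * x z = 2 * (x z * n) - 4 * x z" "x z * (2 * n) = 2 * (x z * n)"
      by (simp_all add: algebra_simps)
    ultimately have "x z * (2 * n) \<le> (27/250) * (2 * n)" using n_lower x1[OF z(1)] by linarith
    then show ?thesis using n by (subst (asm) mult_le_cancel_right) auto
  qed
  let ?A = "N u \<inter> N v"
  define c where "c = real (card ?A)"
  have c_ge: "c \<ge> (1909/2000) * n"
  proof -
    \<comment> \<open>Every heavy end other than \<open>u\<close> and \<open>v\<close> weighs at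
      most 27/250; \<open>v\<close> is allowed the further 223/250 up to 1, and it is reached
      exactly from the \<open>y\<close> in the common neighbourhood.\<close>
    have inner: "(\<Sum>z\<in>N y \<inter> H - {u}. x z) \<le> (27/250) * real (card (N y \<inter> H - {u})) + (if y \<in> N v then (223/250) else 0)"
      if y: "y \<in> N u" for y
    proof -
      have *: "(\<Sum>z\<in>N y \<inter> H - {u}. x z) \<le> (\<Sum>z\<in>N y \<inter> H - {u}. (27/250) + (if z = v then (223/250) else 0))"
        using small xv0 by (intro sum_mono) auto
      also have "\<dots> = (27/250) * real (card (N y \<inter> H - {u})) + (\<Sum>z\<in>N y \<inter> H - {u}. if z = v then (223/250) else 0)"
        by (simp add: sum.distrib)
      also have "(\<Sum>z\<in>N y \<inter> H - {u}. if z = v then (223/250) else (0::real)) = (if y \<in> N v then (223/250) else 0)"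
      proof -
        have "v \<in> N y \<inter> H - {u} \<longleftrightarrow> y \<in> N v" using y v v' E_sym by (auto simp: nbs_def)
        then show ?thesis by (simp add: sum.delta)
      qed
      finally show ?thesis .
    qed
    have "(\<Sum>y\<in>N u. \<Sum>z\<in>N y \<inter> H - {u}. x z)
        \<le> (\<Sum>y\<in>N u. (27/250) * real (card (N y \<inter> H - {u})) + (if y \<in> N v then (223/250) else 0))"
      by (rule sum_mono) (rule inner)
    also have "\<dots> = (27/250) * (\<Sum>y\<in>N u. real (card (N y \<inter> H - {u}))) + (223/250) * c"
      by (simp add: sum.distrib sum_distrib_left c_def sum.If_cases)
    finally have I: "(\<Sum>y\<in>N u. \<Sum>z\<in>N y \<inter> H - {u}. x z)
        \<le> (27/250) * (\<Sum>y\<in>N u. real (card (N y \<inter> H - {u}))) + (223/250) * c" .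
    have comb: "m \<le> D + (27/250) * D + (729/2500000) * k + r + (1/25) * k"
      if "I \<le> (27/250) * S + r" "T = D + I" "S \<le> D + (27/10000) * k" "m \<le> T + (1/25) * k"
      for I S T D k m r :: real
      using that by linarith
    have "2 * n - 4 \<le> d u + (27/250) * d u + (729/2500000) * n + (223/250) * c + (1/25) * n"
      by (rule comb[OF I inner_u cu two_u])
    then show ?thesis using d_le_n[of u] n by simp
  qed
  have nbA: "card (N z \<inter> ?A) \<le> 2" if z: "z \<noteq> u" "z \<noteq> v" for z
  proof -
    have "card {y \<in> V. (u, y) \<in> E \<and> (v, y) \<in> E \<and> (z, y) \<in> E} \<le> 2"
      by (rule codeg3) (use z v in auto)
    moreover have "N z \<inter> ?A = {y \<in> V. (u, y) \<in> E \<and> (v, y) \<in> E \<and> (z, y) \<in> E}" by (auto simp: nbs_def)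
    ultimately show ?thesis by simp
  qed
  define R where "R = V - {u, v} - ?A"
  have uvA: "u \<notin> ?A" "v \<notin> ?A" using irreflE by (auto simp: nbs_def irrefl_def)
  have cardR: "real (card R) \<le> (91/2000) * n"
  proof -
    have "card R + card ?A \<le> card V"
    proof -
      have "R \<inter> ?A = {}" "R \<union> ?A \<subseteq> V" "finite R" using NV fin by (auto simp: R_def)
      then show ?thesis using card_Un_disjoint[of R ?A] card_mono[OF fin, of "R \<union> ?A"] by simp
    qed
    then show ?thesis using c_ge by (simp add: c_def)
  qed
  have RV: "R \<subseteq> V" by (auto simp: R_def)
  have fR: "finite R" using RV fin finite_subset by blast
  \<comment> \<open>The inserted 0 makes the maximum nonnegative and always defined.\<close>
  define M where "M = Max (insert 0 (x ` (V - {u, v})))"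
  have fM: "finite (insert 0 (x ` (V - {u, v})))" using fin by simp
  have M0: "0 \<le> M" unfolding M_def using fM by simp
  have Mx: "x z \<le> M" if "z \<in> V - {u, v}" for z unfolding M_def using fM that by (intro Max_ge) auto
  have M1: "M \<le> 1" unfolding M_def using fM x1 by (subst Max_le_iff) auto
  have nbsum: "(\<Sum>y\<in>N z. x y) \<le> (\<Sum>y\<in>N z \<inter> {u, v}. x y) + 2 * M + (\<Sum>y\<in>N z \<inter> R. x y)"
    if z: "z \<in> V" "z \<noteq> u" "z \<noteq> v" for z
  proof -
    have "N z = (N z \<inter> {u, v}) \<union> (N z \<inter> ?A) \<union> (N z \<inter> R)" using NV[of z] by (auto simp: R_def)
    then have "(\<Sum>y\<in>N z. x y) = (\<Sum>y\<in>(N z \<inter> {u, v}) \<union> (N z \<inter> ?A) \<union> (N z \<inter> R). x y)" by simp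
    also have "\<dots> = (\<Sum>y\<in>N z \<inter> {u, v}. x y) + (\<Sum>y\<in>N z \<inter> ?A. x y) + (\<Sum>y\<in>N z \<inter> R. x y)"
      by (subst sum.union_disjoint sum.union_disjoint; use uvA fR in \<open>auto simp: R_def\<close>)+
    also have "(\<Sum>y\<in>N z \<inter> ?A. x y) \<le> (\<Sum>y\<in>N z \<inter> ?A. M)"
      using uvA NV by (intro sum_mono Mx) auto
    also have "\<dots> \<le> 2 * M" using nbA[OF z(2,3)] M0 by (simp add: mult_right_mono)
    finally show ?thesis by simp
  qed
  define Y where "Y = (\<Sum>r\<in>R. x r)"
  \<comment> \<open>A vertex of \<open>R\<close> misses \<open>u\<close> or \<open>v\<close>, so the
    apexes add at most 1, the common neighbourhood at most 2 M, and the arcs within \<open>R\<close>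
    at most 16 M on average.\<close>
  have Y: "\<rho> * Y \<le> real (card R) * (1 + 18 * M)"
  proof -
    have "\<rho> * Y \<le> (\<Sum>r\<in>R. \<Sum>y\<in>N r. x y)"
      unfolding Y_def sum_distrib_left using RV by (intro sum_mono sub) auto
    also have "\<dots> \<le> (\<Sum>r\<in>R. 1 + 2 * M + M * real (card (N r \<inter> R)))"
    proof (rule sum_mono)
      fix r assume r: "r \<in> R"
      then have r': "r \<in> V" "r \<noteq> u" "r \<noteq> v" "r \<notin> ?A" by (auto simp: R_def)
      have "(\<Sum>y\<in>N r \<inter> {u, v}. x y) \<le> 1"
      proof -
        have "\<not> (u \<in> N r \<and> v \<in> N r)" using r' E_sym by (auto simp: nbs_def)
        then have "N r \<inter> {u, v} = {} \<or> N r \<inter> {u, v} = {u} \<or> N r \<inter> {u, v} = {v}" by auto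
        then show ?thesis using u(2) xv0 by auto
      qed
      moreover have "(\<Sum>y\<in>N r \<inter> R. x y) \<le> (\<Sum>y\<in>N r \<inter> R. M)"
        by (rule sum_mono) (rule Mx, auto simp: R_def)
      ultimately show "(\<Sum>y\<in>N r. x y) \<le> 1 + 2 * M + M * real (card (N r \<inter> R))"
        using nbsum[OF r'(1-3)] by (simp add: mult.commute)
    qed
    also have "\<dots> = real (card R) * (1 + 2 * M) + M * (\<Sum>r\<in>R. real (card (N r \<inter> R)))"
      by (simp add: sum.distrib sum_distrib_left)
    also have "(\<Sum>r\<in>R. real (card (N r \<inter> R))) = real (card (E \<inter> R \<times> R))"
    proof -
      have "E \<inter> R \<times> R = Sigma R (\<lambda>r. N r \<inter> R)" using RV by (auto simp: nbs_def)
      then show ?thesis using fR by simp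
    qed
    also have "M * real (card (E \<inter> R \<times> R)) \<le> M * (16 * real (card R))"
      using sparse[OF RV] M0 by (intro mult_left_mono) auto
    finally show ?thesis by (simp add: algebra_simps)
  qed
  \<comment> \<open>A second application of \<open>sub\<close>, at a vertex of weight
    \<open>M\<close>. With n \<le> 0.50001 \<rho>^2 and 4 / \<rho> \<le> 1/100000 it yields M \<le>
    0.00001 + 0.0228 (1 + 18 M), and hence M < 0.039.\<close>
  have xz: "x z \<le> (39/1000)" if z: "z \<in> V" "z \<noteq> u" "z \<noteq> v" "x z = M" for z
  proof -
    have "(\<Sum>y\<in>N z \<inter> {u, v}. x y) \<le> (\<Sum>y\<in>{u, v}. x y)"
      using u v x0 by (intro sum_mono2) auto
    also have "\<dots> \<le> 2" using u v xv0 by simp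
    finally have 1: "(\<Sum>y\<in>N z \<inter> {u, v}. x y) \<le> 2" .
    have 2: "(\<Sum>y\<in>N z \<inter> R. x y) \<le> Y"
      unfolding Y_def using fR RV x0 by (intro sum_mono2) auto
    have "\<rho> * M \<le> 4 + Y" using sub[OF z(1)] nbsum[OF z(1-3)] 1 2 z(4) M1 by simp
    then have "\<rho> * (\<rho> * M) \<le> \<rho> * (4 + Y)" using \<rho> by (intro mult_left_mono) auto
    then have 3: "\<rho>\<^sup>2 * M \<le> 4 * \<rho> + \<rho> * Y" by (simp add: power2_eq_square algebra_simps)
    have M18: "0 \<le> 1 + 18 * M" using M0 by simp
    have nle: "n \<le> (50001/100000) * \<rho>\<^sup>2" using \<rho>(2) n by simp
    have "\<rho> * Y \<le> (91/2000) * n * (1 + 18 * M)"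
      by (rule order_trans[OF Y mult_right_mono[OF cardR M18]])
    also have "\<dots> \<le> (91/2000) * ((50001/100000) * \<rho>\<^sup>2) * (1 + 18 * M)"
      using nle M18 by (intro mult_right_mono mult_left_mono) auto
    finally have 4: "\<rho> * Y \<le> \<rho>\<^sup>2 * ((91/2000) * (50001/100000) * (1 + 18 * M))" by (simp add: algebra_simps)
    have "400000 * \<rho> \<le> \<rho> * \<rho>" using rho_lower \<rho>(1) by (intro mult_right_mono) auto
    then have "4 * \<rho> \<le> \<rho>\<^sup>2 * (1/100000)" by (simp add: power2_eq_square)
    with 3 4 have "\<rho>\<^sup>2 * M \<le> \<rho>\<^sup>2 * (1/100000) + \<rho>\<^sup>2 * ((91/2000) * (50001/100000) * (1 + 18 * M))" by linarith
    then have "\<rho>\<^sup>2 * M \<le> \<rho>\<^sup>2 * ((1/100000) + (91/2000) * (50001/100000) * (1 + 18 * M))"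
      by (simp only: distrib_left)
    then have "M \<le> (1/100000) + (91/2000) * (50001/100000) * (1 + 18 * M)"
      using \<rho>(1) by (subst (asm) mult_le_cancel_left) auto
    moreover have "(91/2000) * (50001/100000) * (1 + 18 * M) = 4550091/200000000 + (81901638/200000000) * M"
      by (simp add: field_simps)
    ultimately show ?thesis using z(4) by linarith
  qed
  have "M \<le> (39/1000)"
  proof -
    have "M \<in> insert 0 (x ` (V - {u, v}))" unfolding M_def using fM by (intro Max_in) auto
    then show ?thesis using xz by auto
  qed
  then have "18 * M < x v" using xv by simp
  moreover have "2 * real (card ?A) \<ge> n" using c_ge n by (simp add: c_def)
  ultimately show thesis using that[OF v(1,2) M0] Mx by blast
qed

end

section \<open>Isomorphisms and fans\<close>

lemma isomorphicI:
  assumes wf: "pair_wf_digraph F" and inj: "inj_on f (pverts F)"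
    and K: "pverts K = f ` pverts F" "parcs K = map_prod f f ` parcs F"
  shows "isomorphic F K"
proof -
  let ?h = "\<lparr>iso_verts = f, iso_arcs = map_prod f f, iso_head = snd, iso_tail = fst\<rparr>"
  have sub: "fst a \<in> pverts F" "snd a \<in> pverts F" if "a \<in> parcs F" for a
    using pair_wf_digraph.arc_fst_in_verts[OF wf that] pair_wf_digraph.arc_snd_in_verts[OF wf that] by simp_all
  have "inj_on (map_prod f f) (parcs F)"
    using inj sub by (auto simp: inj_on_def)
  then have "pre_digraph.digraph_isomorphism (with_proj F) ?h"
    using wf inj by (simp add: pre_digraph.digraph_isomorphism_def wf_digraph_wp_iff)
  moreover have "with_proj K = app_iso ?h (with_proj F)"
    using K by (simp add: app_iso_def with_proj_def)
  ultimately show ?thesis unfolding isomorphic_def digraph_iso_def by blast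
qed

lemma isomorphicD:
  assumes "isomorphic F K"
  obtains f where "inj_on f (pverts F)" "pverts K = f ` pverts F" "parcs K = map_prod f f ` parcs F"
proof -
  obtain h where h: "pre_digraph.digraph_isomorphism (with_proj F) h" "with_proj K = app_iso h (with_proj F)"
    using assms unfolding isomorphic_def digraph_iso_def by blast
  have K: "pverts K = iso_verts h ` pverts F" "parcs K = iso_arcs h ` parcs F" "fst = iso_tail h" "snd = iso_head h"
    using h(2) by (simp_all add: app_iso_def with_proj_def)
  have "iso_arcs h a = map_prod (iso_verts h) (iso_verts h) a" if "a \<in> parcs F" for a
    using h(1) that K(3,4) unfolding pre_digraph.digraph_isomorphism_def
    by (simp add: with_proj_def prod_eq_iff)
  then have "parcs K = map_prod (iso_verts h) (iso_verts h) ` parcs F" using K(2) by simp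
  moreover have "inj_on (iso_verts h) (pverts F)"
    using h(1) by (simp add: pre_digraph.digraph_isomorphism_def)
  ultimately show thesis using that K(1) by blast
qed

lemma pair_graphI:
  assumes "finite (pverts G)" "parcs G \<subseteq> pverts G \<times> pverts G" "sym (parcs G)" "irrefl (parcs G)"
  shows "pair_graph G"
proof -
  have "symmetric (with_proj G)"
  proof -
    have "arcs_ends (with_proj G) = parcs G" by (simp add: arcs_ends_def arc_to_ends_def with_proj_def)
    then show ?thesis using assms(3) by (simp add: symmetric_def)
  qed
  moreover have "finite (parcs G)" using assms finite_subset by blast
  ultimately show ?thesis
    using assms by unfold_locales (auto simp: irrefl_def)
qed

section \<open>Linear forests and fans given by lists of paths\<close>

definition path_arcs :: "'a list \<Rightarrow> ('a \<times> 'a) set" where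
  "path_arcs p = (\<lambda>(i, j). (p ! i, p ! j)) ` {(i, j). i < length p \<and> j < length p \<and> (j = Suc i \<or> i = Suc j)}"

definition forest_arcs :: "'a list list \<Rightarrow> ('a \<times> 'a) set" where
  "forest_arcs ps = (\<Union>p\<in>set ps. path_arcs p)"

text \<open>The join of K_2 on \<open>u\<close>, \<open>v\<close> with the linear forest whose
  components are the lists in \<open>ps\<close>. No disjoint sum is formed, so an extremal graph can
  be shown equal to a fan on its own vertices.\<close>

definition fan :: "'a \<Rightarrow> 'a \<Rightarrow> 'a list list \<Rightarrow> 'a pair_pre_digraph" where
  "fan u v ps = \<lparr> pverts = {u, v} \<union> set (concat ps),
     parcs = {(u, v), (v, u)} \<union> {u, v} \<times> set (concat ps) \<union> set (concat ps) \<times> {u, v} \<union> forest_arcs ps \<rparr>"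

text \<open>Excluding empty lists makes the lengths a partition of n - 2 and keeps the lists in
  \<open>ps\<close> pairwise distinct.\<close>

definition fan_list :: "'a \<Rightarrow> 'a \<Rightarrow> 'a list list \<Rightarrow> bool" where
  "fan_list u v ps \<longleftrightarrow> distinct (u # v # concat ps) \<and> [] \<notin> set ps"

lemma path_arcs_sym: "(a, b) \<in> path_arcs p \<Longrightarrow> (b, a) \<in> path_arcs p"
  unfolding path_arcs_def by force

lemma path_arcs_set: "(a, b) \<in> path_arcs p \<Longrightarrow> a \<in> set p \<and> b \<in> set p"
  by (auto simp: path_arcs_def)

lemma path_arcs_irrefl: "distinct p \<Longrightarrow> (a, a) \<notin> path_arcs p"
  by (auto simp: path_arcs_def nth_eq_iff_index_eq)

lemma path_arcs_map: "path_arcs (map f p) = map_prod f f ` path_arcs p"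
  unfolding path_arcs_def image_image by (rule image_cong) auto

lemma forest_arcs_set: "(a, b) \<in> forest_arcs ps \<Longrightarrow> a \<in> set (concat ps) \<and> b \<in> set (concat ps)"
  using path_arcs_set unfolding forest_arcs_def by fastforce

lemma fan_list_distinct_path: "fan_list u v ps \<Longrightarrow> p \<in> set ps \<Longrightarrow> distinct p"
  by (auto simp: fan_list_def distinct_concat_iff)

lemma fan_list_disjoint:
  assumes "fan_list u v ps" "p \<in> set ps" "q \<in> set ps" "w \<in> set p" "w \<in> set q"
  shows "p = q"
proof -
  have "removeAll [] ps = ps" using assms(1) by (simp add: fan_list_def)
  then have "p \<noteq> q \<Longrightarrow> set p \<inter> set q = {}"
    using assms(1-3) by (auto simp: fan_list_def distinct_concat_iff simp del: set_concat)
  then show ?thesis using assms(4,5) by blast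
qed

lemma fan_list_distinct: "fan_list u v ps \<Longrightarrow> distinct ps"
proof -
  assume a: "fan_list u v ps"
  then have "removeAll [] ps = ps" by (simp add: fan_list_def)
  then show ?thesis using a by (auto simp: fan_list_def distinct_concat_iff)
qed

lemma fan_list_cong:
  assumes "fan_list u v ps" "mset qs = mset ps"
  shows "fan_list u v qs" "fan u v qs = fan u v ps"
proof -
  have s: "set qs = set ps" using assms(2) by (rule mset_eq_setD)
  have "mset (concat qs) = mset (concat ps)" using assms(2) by (simp add: mset_concat flip: sum_mset_sum_list)
  then have "distinct (concat qs)" using assms(1) by (simp add: fan_list_def) (metis mset_eq_imp_distinct_iff)
  then show "fan_list u v qs" using assms(1) s by (simp add: fan_list_def)
  show "fan u v qs = fan u v ps" using s by (simp add: fan_def forest_arcs_def)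
qed

lemma forest_arcs_sym: "(a, b) \<in> forest_arcs ps \<Longrightarrow> (b, a) \<in> forest_arcs ps"
  using path_arcs_sym[of a b] unfolding forest_arcs_def by auto

lemma pverts_fan: "pverts (fan u v ps) = {u, v} \<union> set (concat ps)"
  by (simp add: fan_def)

lemma parcs_fan_iff:
  "(a, b) \<in> parcs (fan u v ps) \<longleftrightarrow> (a = u \<and> b = v) \<or> (a = v \<and> b = u) \<or>
     (a \<in> {u, v} \<and> b \<in> set (concat ps)) \<or> (a \<in> set (concat ps) \<and> b \<in> {u, v}) \<or> (a, b) \<in> forest_arcs ps"
  unfolding fan_def by (simp del: set_concat)

lemma pair_graph_fan:
  assumes "fan_list u v ps" shows "pair_graph (fan u v ps)"
proof (rule pair_graphI)
  show "finite (pverts (fan u v ps))" by (simp add: fan_def)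
  show "parcs (fan u v ps) \<subseteq> pverts (fan u v ps) \<times> pverts (fan u v ps)"
  proof
    fix e assume e: "e \<in> parcs (fan u v ps)"
    obtain a b where ab: "e = (a, b)" by (cases e)
    show "e \<in> pverts (fan u v ps) \<times> pverts (fan u v ps)"
      using e forest_arcs_set[of a b ps] unfolding ab parcs_fan_iff pverts_fan by (elim disjE) (auto simp del: set_concat)
  qed
  show "sym (parcs (fan u v ps))"
  proof (rule symI)
    fix a b assume "(a, b) \<in> parcs (fan u v ps)"
    then show "(b, a) \<in> parcs (fan u v ps)"
      using forest_arcs_sym[of a b ps] unfolding parcs_fan_iff by (elim disjE) (auto simp del: set_concat)
  qed
  have "(a, a) \<notin> forest_arcs ps" for a
  proof
    assume "(a, a) \<in> forest_arcs ps"
    then obtain p where "p \<in> set ps" "(a, a) \<in> path_arcs p" unfolding forest_arcs_def by auto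
    then show False using path_arcs_irrefl[OF fan_list_distinct_path[OF assms]] by metis
  qed
  moreover have "u \<noteq> v" "u \<notin> set (concat ps)" "v \<notin> set (concat ps)" using assms by (auto simp: fan_list_def)
  ultimately show "irrefl (parcs (fan u v ps))" unfolding irrefl_def parcs_fan_iff by (auto simp del: set_concat)
qed

lemma card_fan:
  assumes "fan_list u v ps" shows "card (pverts (fan u v ps)) = 2 + sum_list (map length ps)"
proof -
  have "pverts (fan u v ps) = set (u # v # concat ps)" by (auto simp: fan_def)
  then show ?thesis using assms distinct_card[of "u # v # concat ps"]
    by (simp add: fan_list_def length_concat)
qed

text \<open>Equal lengths cut the two flattened vertex lists at the same places, so matching them
  position by position carries path to path.\<close>

lemma isomorphic_fan_same_lengths:
  assumes ps: "fan_list u v ps" and qs: "fan_list u' v' qs" and len: "map length ps = map length qs"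
  shows "isomorphic (fan u v ps) (fan u' v' qs)"
proof -
  let ?xs = "u # v # concat ps" and ?ys = "u' # v' # concat qs"
  have len2: "length ?xs = length ?ys" using len by (simp add: length_concat)
  have d: "distinct ?xs" "distinct ?ys" using ps qs by (simp_all add: fan_list_def)
  define f where "f x = the (map_of (zip ?xs ?ys) x)" for x
  have fn: "f (?xs ! i) = ?ys ! i" if "i < length ?xs" for i
    using map_of_zip_nth[OF len2 d(1), of i] that len2 unfolding f_def by simp
  have mf: "map f ?xs = ?ys"
  proof (rule nth_equalityI)
    show "length (map f ?xs) = length ?ys" using len2 by (simp only: length_map)
    fix i assume "i < length (map f ?xs)"
    then have i: "i < length ?xs" by (simp only: length_map)
    show "map f ?xs ! i = ?ys ! i" using fn[OF i] nth_map[OF i, of f] by (simp only:)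
  qed
  then have f: "f u = u'" "f v = v'" "map f (concat ps) = concat qs" by simp_all
  have inj: "inj_on f (set ?xs)"
    using d(2) mf by (metis distinct_map)
  have "concat (map (map f) ps) = concat qs" using f(3) by (simp add: map_concat)
  then have mm: "map (map f) ps = qs"
  proof (rule concat_injective)
    show l: "length (map (map f) ps) = length qs" using len by (metis length_map)
    have "length (ps ! i) = length (qs ! i)" if "i < length ps" for i
      using arg_cong[OF len, of "\<lambda>l. l ! i"] that l by simp
    then show "\<forall>(x, y)\<in>set (zip (map (map f) ps) qs). length x = length y"
      by (auto simp: set_zip)
  qed
  show ?thesis
  proof (rule isomorphicI)
    show "pair_wf_digraph (fan u v ps)"
      using pair_graph_fan[OF ps] by (simp add: pair_graph_def pair_digraph_def pair_fin_digraph_def)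
    show "inj_on f (pverts (fan u v ps))" using inj by (simp add: fan_def)
    have s: "set (concat qs) = f ` set (concat ps)" using f(3) by (metis set_map)
    show "pverts (fan u' v' qs) = f ` pverts (fan u v ps)"
      using f s by (simp add: fan_def del: set_concat)
    have "forest_arcs qs = map_prod f f ` forest_arcs ps"
      unfolding forest_arcs_def mm[symmetric] by (simp add: path_arcs_map image_UN)
    moreover have "map_prod f f ` (A \<times> B) = f ` A \<times> f ` B" for A B by force
    moreover have "{u', v'} = f ` {u, v}" using f by simp
    ultimately show "parcs (fan u' v' qs) = map_prod f f ` parcs (fan u v ps)"
      using f(1,2) s unfolding fan_def
      by (simp only: pair_pre_digraph.simps image_Un image_insert image_empty map_prod_simp)
  qed
qed

lemma isomorphic_fan:
  assumes ps: "fan_list u v ps" and qs: "fan_list u' v' qs"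
    and len: "mset (map length ps) = mset (map length qs)"
  shows "isomorphic (fan u v ps) (fan u' v' qs)"
proof -
  let ?ps = "sort_key length ps" and ?qs = "sort_key length qs"
  have "map length ?ps = map length ?qs"
  proof (rule properties_for_sort[symmetric, THEN trans, OF _ _ properties_for_sort])
    show "mset (map length ?ps) = mset (map length ps)" by simp
    show "sorted (map length ?ps)" by simp
    show "mset (map length ?qs) = mset (map length ps)" using len by simp
    show "sorted (map length ?qs)" by simp
  qed
  moreover have "fan_list u v ?ps" "fan u v ?ps = fan u v ps" "fan_list u' v' ?qs" "fan u' v' ?qs = fan u' v' qs"
    using fan_list_cong[OF ps, of ?ps] fan_list_cong[OF qs, of ?qs] by simp_all
  ultimately show ?thesis using isomorphic_fan_same_lengths by metis
qed

definition target_lengths :: "nat \<Rightarrow> nat \<Rightarrow> nat \<Rightarrow> nat list" where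
  "target_lengths n n1 n2 = n1 # replicate (H_alpha n n1 n2) n2 @ [H_beta n n1 n2]"

lemma path_arcs_map_upt:
  "path_arcs (map f [0..<m]) = {(f i, f j) | i j. i < m \<and> j < m \<and> (j = Suc i \<or> i = Suc j)}"
proof -
  have "path_arcs (map f [0..<m]) = (\<lambda>(i, j). (f i, f j)) ` {(i, j). i < m \<and> j < m \<and> (j = Suc i \<or> i = Suc j)}"
    unfolding path_arcs_def by (rule image_cong) auto
  also have "\<dots> = {(f i, f j) | i j. i < m \<and> j < m \<and> (j = Suc i \<or> i = Suc j)}" by force
  finally show ?thesis .
qed

lemma target_is_fan:
  assumes "n1 \<ge> 1" "n2 \<ge> 1"
  obtains ps where "fan_list (Inl 0) (Inl 1) ps" "map length ps = target_lengths n n1 n2"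
    "graph_join (complete_graph 2) (H_graph n n1 n2) = fan (Inl 0) (Inl 1) ps"
proof -
  define a b where "a = H_alpha n n1 n2" and "b = H_beta n n1 n2"
  have b: "b \<ge> 1" by (simp add: b_def H_beta_def)
  define p0 :: "(nat + nat + nat \<times> nat + nat) list" where "p0 = map (\<lambda>i. Inr (Inl i)) [0..<n1]"
  define pa :: "nat \<Rightarrow> (nat + nat + nat \<times> nat + nat) list"
    where "pa i = map (\<lambda>j. Inr (Inr (Inl (i, j)))) [0..<n2]" for i
  define pb :: "(nat + nat + nat \<times> nat + nat) list" where "pb = map (\<lambda>i. Inr (Inr (Inr i))) [0..<b]"
  define ps where "ps = p0 # map pa [0..<a] @ [pb]"
  have set_ps: "set (concat ps) = {Inr (Inl i) | i. i < n1} \<union> {Inr (Inr (Inl (i, j))) | i j. i < a \<and> j < n2}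
      \<union> {Inr (Inr (Inr i)) | i. i < b}"
    by (auto simp: ps_def p0_def pa_def pb_def)
  have "distinct (concat (map pa [0..<a]))"
  proof -
    have "pa i \<noteq> [] \<and> [] \<noteq> pa i" for i using assms by (simp add: pa_def)
    then have 1: "removeAll [] (map pa [0..<a]) = map pa [0..<a]" by (intro removeAll_id) auto
    have "hd (pa i) = Inr (Inr (Inl (i, 0)))" for i using assms by (simp add: pa_def hd_map)
    then have "pa i = pa j \<Longrightarrow> i = j" for i j by (metis Inl_inject Inr_inject prod.inject)
    then have 2: "distinct (map pa [0..<a])" by (simp add: distinct_map inj_on_def)
    have 3: "distinct (pa i)" for i unfolding pa_def by (simp add: distinct_map inj_on_def)
    have 4: "set (pa i) \<inter> set (pa j) = {}" if "i \<noteq> j" for i j using that unfolding pa_def by auto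
    show ?thesis unfolding distinct_concat_iff 1
    proof (intro conjI allI impI)
      fix ys zs assume "ys \<in> set (map pa [0..<a]) \<and> zs \<in> set (map pa [0..<a]) \<and> ys \<noteq> zs"
      then obtain i j where "ys = pa i" "zs = pa j" by auto
      then show "set ys \<inter> set zs = {}" using 4[of i j] \<open>_ \<and> _ \<and> ys \<noteq> zs\<close> by (cases "i = j") auto
    next
      fix ys assume "ys \<in> set (map pa [0..<a])"
      then show "distinct ys" using 3 by auto
    qed (rule 2)
  qed
  then have fl: "fan_list (Inl 0) (Inl 1) ps"
    using assms b by (auto simp: fan_list_def ps_def p0_def pb_def pa_def distinct_map inj_on_def)
  have len: "map length ps = target_lengths n n1 n2"
    by (simp add: ps_def p0_def pa_def pb_def target_lengths_def a_def b_def comp_def map_replicate_const)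
  have two: "i < 2 \<longleftrightarrow> i = 0 \<or> i = 1" for i :: nat by auto
  have "forest_arcs ps = {(Inr (Inl i), Inr (Inl j)) | i j. i < n1 \<and> j < n1 \<and> (j = Suc i \<or> i = Suc j)}
     \<union> {(Inr (Inr (Inl (k, i))), Inr (Inr (Inl (k, j)))) | k i j. k < a \<and> i < n2 \<and> j < n2 \<and> (j = Suc i \<or> i = Suc j)}
     \<union> {(Inr (Inr (Inr i)), Inr (Inr (Inr j))) | i j. i < b \<and> j < b \<and> (j = Suc i \<or> i = Suc j)}"
    unfolding forest_arcs_def ps_def p0_def pa_def pb_def by (auto simp: path_arcs_map_upt)
  moreover have "parcs (H_graph n n1 n2) = {(Inl i, Inl j) | i j. i < n1 \<and> j < n1 \<and> (j = Suc i \<or> i = Suc j)}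
     \<union> {(Inr (Inl (k, i)), Inr (Inl (k, j))) | k i j. k < a \<and> i < n2 \<and> j < n2 \<and> (j = Suc i \<or> i = Suc j)}
     \<union> {(Inr (Inr i), Inr (Inr j)) | i j. i < b \<and> j < b \<and> (j = Suc i \<or> i = Suc j)}"
    unfolding H_graph_def disjoint_union_def copies_def path_graph_def a_def b_def by auto
  ultimately have fa: "forest_arcs ps = {(Inr x, Inr y) | x y. (x, y) \<in> parcs (H_graph n n1 n2)}"
    by auto
  have sv: "set (concat ps) = Inr ` pverts (H_graph n n1 n2)"
    unfolding set_ps H_graph_def disjoint_union_def copies_def path_graph_def a_def b_def by force
  have "graph_join (complete_graph 2) (H_graph n n1 n2) = fan (Inl 0) (Inl 1) ps"
    unfolding graph_join_def fan_def fa sv disjoint_union_def complete_graph_def two by auto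
  then show thesis using that fl len by blast
qed

section \<open>Fans are planar\<close>

lemma planar_subgraph:
  assumes "planar G" "pverts H = pverts G" "parcs H \<subseteq> parcs G"
  shows "planar H"
proof -
  obtain p \<gamma> where d: "planar_drawing G p \<gamma>" using assms(1) unfolding planar_def by blast
  have "graph_edges H \<subseteq> graph_edges G" using assms(3) unfolding graph_edges_def by blast
  then have "planar_drawing H p \<gamma>" using d assms(2) unfolding planar_drawing_def by (simp add: subset_iff)
  then show ?thesis unfolding planar_def by blast
qed

text \<open>Because no vertex is isolated, a vertex on a foreign segment would be an end of another
  edge; the condition on pairs of edges thus also keeps vertices off the edges.\<close>

lemma planar_straight:
  fixes pt :: "'a \<Rightarrow> complex"
  assumes inj: "inj_on pt (pverts G)" and graph: "pair_graph G"
    and nonisolated: "\<And>w. w \<in> pverts G \<Longrightarrow> \<exists>e\<in>graph_edges G. w \<in> e"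
    and cross: "\<And>e e'. e \<in> graph_edges G \<Longrightarrow> e' \<in> graph_edges G \<Longrightarrow> e \<noteq> e' \<Longrightarrow>
      (convex hull (pt ` e) - pt ` e) \<inter> convex hull (pt ` e') = {}"
  shows "planar G"
proof -
  interpret pair_graph G by (rule graph)
  have "\<exists>g. Path_Connected.arc g \<and> {pathstart g, pathfinish g} = pt ` e \<and> path_image g = convex hull (pt ` e)"
    if e: "e \<in> graph_edges G" for e
  proof -
    obtain a b where ab: "e = {a, b}" "(a, b) \<in> parcs G" using e by (auto simp: graph_edges_def)
    then have "a \<in> pverts G" "b \<in> pverts G" "a \<noteq> b" using in_arcsD1 in_arcsD2 pair_no_loops by force+
    then have "pt a \<noteq> pt b" using inj by (auto dest: inj_onD)
    then show ?thesis using ab by (intro exI[of _ "linepath (pt a) (pt b)"]) (simp add: segment_convex_hull)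
  qed
  then obtain \<gamma> where \<gamma>: "\<And>e. e \<in> graph_edges G \<Longrightarrow> Path_Connected.arc (\<gamma> e) \<and>
    {pathstart (\<gamma> e), pathfinish (\<gamma> e)} = pt ` e \<and> path_image (\<gamma> e) = convex hull (pt ` e)" by metis
  have V: "e \<subseteq> pverts G" if "e \<in> graph_edges G" for e
    using that in_arcsD1 in_arcsD2 by (auto simp: graph_edges_def)
  have "(path_image (\<gamma> e) - pt ` e) \<inter> pt ` pverts G = {}" if e: "e \<in> graph_edges G" for e
  proof (rule ccontr)
    assume "\<not> ?thesis"
    then obtain w where w: "w \<in> pverts G" "pt w \<in> path_image (\<gamma> e)" "pt w \<notin> pt ` e" by blast
    then obtain e' where e': "e' \<in> graph_edges G" "w \<in> e'" using nonisolated by blast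
    then have "e \<noteq> e'" using w by blast
    moreover have "pt w \<in> convex hull (pt ` e')" using e' by (simp add: hull_inc)
    ultimately show False using cross[OF e e'(1)] w \<gamma>[OF e] by auto
  qed
  then have "planar_drawing G pt \<gamma>"
    unfolding planar_drawing_def using inj \<gamma> cross by simp
  then show ?thesis unfolding planar_def by blast
qed

lemma segment_to_imag_axis:
  assumes "z \<in> closed_segment (of_real s) (\<i> * of_real r)" "\<bar>s\<bar> = 1"
  shows "0 \<le> s * Re z \<and> s * Re z \<le> 1 \<and> Im z = (1 - s * Re z) * r"
proof -
  obtain t where t: "0 \<le> t" "t \<le> 1" "z = (1 - t) *\<^sub>R of_real s + t *\<^sub>R (\<i> * of_real r)"
    using assms(1) unfolding closed_segment_def by auto
  have "s * s = 1" using assms(2) by (metis abs_mult_self_eq mult_1)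
  moreover have z: "Re z = (1 - t) * s" "Im z = t * r" using t(3) by simp_all
  ultimately have "s * Re z = 1 - t" by (metis mult.assoc mult.commute mult_1)
  then show ?thesis using t(1,2) z(2) by simp
qed

text \<open>Drawn with \<open>u\<close> at -1, \<open>v\<close> at 1 and the path going up the
  imaginary axis from \<i>. Edges at \<open>u\<close> fill the left of the axis, edges at
  \<open>v\<close> the right, and the edge \<open>uv\<close> lies on the real axis.\<close>

lemma planar_full_fan:
  assumes d: "distinct (u # v # cs)" and ne: "cs \<noteq> []"
  shows "planar (fan u v [cs])"
proof -
  let ?G = "fan u v [cs]"
  define m where "m = length cs"
  define idx where "idx w = (THE k. k < m \<and> cs ! k = w)" for w
  have idx: "idx (cs ! k) = k" if "k < m" for k
    unfolding idx_def by (rule the_equality) (use that d in \<open>auto simp: m_def nth_eq_iff_index_eq\<close>)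
  define pt where "pt w = (if w = u then -1 else if w = v then 1 else \<i> * of_real (real (idx w) + 1))" for w
  have cm: "cs ! k \<in> set cs" if "k < m" for k using that by (simp add: m_def)
  have ptc: "pt (cs ! k) = \<i> * of_real (real k + 1)" if "k < m" for k
    using cm[OF that] idx[OF that] d by (auto simp: pt_def)
  have ptu: "pt u = of_real (-1)" and ptv: "pt v = of_real 1" using d by (auto simp: pt_def)
  have E: "graph_edges ?G = {{u, v}} \<union> {{u, cs ! k} | k. k < m} \<union> {{v, cs ! k} | k. k < m}
      \<union> {{cs ! k, cs ! Suc k} | k. Suc k < m}" (is "_ = ?E")
  proof
    show "graph_edges ?G \<subseteq> ?E"
    proof
      fix e assume "e \<in> graph_edges ?G"
      then obtain a b where ab: "e = {a, b}" "(a, b) \<in> parcs ?G" by (auto simp: graph_edges_def)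
      have sc: "w \<in> set cs \<Longrightarrow> \<exists>k<m. w = cs ! k" for w by (auto simp: m_def in_set_conv_nth)
      show "e \<in> ?E" using ab(2) unfolding parcs_fan_iff
      proof (elim disjE conjE)
        assume "(a, b) \<in> forest_arcs [cs]"
        then obtain i j where "a = cs ! i" "b = cs ! j" "i < m" "j < m" "j = Suc i \<or> i = Suc j"
          by (auto simp: forest_arcs_def path_arcs_def m_def)
        then show ?thesis unfolding ab(1) by (auto simp: insert_commute)
      next
        assume "a \<in> {u, v}" "b \<in> set (concat [cs])"
        then obtain k where "k < m" "b = cs ! k" using sc by auto
        then show ?thesis using \<open>a \<in> {u, v}\<close> unfolding ab(1) by auto
      next
        assume "b \<in> {u, v}" "a \<in> set (concat [cs])"
        then obtain k where "k < m" "a = cs ! k" using sc by auto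
        then show ?thesis using \<open>b \<in> {u, v}\<close> unfolding ab(1) by (auto simp: insert_commute)
      qed (auto simp: ab(1))
    qed
    have mem: "{a, b} \<in> graph_edges ?G" if "(a, b) \<in> parcs ?G" for a b
      using that by (auto simp: graph_edges_def)
    have "(cs ! k, cs ! Suc k) \<in> forest_arcs [cs]" if "Suc k < m" for k
      using that by (force simp: forest_arcs_def path_arcs_def m_def)
    then show "?E \<subseteq> graph_edges ?G"
      using cm by (auto intro!: mem simp: parcs_fan_iff)
  qed
  have hull2: "convex hull (pt ` {a, b}) = closed_segment (pt a) (pt b)" for a b
    by (simp add: segment_convex_hull)
  have uk: "Re z \<le> 0 \<and> -1 \<le> Re z \<and> Im z = (1 + Re z) * (real k + 1)"
    if "z \<in> convex hull (pt ` {u, cs ! k})" "k < m" for z k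
    using segment_to_imag_axis[of z "-1" "real k + 1"] that unfolding hull2 ptu ptc[OF that(2)] by simp
  have vk: "0 \<le> Re z \<and> Re z \<le> 1 \<and> Im z = (1 - Re z) * (real k + 1)"
    if "z \<in> convex hull (pt ` {v, cs ! k})" "k < m" for z k
    using segment_to_imag_axis[of z "1" "real k + 1"] that unfolding hull2 ptv ptc[OF that(2)] by simp
  have uv: "Im z = 0" if "z \<in> convex hull (pt ` {u, v})" for z
    using that unfolding hull2 ptu ptv closed_segment_def by auto
  have kk: "Re z = 0 \<and> real k + 1 \<le> Im z \<and> Im z \<le> real k + 2"
    if z: "z \<in> convex hull (pt ` {cs ! k, cs ! Suc k})" "Suc k < m" for z k
  proof -
    obtain t where "0 \<le> t" "t \<le> 1" "z = (1 - t) *\<^sub>R pt (cs ! k) + t *\<^sub>R pt (cs ! Suc k)"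
      using z(1) unfolding hull2 closed_segment_def by auto
    moreover from this have "Re z = 0" "Im z = (1 - t) * (real k + 1) + t * (real (Suc k) + 1)"
      using z(2) ptc[of k] ptc[of "Suc k"] by simp_all
    ultimately show ?thesis by (simp add: algebra_simps)
  qed
  \<comment> \<open>A necessary condition for \<open>z\<close> to lie on the segment of
    \<open>e\<close>, in coordinates. For a point that is no end of its own edge it determines the
    edge, which excludes crossings.\<close>
  define Q where "Q e z \<longleftrightarrow> (e = {u, v} \<and> Im z = 0) \<or>
      (\<exists>k<m. e = {u, cs ! k} \<and> Re z \<le> 0 \<and> -1 \<le> Re z \<and> Im z = (1 + Re z) * (real k + 1)) \<or>
      (\<exists>k<m. e = {v, cs ! k} \<and> 0 \<le> Re z \<and> Re z \<le> 1 \<and> Im z = (1 - Re z) * (real k + 1)) \<or>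
      (\<exists>k. Suc k < m \<and> e = {cs ! k, cs ! Suc k} \<and> Re z = 0 \<and> real k + 1 \<le> Im z \<and> Im z \<le> real k + 2)" for e z
  have closed: "Q e z" if e: "e \<in> graph_edges ?G" and z: "z \<in> convex hull (pt ` e)" for e z
    using e unfolding E
  proof (elim UnE)
    assume "e \<in> {{u, v}}"
    then show ?thesis using z uv by (auto simp: Q_def)
  next
    assume "e \<in> {{u, cs ! k} | k. k < m}"
    then obtain k where "k < m" "e = {u, cs ! k}" by blast
    then show ?thesis using z uk[of z k] unfolding Q_def by blast
  next
    assume "e \<in> {{v, cs ! k} | k. k < m}"
    then obtain k where "k < m" "e = {v, cs ! k}" by blast
    then show ?thesis using z vk[of z k] unfolding Q_def by blast
  next
    assume "e \<in> {{cs ! k, cs ! Suc k} | k. Suc k < m}"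
    then obtain k where "Suc k < m" "e = {cs ! k, cs ! Suc k}" by blast
    then show ?thesis using z kk[of z k] unfolding Q_def by blast
  qed
  have eqC: "z = pt w \<longleftrightarrow> Re z = Re (pt w) \<and> Im z = Im (pt w)" for z w by (rule complex_eq_iff)
  have unique: "e = e'" if e: "e \<in> graph_edges ?G" and z: "z \<in> convex hull (pt ` e)" "z \<notin> pt ` e" and e': "Q e' z" for e e' z
  proof -
    from closed[OF e z(1)] have "Q e z" .
    then consider (uv) "e = {u, v}" "Im z = 0"
      | (u) k where "k < m" "e = {u, cs ! k}" "Re z \<le> 0" "-1 \<le> Re z" "Im z = (1 + Re z) * (real k + 1)"
      | (v) k where "k < m" "e = {v, cs ! k}" "0 \<le> Re z" "Re z \<le> 1" "Im z = (1 - Re z) * (real k + 1)"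
      | (k) k where "Suc k < m" "e = {cs ! k, cs ! Suc k}" "Re z = 0" "real k + 1 \<le> Im z" "Im z \<le> real k + 2"
      unfolding Q_def by blast
    then show ?thesis
    proof cases
      case uv
      have ne: "Re z \<noteq> -1" "Re z \<noteq> 1" using z(2) uv ptu ptv by (auto simp: complex_eq_iff)
      then have "Im z \<noteq> (1 + Re z) * (real k + 1)" "Im z \<noteq> (1 - Re z) * (real k + 1)" for k using uv by auto
      moreover have "\<not> real k + 1 \<le> Im z" for k using uv by simp
      ultimately show ?thesis using e' uv(1) unfolding Q_def by blast
    next
      case (u k)
      have ne: "z \<noteq> pt u" "z \<noteq> pt (cs ! k)" using z(2) u by auto
      have "Re z \<noteq> -1" using ne(1) u(5) ptu by (auto simp: complex_eq_iff)
      moreover have "Re z \<noteq> 0" using ne(2) u(5) ptc[OF u(1)] by (auto simp: complex_eq_iff)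
      ultimately have s: "-1 < Re z" "Re z < 0" using u by auto
      then have "Im z > 0" using u(5) by simp
      then show ?thesis using e' s u(2,5) unfolding Q_def by auto
    next
      case (v k)
      have ne: "z \<noteq> pt v" "z \<noteq> pt (cs ! k)" using z(2) v by auto
      have "Re z \<noteq> 1" using ne(1) v(5) ptv by (auto simp: complex_eq_iff)
      moreover have "Re z \<noteq> 0" using ne(2) v(5) ptc[OF v(1)] by (auto simp: complex_eq_iff)
      ultimately have s: "Re z < 1" "0 < Re z" using v by auto
      then have "Im z > 0" using v(5) by simp
      then show ?thesis using e' s v(2,5) unfolding Q_def by auto
    next
      case (k k)
      have ne: "z \<noteq> pt (cs ! k)" "z \<noteq> pt (cs ! Suc k)" using z(2) k by auto
      have "Im z \<noteq> real k + 1" "Im z \<noteq> real k + 2"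
        using ne k ptc[of k] ptc[of "Suc k"] by (auto simp: complex_eq_iff)
      then have s: "real k + 1 < Im z" "Im z < real k + 2" using k by auto
      have "Im z \<noteq> real j + 1" for j
      proof
        assume "Im z = real j + 1"
        then have "real k < real j" "real j < real (Suc k)" using s by auto
        then show False by simp
      qed
      moreover have "j = k" if "real j + 1 \<le> Im z" "Im z \<le> real j + 2" for j
      proof -
        have "real j < real (Suc k)" "real k < real (Suc j)" using s that by auto
        then show ?thesis by simp
      qed
      moreover have "Im z \<noteq> 0" using s by auto
      ultimately show ?thesis using e' k(2,3) unfolding Q_def by auto
    qed
  qed
  show ?thesis
  proof (rule planar_straight[where pt = pt])
    show "pair_graph ?G" by (rule pair_graph_fan) (use d ne in \<open>auto simp: fan_list_def\<close>)
    have "inj_on pt (set cs)"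
      by (rule inj_onI) (auto simp: in_set_conv_nth ptc m_def[symmetric])
    moreover have "pt u \<noteq> pt v" "pt u \<notin> pt ` set cs" "pt v \<notin> pt ` set cs"
      using ptu ptv ptc by (auto simp: in_set_conv_nth m_def[symmetric] complex_eq_iff)
    ultimately show "inj_on pt (pverts ?G)" by (auto simp: pverts_fan)
    show "\<exists>e\<in>graph_edges ?G. w \<in> e" if "w \<in> pverts ?G" for w
      using that unfolding E by (auto simp: pverts_fan in_set_conv_nth m_def[symmetric])
    show "(convex hull (pt ` e) - pt ` e) \<inter> convex hull (pt ` e') = {}"
      if "e \<in> graph_edges ?G" "e' \<in> graph_edges ?G" "e \<noteq> e'" for e e'
    proof (rule ccontr)
      assume "\<not> ?thesis"
      then obtain z where "z \<in> convex hull (pt ` e)" "z \<notin> pt ` e" "z \<in> convex hull (pt ` e')" by blast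
      then show False using unique[OF that(1)] closed[OF that(2)] that(3) by blast
    qed
  qed
qed

lemma path_arcs_iff:
  "(a, b) \<in> path_arcs p \<longleftrightarrow>
     (\<exists>i j. i < length p \<and> j < length p \<and> (j = Suc i \<or> i = Suc j) \<and> a = p ! i \<and> b = p ! j)"
  by (auto simp: path_arcs_def)

lemma path_arcs_append: "path_arcs p \<subseteq> path_arcs (a @ p @ b)"
proof
  fix e assume e: "e \<in> path_arcs p"
  obtain x y where xy: "e = (x, y)" by (cases e)
  obtain i j where ij: "i < length p" "j < length p" "j = Suc i \<or> i = Suc j" "x = p ! i" "y = p ! j"
    using e unfolding xy path_arcs_iff by blast
  have "(a @ p @ b) ! (length a + k) = p ! k" if "k < length p" for k
    using that by (simp add: nth_append)
  then show "e \<in> path_arcs (a @ p @ b)"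
    unfolding xy path_arcs_iff using ij
    by (intro exI[of _ "length a + i"] exI[of _ "length a + j"]) auto
qed

text \<open>Running all paths together into one long path only adds edges.\<close>

lemma planar_fan:
  assumes "fan_list u v ps" "ps \<noteq> []"
  shows "planar (fan u v ps)"
proof (rule planar_subgraph)
  have "concat ps \<noteq> []" using assms by (cases ps) (auto simp: fan_list_def)
  then show "planar (fan u v [concat ps])"
    using assms by (intro planar_full_fan) (auto simp: fan_list_def)
  show "pverts (fan u v ps) = pverts (fan u v [concat ps])" by (simp add: pverts_fan)
  have "path_arcs p \<subseteq> path_arcs (concat ps)" if p: "p \<in> set ps" for p
  proof -
    obtain ys zs where "ps = ys @ p # zs" using split_list[OF p] by blast
    then show ?thesis using path_arcs_append[of p "concat ys" "concat zs"] by simp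
  qed
  then have "forest_arcs ps \<subseteq> forest_arcs [concat ps]" by (auto simp: forest_arcs_def)
  then show "parcs (fan u v ps) \<subseteq> parcs (fan u v [concat ps])"
    by (auto simp: fan_def)
qed

section \<open>Pairs of disjoint cycles\<close>

text \<open>A single edge, listed as two vertices, also qualifies in a symmetric relation, so a
  length of at least 3 is asked for separately.\<close>

definition cycle_list :: "('a \<times> 'a) set \<Rightarrow> 'a list \<Rightarrow> bool" where
  "cycle_list E c \<longleftrightarrow> gpath E c \<and> (last c, hd c) \<in> E"

definition two_cycles :: "('a \<times> 'a) set \<Rightarrow> nat \<Rightarrow> bool" where
  "two_cycles E l \<longleftrightarrow> (\<exists>c d. cycle_list E c \<and> cycle_list E d \<and> length c = l \<and> length d = l \<and> set c \<inter> set d = {})"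

lemma cycle_list_next:
  assumes "cycle_list E c" "i < length c"
  shows "(c ! i, c ! (Suc i mod length c)) \<in> E"
proof (cases "Suc i < length c")
  case True
  then show ?thesis using assms by (simp add: cycle_list_def gpath_def successively_conv_nth)
next
  case False
  then have "Suc i = length c" "c \<noteq> []" using assms by auto
  then have "c ! i = last c" "Suc i mod length c = 0" by (simp_all add: last_conv_nth flip: \<open>Suc i = length c\<close>)
  then show ?thesis using assms \<open>c \<noteq> []\<close> by (simp add: cycle_list_def hd_conv_nth)
qed

lemma cycle_list_two_nbs:
  assumes c: "cycle_list E c" "length c \<ge> 3" "sym E" "w \<in> set c"
  obtains y z where "y \<in> set c" "z \<in> set c" "y \<noteq> z" "(w, y) \<in> E" "(w, z) \<in> E"
proof -
  let ?n = "length c"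
  obtain i where i: "i < ?n" "c ! i = w" using c(4) by (auto simp: in_set_conv_nth)
  let ?j = "Suc i mod ?n" and ?k = "(if i = 0 then ?n - 1 else i - 1)"
  have "?n > 0" using c by linarith
  then have n: "?j < ?n" "?k < ?n" using i by auto
  have "Suc ?k mod ?n = i" using i by auto
  then have "(c ! ?k, w) \<in> E" using cycle_list_next[OF c(1) n(2)] i by simp
  moreover have "(w, c ! ?j) \<in> E" using cycle_list_next[OF c(1) i(1)] i by simp
  moreover have "?j \<noteq> ?k"
    using c(2) i by (cases "Suc i = ?n") (auto split: if_splits)
  then have "c ! ?j \<noteq> c ! ?k" using c n by (simp add: cycle_list_def gpath_def nth_eq_iff_index_eq)
  ultimately show thesis using that[of "c ! ?j" "c ! ?k"] n c(3) by (auto dest: symD)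
qed

lemma cycle_list_rotate:
  assumes "cycle_list E c" "u \<in> set c"
  obtains r where "cycle_list E (u # r)" "set (u # r) = set c" "length (u # r) = length c"
proof -
  obtain a b where ab: "c = a @ u # b" using split_list[OF assms(2)] by blast
  have g: "gpath E (a @ u # b)" "(last (u # b), hd (a @ [u])) \<in> E"
    using assms(1) ab by (cases a; auto simp: cycle_list_def)+
  have "cycle_list E ((u # b) @ a)"
  proof (cases "a = []")
    case True
    then show ?thesis using assms(1) ab by simp
  next
    case False
    then have "gpath E a" "gpath E (u # b)" "set a \<inter> set (u # b) = {}" "(last a, u) \<in> E"
      using g(1) by (auto simp: gpath_append)
    moreover have "(last (u # b), hd a) \<in> E" using g(2) False by simp
    ultimately have "gpath E ((u # b) @ a)" unfolding gpath_append using False by blast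
    then show ?thesis using False \<open>(last a, u) \<in> E\<close> by (simp add: cycle_list_def)
  qed
  then have "cycle_list E (u # (b @ a))" by simp
  moreover have "set (u # b @ a) = set c" "length (u # b @ a) = length c" using ab by auto
  ultimately show thesis using that by blast
qed

lemma apex_cycle:
  assumes "gpath E r" "u \<notin> set r" "\<And>x. x \<in> set r \<Longrightarrow> (u, x) \<in> E \<and> (x, u) \<in> E"
  shows "cycle_list E (u # r)"
proof -
  have "r \<noteq> []" using assms(1) by (simp add: gpath_def)
  then show ?thesis
    using assms gpath_append[of E "[u]" r] by (auto simp: cycle_list_def)
qed

lemma pair_wf_copies_cycle: "pair_wf_digraph (copies k (cycle_graph l))"
  by unfold_locales (auto simp: copies_def cycle_graph_def)

lemma parcs_copies_cycle:
  "((k, i), (m, j)) \<in> parcs (copies 2 (cycle_graph l)) \<longleftrightarrow>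
     k = m \<and> k < 2 \<and> i < l \<and> j < l \<and> (j = Suc i mod l \<or> i = Suc j mod l)"
  by (auto simp: copies_def cycle_graph_def)

lemma free_of_two_cycles_iff:
  assumes G: "pair_graph G" and l: "l \<ge> 3"
  shows "free_of (copies 2 (cycle_graph l)) G \<longleftrightarrow> \<not> two_cycles (parcs G) l"
proof -
  let ?F = "copies 2 (cycle_graph l)"
  interpret pair_graph G by (rule G)
  have F: "pverts ?F = {0..<2} \<times> {0..<l}" by (simp add: copies_def cycle_graph_def)
  have "\<exists>K :: 'a pair_pre_digraph. subgraph (with_proj K) (with_proj G) \<and> isomorphic ?F K"
    if two: "two_cycles (parcs G) l"
  proof -
    obtain c d where cd: "cycle_list (parcs G) c" "cycle_list (parcs G) d" "length c = l" "length d = l"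
      "set c \<inter> set d = {}" using two by (auto simp: two_cycles_def)
    define f where "f = (\<lambda>(i::nat, j). if i = 0 then c ! j else d ! j)"
    define K where "K = \<lparr>pverts = f ` pverts ?F, parcs = map_prod f f ` parcs ?F\<rparr>"
    have dist: "distinct c" "distinct d" using cd by (auto simp: cycle_list_def gpath_def)
    have dis: "c ! i \<noteq> d ! j" if "i < l" "j < l" for i j
      using cd(3-5) that nth_mem[of i c] nth_mem[of j d] by (metis disjoint_iff)
    have inj: "inj_on f (pverts ?F)"
      unfolding F
    proof (rule inj_onI)
      fix x y :: "nat \<times> nat" assume "x \<in> {0..<2} \<times> {0..<l}" "y \<in> {0..<2} \<times> {0..<l}" "f x = f y"
      then show "x = y"
        using dis dist cd(3,4) dis[symmetric]
        by (cases x; cases y) (auto simp: f_def nth_eq_iff_index_eq less_2_cases_iff split: if_splits)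
    qed
    have wfF: "pair_wf_digraph ?F" by (rule pair_wf_copies_cycle)
    have arcF: "(f a, f b) \<in> parcs G" if "(a, b) \<in> parcs ?F" for a b
    proof -
      obtain k i m j where ab: "a = (k, i)" "b = (m, j)" by (cases a; cases b)
      have h: "k = m" "k < 2" "i < l" "j < l" "j = Suc i mod l \<or> i = Suc j mod l"
        using that unfolding ab parcs_copies_cycle by auto
      have *: "(e ! i, e ! j) \<in> parcs G" if e: "cycle_list (parcs G) e" "length e = l" for e
        using h(5)
      proof
        assume "j = Suc i mod l"
        then show ?thesis using cycle_list_next[OF e(1), of i] e(2) h(3) by simp
      next
        assume "i = Suc j mod l"
        then have "(e ! j, e ! i) \<in> parcs G" using cycle_list_next[OF e(1), of j] e(2) h(4) by simp
        then show ?thesis by (metis arcs_symmetric)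
      qed
      show ?thesis using *[of c] *[of d] cd h(1) by (simp add: f_def ab)
    qed
    have "isomorphic ?F K" by (rule isomorphicI[OF wfF inj]) (simp_all add: K_def)
    moreover have "subgraph (with_proj K) (with_proj G)"
    proof -
      have "f x \<in> pverts G" if xF: "x \<in> pverts ?F" for x
      proof -
        obtain k i where x: "x = (k, i)" "k < 2" "i < l" using xF F by (cases x) auto
        have "((k, i), (k, Suc i mod l)) \<in> parcs ?F"
          unfolding parcs_copies_cycle using x l by auto
        then show ?thesis using arcF in_arcsD1 x by blast
      qed
      then have V: "pverts K \<subseteq> pverts G" by (auto simp: K_def)
      have A: "parcs K \<subseteq> parcs G" using arcF by (auto simp: K_def)
      have "pair_wf_digraph K"
      proof
        fix e assume "e \<in> parcs K"
        then obtain a b where "e = (f a, f b)" "(a, b) \<in> parcs ?F" by (auto simp: K_def)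
        then show "fst e \<in> pverts K" "snd e \<in> pverts K"
          using pair_wf_digraph.in_arcsD1[OF wfF] pair_wf_digraph.in_arcsD2[OF wfF] by (auto simp: K_def)
      qed
      then have "wf_digraph (with_proj K)" by (simp add: wf_digraph_wp_iff)
      moreover have "wf_digraph (with_proj G)" using pair_wf_digraph_axioms by (simp add: wf_digraph_wp_iff)
      ultimately show ?thesis using V A by (simp add: subgraph_def compatible_def)
    qed
    ultimately show ?thesis by blast
  qed
  moreover have "two_cycles (parcs G) l"
    if K: "subgraph (with_proj K) (with_proj G)" "isomorphic ?F K" for K :: "'a pair_pre_digraph"
  proof -
    obtain f where f: "inj_on f (pverts ?F)" "parcs K = map_prod f f ` parcs ?F"
      by (rule isomorphicD[OF K(2)])
    have KG: "parcs K \<subseteq> parcs G" using K(1) by (simp add: subgraph_def)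
    have arc: "(f a, f b) \<in> parcs G" if "(a, b) \<in> parcs ?F" for a b
      using that f(2) KG by force
    define c where "c k = map (\<lambda>i. f (k, i)) [0..<l]" for k :: nat
    have "cycle_list (parcs G) (c k)" if k: "k < 2" for k
    proof -
      have ne: "c k \<noteq> []" using l by (simp add: c_def)
      have "distinct (c k)"
        unfolding c_def distinct_map using f(1) k by (auto simp: F inj_on_def)
      moreover have "successively (\<lambda>x y. (x, y) \<in> parcs G) (c k)"
        unfolding successively_conv_nth c_def using k by (auto intro!: arc simp: parcs_copies_cycle)
      moreover have "(f (k, l - 1), f (k, 0)) \<in> parcs G"
        by (rule arc) (use k l in \<open>simp add: parcs_copies_cycle\<close>)
      then have "(last (c k), hd (c k)) \<in> parcs G" using l by (simp add: c_def last_map hd_map)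
      ultimately show ?thesis using ne by (simp add: cycle_list_def gpath_def)
    qed
    moreover have "set (c 0) \<inter> set (c 1) = {}"
    proof -
      have "f (0, a) \<noteq> f (Suc 0, b)" if "a < l" "b < l" for a b
        using inj_onD[OF f(1), of "(0, a)" "(Suc 0, b)"] that by (auto simp: F)
      then show ?thesis unfolding c_def by auto
    qed
    moreover have "length (c k) = l" for k by (simp add: c_def)
    ultimately show ?thesis unfolding two_cycles_def
      by (intro exI[of _ "c 0"] exI[of _ "c 1"]) auto
  qed
  ultimately show ?thesis unfolding free_of_def by blast
qed

lemma fan_arc_off_apexes:
  assumes "(a, b) \<in> parcs (fan u v ps)" "a \<notin> {u, v}" "b \<notin> {u, v}"
  shows "(a, b) \<in> forest_arcs ps"
  using assms unfolding parcs_fan_iff by auto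

lemma forest_arc_same_path:
  assumes fl: "fan_list u v ps" and ab: "(a, b) \<in> forest_arcs ps" and p: "p \<in> set ps" "a \<in> set p"
  shows "(a, b) \<in> path_arcs p"
proof -
  obtain q where q: "q \<in> set ps" "(a, b) \<in> path_arcs q" using ab by (auto simp: forest_arcs_def)
  then have "q = p" using fan_list_disjoint[OF fl q(1) p(1) _ p(2)] path_arcs_set by metis
  then show ?thesis using q by simp
qed

text \<open>Off the apexes a cycle would lie in the linear forest. On a path that it meets, the
  cycle vertex with the least index has at most one neighbour in the cycle, its successor.\<close>

lemma fan_cycle_meets_apex:
  assumes fl: "fan_list u v ps" and c: "cycle_list (parcs (fan u v ps)) c" "length c \<ge> 3"
  shows "u \<in> set c \<or> v \<in> set c"
proof (rule ccontr)
  assume no: "\<not> ?thesis"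
  interpret pair_graph "fan u v ps" by (rule pair_graph_fan[OF fl])
  let ?E = "parcs (fan u v ps)"
  have s: "sym ?E" by (rule symI) (metis arcs_symmetric)
  have nb: "\<exists>y\<in>set c. \<exists>z\<in>set c. y \<noteq> z \<and> (w, y) \<in> forest_arcs ps \<and> (w, z) \<in> forest_arcs ps" if "w \<in> set c" for w
    using cycle_list_two_nbs[OF c s that] fan_arc_off_apexes that no by (metis empty_iff insert_iff)
  have "c \<noteq> []" using c by auto
  then obtain p where p: "p \<in> set ps" "hd c \<in> set p"
    using nb[of "hd c"] forest_arcs_set by fastforce
  have dp: "distinct p" by (rule fan_list_distinct_path[OF fl p(1)])
  obtain i0 where "i0 < length p \<and> p ! i0 \<in> set c" using p \<open>c \<noteq> []\<close> by (metis hd_in_set in_set_conv_nth)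
  define i where "i = (LEAST i. i < length p \<and> p ! i \<in> set c)"
  have i: "i < length p" "p ! i \<in> set c"
    unfolding i_def using LeastI[of "\<lambda>i. i < length p \<and> p ! i \<in> set c"] \<open>i0 < _ \<and> _\<close> by auto
  have imin: "i \<le> j" if "j < length p" "p ! j \<in> set c" for j
    unfolding i_def using that by (intro Least_le) auto
  obtain y z where yz: "y \<in> set c" "z \<in> set c" "y \<noteq> z" "(p ! i, y) \<in> forest_arcs ps" "(p ! i, z) \<in> forest_arcs ps"
    using nb[OF i(2)] by blast
  have "w = p ! Suc i" if w: "(p ! i, w) \<in> forest_arcs ps" "w \<in> set c" for w
  proof -
    have "(p ! i, w) \<in> path_arcs p" using forest_arc_same_path[OF fl w(1) p(1)] i by simp
    then obtain j where "j < length p" "w = p ! j" "j = Suc i \<or> i = Suc j"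
      using dp i by (auto simp: path_arcs_def nth_eq_iff_index_eq)
    then show ?thesis using imin[of j] w(2) by auto
  qed
  then show False using yz by blast
qed

lemma fan_path_in_component:
  assumes fl: "fan_list u v ps" and r: "gpath (parcs (fan u v ps)) r" "set r \<inter> {u, v} = {}" "length r \<ge> 2"
  shows "\<exists>p\<in>set ps. set r \<subseteq> set p"
proof -
  have fa: "(r ! i, r ! Suc i) \<in> forest_arcs ps" if "Suc i < length r" for i
  proof (rule fan_arc_off_apexes)
    show "(r ! i, r ! Suc i) \<in> parcs (fan u v ps)"
      using r(1) that by (simp add: gpath_def successively_conv_nth)
    show "r ! i \<notin> {u, v}" "r ! Suc i \<notin> {u, v}"
      using r(2) that nth_mem[of i r] nth_mem[of "Suc i" r] by auto
  qed
  then have "(r ! 0, r ! Suc 0) \<in> forest_arcs ps" using r(3) by simp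
  then obtain p where p: "p \<in> set ps" "r ! 0 \<in> set p" using forest_arcs_set by fastforce
  have "i < length r \<longrightarrow> r ! i \<in> set p" for i
  proof (induction i)
    case (Suc i)
    show ?case
    proof
      assume i: "Suc i < length r"
      then have "(r ! i, r ! Suc i) \<in> path_arcs p" using forest_arc_same_path[OF fl fa[OF i] p(1)] Suc by simp
      then show "r ! Suc i \<in> set p" using path_arcs_set by metis
    qed
  qed (use p in simp)
  then have "set r \<subseteq> set p" by (auto simp: in_set_conv_nth)
  then show ?thesis using p by blast
qed

text \<open>Disjoint cycles that each need an apex get one apex each, and the remaining l - 1
  vertices of either lie on a single path. If it is the same path, it has at least 2 l - 2 vertices;
  otherwise both paths have at least l - 1.\<close>

lemma fan_no_two_cycles:
  assumes fl: "fan_list u v ps" and l: "l \<ge> 3"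
    and long: "\<And>p. p \<in> set ps \<Longrightarrow> length p \<le> 2 * l - 3"
    and one: "\<And>p q. p \<in> set ps \<Longrightarrow> q \<in> set ps \<Longrightarrow> p \<noteq> q \<Longrightarrow> length p < l - 1 \<or> length q < l - 1"
  shows "\<not> two_cycles (parcs (fan u v ps)) l"
proof
  let ?E = "parcs (fan u v ps)"
  assume "two_cycles ?E l"
  then obtain c d where cd: "cycle_list ?E c" "cycle_list ?E d" "length c = l" "length d = l" "set c \<inter> set d = {}"
    by (auto simp: two_cycles_def)
  have uv: "u \<noteq> v" using fl by (auto simp: fan_list_def)
  have "u \<in> set c \<or> v \<in> set c" "u \<in> set d \<or> v \<in> set d"
    using fan_cycle_meets_apex[OF fl] cd l by auto
  then have cases: "(u \<in> set c \<and> v \<notin> set c \<and> v \<in> set d \<and> u \<notin> set d) \<or> (v \<in> set c \<and> u \<notin> set c \<and> u \<in> set d \<and> v \<notin> set d)"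
    using cd(5) by blast
  have comp: "\<exists>p\<in>set ps. \<exists>r. set r \<subseteq> set p \<and> set r \<subseteq> set e \<and> distinct r \<and> length r = l - 1"
    if e: "cycle_list ?E e" "length e = l" "w \<in> set e" "w' \<notin> set e" "{w, w'} = {u, v}" for e w w'
  proof -
    obtain r where r: "cycle_list ?E (w # r)" "set (w # r) = set e" "length (w # r) = length e"
      using cycle_list_rotate[OF e(1,3)] by blast
    have rne: "r \<noteq> []" "length r = l - 1" using r(3) e(2) l by auto
    have "gpath ?E ([w] @ r)" using r(1) by (simp add: cycle_list_def)
    then have g: "gpath ?E r" "w \<notin> set r" using rne unfolding gpath_append by auto
    have "w' \<notin> set r" using r(2) e(4) by auto
    then have "set r \<inter> {w, w'} = {}" using g(2) by blast
    then have "set r \<inter> {u, v} = {}" unfolding e(5) .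
    then obtain p where "p \<in> set ps" "set r \<subseteq> set p"
    proof -
      have "length r \<ge> 2" using rne l by simp
      then show ?thesis using that fan_path_in_component[OF fl g(1) \<open>set r \<inter> {u, v} = {}\<close>] by blast
    qed
    moreover have "distinct r" using g by (simp add: gpath_def)
    ultimately show ?thesis using rne r(2) by (metis set_subset_Cons)
  qed
  obtain w w' where w: "w \<in> set c" "w' \<notin> set c" "w' \<in> set d" "w \<notin> set d" "{w, w'} = {u, v}"
    using cases by (metis insert_commute)
  obtain p r where p: "p \<in> set ps" "set r \<subseteq> set p" "set r \<subseteq> set c" "distinct r" "length r = l - 1"
    using comp[OF cd(1,3) w(1,2,5)] by blast
  obtain q s where q: "q \<in> set ps" "set s \<subseteq> set q" "set s \<subseteq> set d" "distinct s" "length s = l - 1"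
    using comp[OF cd(2,4) w(3,4)] w(5) by (auto simp: insert_commute)
  have len: "l - 1 \<le> length p'" if "set r' \<subseteq> set p'" "distinct r'" "length r' = l - 1" for p' r' :: "'a list"
    using that by (metis List.finite_set card_length card_mono distinct_card le_trans)
  show False
  proof (cases "p = q")
    case False
    then show False using one[OF p(1) q(1)] len[OF p(2,4,5)] len[OF q(2,4,5)] by auto
  next
    case True
    have "distinct (r @ s)" using p q cd(5) by auto
    then have "card (set (r @ s)) = 2 * (l - 1)" using distinct_card[of "r @ s"] p q by simp
    moreover have "set (r @ s) \<subseteq> set p" using p q True by auto
    ultimately have "2 * (l - 1) \<le> length p"
      by (metis List.finite_set card_length card_mono le_trans)
    then show False using long[OF p(1)] l by auto
  qed
qed

section \<open>Spectral radius of a fan\<close>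

text \<open>With \<open>\<rho> = q + 1/q\<close> the adjacency equations on a path on \<open>s\<close> vertices joined to two apexes of
  weight 1 read \<open>\<rho> y\<^sub>i = 2 + y\<^sub>i\<^sub>-\<^sub>1 + y\<^sub>i\<^sub>+\<^sub>1\<close> with zero boundary values; \<open>pathw q s\<close> solves them.\<close>

definition pathw :: "real \<Rightarrow> nat \<Rightarrow> nat \<Rightarrow> real" where
  "pathw q s k = 2 * q / (1 - q)\<^sup>2 * (1 - (q ^ k + q ^ (s + 1 - k)) / (1 + q ^ (s + 1)))"

definition pathg :: "real \<Rightarrow> nat \<Rightarrow> real" where
  "pathg q s = (1 - q ^ s) / (1 + q ^ (s + 1))"

text \<open>Total weight of a path, by the geometric series (\<open>pathw_sum\<close>): a part
  linear in \<open>s\<close> minus a multiple of \<open>pathg\<close>, and only the latter feels how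
  the vertices are divided into paths.\<close>

definition pathsum :: "real \<Rightarrow> nat \<Rightarrow> real" where
  "pathsum q s = 2 * q / (1 - q)\<^sup>2 * (real s - 2 * q / (1 - q) * pathg q s)"

lemma pathw_boundary: "0 < q \<Longrightarrow> pathw q s 0 = 0" "0 < q \<Longrightarrow> pathw q s (s + 1) = 0"
proof -
  assume q: "0 < q"
  then have "1 + q ^ (s + 1) > 0" by (simp add: add_pos_pos)
  then show "pathw q s 0 = 0" "pathw q s (s + 1) = 0" by (simp_all add: pathw_def add.commute)
qed

text \<open>The powers of exponents k and s + 1 - k both solve the homogeneous recursion, and the
  factor 2 q / (1 - q)^2 is chosen so that the constant part produces 2.\<close>

lemma pathw_rec:
  assumes q: "0 < q" "q < 1" and k: "1 \<le> k" "k \<le> s"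
  shows "(q + 1 / q) * pathw q s k = 2 + pathw q s (k - 1) + pathw q s (k + 1)"
proof -
  obtain j where j: "k = Suc j" using k by (cases k) auto
  obtain m where m: "s = k + m" using k le_Suc_ex by blast
  define D where "D = 1 + q ^ (s + 1)"
  define c where "c = 2 * q / (1 - q)\<^sup>2"
  define a where "a = q ^ j"
  define b where "b = q ^ m"
  have D: "D > 0" unfolding D_def using q by (simp add: add_pos_pos)
  have e: "pathw q s k = c * (1 - (q * a + q * b) / D)"
    "pathw q s (k - 1) = c * (1 - (a + q * q * b) / D)"
    "pathw q s (k + 1) = c * (1 - (q * q * a + b) / D)"
    using j m by (simp_all add: pathw_def c_def D_def a_def b_def)
  have c1: "c * (q + 1 / q - 2) = 2"
  proof -
    have "q + 1 / q - 2 = (1 - q)\<^sup>2 / q" using q by (simp add: field_simps power2_eq_square)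
    then show ?thesis using q by (simp add: c_def)
  qed
  have "(q + 1 / q) * (q * a + q * b) = (q * q + 1) * a + (q * q + 1) * b" using q by (simp add: field_simps)
  then have "(q + 1 / q) * ((q * a + q * b) / D) = (a + q * q * b) / D + (q * q * a + b) / D"
    by (simp add: add_divide_distrib[symmetric] algebra_simps)
  then have "(q + 1 / q) * (1 - (q * a + q * b) / D)
     = (1 - (a + q * q * b) / D) + (1 - (q * q * a + b) / D) + (q + 1 / q - 2)"
    by (simp add: algebra_simps)
  then have "c * ((q + 1 / q) * (1 - (q * a + q * b) / D))
     = c * ((1 - (a + q * q * b) / D) + (1 - (q * q * a + b) / D) + (q + 1 / q - 2))" by simp
  also have "\<dots> = c * (1 - (a + q * q * b) / D) + c * (1 - (q * q * a + b) / D) + c * (q + 1 / q - 2)"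
    by (simp only: distrib_left)
  finally show ?thesis unfolding e c1 by (simp add: mult.left_commute)
qed

text \<open>Positivity is (1 - q^k) (1 - q^(s+1-k)) > 0, multiplied out.\<close>

lemma pathw_pos:
  assumes q: "0 < q" "q < 1" and k: "1 \<le> k" "k \<le> s"
  shows "pathw q s k > 0"
proof -
  have "q ^ k < 1" "q ^ (s + 1 - k) < 1" using q k by (auto intro!: power_Suc_less_one simp: power_less_one_iff)
  then have "0 < (1 - q ^ k) * (1 - q ^ (s + 1 - k))" by simp
  also have "\<dots> = 1 + q ^ k * q ^ (s + 1 - k) - (q ^ k + q ^ (s + 1 - k))" by (simp add: algebra_simps)
  also have "q ^ k * q ^ (s + 1 - k) = q ^ (s + 1)" using k by (simp flip: power_add)
  finally have "q ^ k + q ^ (s + 1 - k) < 1 + q ^ (s + 1)" by simp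
  moreover have "0 < 1 + q ^ (s + 1)" using q by (simp add: add_pos_pos)
  ultimately have "(q ^ k + q ^ (s + 1 - k)) / (1 + q ^ (s + 1)) < 1" by simp
  then show ?thesis using q by (simp add: pathw_def)
qed

lemma pathw_sum:
  assumes q: "0 < q" "q < 1"
  shows "(\<Sum>i<s. pathw q s (Suc i)) = pathsum q s"
proof -
  define D where "D = 1 + q ^ (s + 1)"
  define c where "c = 2 * q / (1 - q)\<^sup>2"
  have g: "(\<Sum>i<s. q ^ Suc i) = q * (1 - q ^ s) / (1 - q)"
    using q by (simp add: sum_distrib_left[symmetric] sum_gp_strict)
  have "(\<Sum>i<s. q ^ (s - i)) = (\<Sum>i<s. q ^ Suc i)"
    using sum.nat_diff_reindex[of "\<lambda>i. q ^ Suc i" s] by (simp add: Suc_diff_Suc)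
  then have h: "(\<Sum>i<s. q ^ Suc i + q ^ (s - i)) = 2 * (q * (1 - q ^ s) / (1 - q))"
    unfolding sum.distrib g by simp
  have "(\<Sum>i<s. pathw q s (Suc i)) = (\<Sum>i<s. c * (1 - (q ^ Suc i + q ^ (s - i)) / D))"
    by (simp add: pathw_def c_def D_def)
  also have "\<dots> = c * (real s - (\<Sum>i<s. q ^ Suc i + q ^ (s - i)) / D)"
    by (simp only: sum_distrib_left[symmetric] sum_subtractf sum_divide_distrib[symmetric] sum_constant card_lessThan mult_1_right)
  also have "\<dots> = pathsum q s" unfolding h by (simp add: pathsum_def pathg_def c_def D_def)
  finally show ?thesis .
qed

lemma nbs_fan_apex:
  assumes fl: "fan_list u v ps"
  shows "nbs (parcs (fan u v ps)) (pverts (fan u v ps)) u = insert v (set (concat ps))"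
    and "nbs (parcs (fan u v ps)) (pverts (fan u v ps)) v = insert u (set (concat ps))"
proof -
  have d: "u \<noteq> v" "u \<notin> set (concat ps)" "v \<notin> set (concat ps)" using fl by (auto simp: fan_list_def)
  have f: "(u, b) \<notin> forest_arcs ps" "(v, b) \<notin> forest_arcs ps" for b
    using d forest_arcs_set[of u b ps] forest_arcs_set[of v b ps] by auto
  show "nbs (parcs (fan u v ps)) (pverts (fan u v ps)) u = insert v (set (concat ps))"
    unfolding nbs_def parcs_fan_iff pverts_fan using d f by (auto simp del: set_concat)
  show "nbs (parcs (fan u v ps)) (pverts (fan u v ps)) v = insert u (set (concat ps))"
    unfolding nbs_def parcs_fan_iff pverts_fan using d f by (auto simp del: set_concat)
qed

lemma nbs_fan_path:
  assumes fl: "fan_list u v ps" and p: "p \<in> set ps" "i < length p"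
  shows "nbs (parcs (fan u v ps)) (pverts (fan u v ps)) (p ! i)
    = {u, v} \<union> (if i = 0 then {} else {p ! (i - 1)}) \<union> (if Suc i < length p then {p ! Suc i} else {})"
    (is "?N = ?R")
proof -
  have pi: "p ! i \<in> set (concat ps)" unfolding set_concat using p nth_mem by blast
  then have d: "p ! i \<noteq> u" "p ! i \<noteq> v" using fl by (auto simp: fan_list_def)
  have dp: "distinct p" by (rule fan_list_distinct_path[OF fl p(1)])
  have "(p ! i, b) \<in> forest_arcs ps \<longleftrightarrow> (\<exists>j < length p. b = p ! j \<and> (j = Suc i \<or> i = Suc j))" for b
  proof
    assume "(p ! i, b) \<in> forest_arcs ps"
    then obtain r where r: "r \<in> set ps" "(p ! i, b) \<in> path_arcs r" by (auto simp: forest_arcs_def)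
    then have "r = p" using fan_list_disjoint[OF fl r(1) p(1), of "p ! i"] path_arcs_set p(2) by (metis nth_mem)
    then show "\<exists>j < length p. b = p ! j \<and> (j = Suc i \<or> i = Suc j)"
      using r(2) dp p(2) by (auto simp: path_arcs_def nth_eq_iff_index_eq)
  next
    assume "\<exists>j < length p. b = p ! j \<and> (j = Suc i \<or> i = Suc j)"
    then show "(p ! i, b) \<in> forest_arcs ps"
      using p unfolding forest_arcs_def path_arcs_def by auto
  qed
  then have "?N = {u, v} \<union> {b. \<exists>j < length p. b = p ! j \<and> (j = Suc i \<or> i = Suc j)}"
    unfolding nbs_def parcs_fan_iff pverts_fan using d pi p(1)
    by (auto simp del: set_concat intro: nth_mem) (auto intro: nth_mem)
  also have "\<dots> = ?R"
  proof (cases i)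
    case (Suc k)
    then have "k < length p" using p(2) by simp
    then have "{b. \<exists>j < length p. b = p ! j \<and> (j = Suc i \<or> i = Suc j)}
        = {p ! k} \<union> {p ! j | j. j < length p \<and> j = Suc i}" unfolding Suc by auto
    then show ?thesis using p(2) Suc by auto
  qed (use p(2) in auto)
  finally show ?thesis .
qed

text \<open>The double sum is a lookup: the vertices in \<open>ps\<close> being distinct, exactly
  one summand is selected for a path vertex.\<close>

definition fanw :: "real \<Rightarrow> 'a \<Rightarrow> 'a \<Rightarrow> 'a list list \<Rightarrow> 'a \<Rightarrow> real" where
  "fanw q u v ps w = (if w \<in> {u, v} then 1 else
     (\<Sum>p\<leftarrow>ps. \<Sum>i<length p. if p ! i = w then pathw q (length p) (Suc i) else 0))"

lemma fanw_path:
  assumes fl: "fan_list u v ps" and p: "p \<in> set ps" "i < length p"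
  shows "fanw q u v ps (p ! i) = pathw q (length p) (Suc i)"
proof -
  have "p ! i \<in> set (concat ps)" unfolding set_concat using p nth_mem by blast
  then have d: "p ! i \<notin> {u, v}" using fl by (auto simp: fan_list_def)
  have dp: "distinct p" by (rule fan_list_distinct_path[OF fl p(1)])
  let ?f = "\<lambda>r. \<Sum>k<length r. if r ! k = p ! i then pathw q (length r) (Suc k) else 0"
  have "fanw q u v ps (p ! i) = sum_list (map ?f ps)" using d by (simp add: fanw_def)
  also have "\<dots> = sum ?f (set ps)" using fan_list_distinct[OF fl] by (simp add: sum_list_distinct_conv_sum_set)
  also have "\<dots> = ?f p"
  proof (rule sum.remove[OF finite_set p(1), THEN trans])
    have "?f r = 0" if "r \<in> set ps - {p}" for r
      using that fan_list_disjoint[OF fl _ p(1), of r "p ! i"] p(2) by (auto intro!: sum.neutral) (metis nth_mem)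
    then show "?f p + sum ?f (set ps - {p}) = ?f p" by (simp add: sum.neutral)
  qed
  also have "\<dots> = (\<Sum>k<length p. if k = i then pathw q (length p) (Suc k) else 0)"
    using dp p(2) by (intro sum.cong) (auto simp: nth_eq_iff_index_eq)
  also have "\<dots> = pathw q (length p) (Suc i)" using p(2) by simp
  finally show ?thesis .
qed

lemma fanw_sum:
  assumes fl: "fan_list u v ps" and q: "0 < q" "q < 1"
  shows "(\<Sum>w\<in>set (concat ps). fanw q u v ps w) = (\<Sum>s\<leftarrow>map length ps. pathsum q s)"
proof -
  have d: "distinct (concat ps)" using fl by (simp add: fan_list_def)
  have "(\<Sum>w\<in>set (concat ps). fanw q u v ps w) = (\<Sum>w\<leftarrow>concat ps. fanw q u v ps w)"
    using d by (simp add: sum_list_distinct_conv_sum_set)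
  also have "\<dots> = (\<Sum>p\<leftarrow>ps. \<Sum>w\<leftarrow>p. fanw q u v ps w)"
  proof -
    have "(\<Sum>w\<leftarrow>concat qs. f w) = (\<Sum>p\<leftarrow>qs. \<Sum>w\<leftarrow>p. f w)" for f :: "'a \<Rightarrow> real" and qs
      by (induction qs) simp_all
    then show ?thesis .
  qed
  also have "\<dots> = (\<Sum>p\<leftarrow>ps. pathsum q (length p))"
  proof (intro arg_cong[of _ _ sum_list] map_cong refl)
    fix p assume p: "p \<in> set ps"
    have "(\<Sum>w\<leftarrow>p. fanw q u v ps w) = (\<Sum>i<length p. fanw q u v ps (p ! i))"
      by (simp add: sum_list_sum_nth atLeast0LessThan)
    also have "\<dots> = (\<Sum>i<length p. pathw q (length p) (Suc i))"
      using fanw_path[OF fl p] by (intro sum.cong) auto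
    finally show "(\<Sum>w\<leftarrow>p. fanw q u v ps w) = pathsum q (length p)" using pathw_sum[OF q] by simp
  qed
  finally show ?thesis by (simp add: comp_def)
qed

text \<open>Path vertices satisfy their equation for every \<open>q\<close> and all lengths; the
  apex equation alone depends on the partition, so it decides between eigenvector and
  supersolution.\<close>

lemma fanw_equations:
  assumes fl: "fan_list u v ps" and q: "0 < q" "q < 1"
  defines "N \<equiv> nbs (parcs (fan u v ps)) (pverts (fan u v ps))" and "y \<equiv> fanw q u v ps"
  shows "w \<in> pverts (fan u v ps) \<Longrightarrow> 0 < y w"
    and "w \<in> {u, v} \<Longrightarrow> (\<Sum>b\<in>N w. y b) = 1 + (\<Sum>s\<leftarrow>map length ps. pathsum q s)"
    and "w \<in> set (concat ps) \<Longrightarrow> (\<Sum>b\<in>N w. y b) = (q + 1 / q) * y w"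
proof -
  have d: "u \<noteq> v" "u \<notin> set (concat ps)" "v \<notin> set (concat ps)" using fl by (auto simp: fan_list_def)
  have yuv: "y u = 1" "y v = 1" by (simp_all add: y_def fanw_def)
  show "0 < y w" if w: "w \<in> pverts (fan u v ps)"
  proof (cases "w \<in> {u, v}")
    case True
    then show ?thesis using yuv by auto
  next
    case False
    then obtain p where p: "p \<in> set ps" "w \<in> set p" using w by (auto simp: pverts_fan)
    then obtain i where p: "p \<in> set ps" "i < length p" "w = p ! i" by (metis in_set_conv_nth)
    then show ?thesis using fanw_path[OF fl p(1,2)] pathw_pos[OF q] by (simp add: y_def)
  qed
  show "(\<Sum>b\<in>N w. y b) = 1 + (\<Sum>s\<leftarrow>map length ps. pathsum q s)" if w: "w \<in> {u, v}"
  proof -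
    obtain w' where w': "N w = insert w' (set (concat ps))" "w' \<in> {u, v}"
      using w nbs_fan_apex[OF fl] by (auto simp: N_def)
    then have "(\<Sum>b\<in>N w. y b) = y w' + (\<Sum>b\<in>set (concat ps). y b)"
      using d by (subst w'(1), subst sum.insert) auto
    then show ?thesis using fanw_sum[OF fl q] w'(2) yuv by (auto simp: y_def)
  qed
  show "(\<Sum>b\<in>N w. y b) = (q + 1 / q) * y w" if w: "w \<in> set (concat ps)"
  proof -
    obtain p where "p \<in> set ps" "w \<in> set p" using w by auto
    then obtain i where p: "p \<in> set ps" "i < length p" "w = p ! i" by (metis in_set_conv_nth)
    let ?s = "length p" and ?A = "if i = 0 then {} else {p ! (i - 1)}" and ?B = "if Suc i < length p then {p ! Suc i} else {}"
    have dp: "distinct p" by (rule fan_list_distinct_path[OF fl p(1)])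
    have pc: "p ! k \<notin> {u, v}" if "k < ?s" for k
      using d nth_mem[OF that] p(1) by auto
    have N: "N w = {u, v} \<union> (?A \<union> ?B)" unfolding N_def p(3) using nbs_fan_path[OF fl p(1,2)] by auto
    have "{u, v} \<inter> (?A \<union> ?B) = {}" using pc[of "i - 1"] pc[of "Suc i"] less_imp_diff_less[OF p(2)] by (auto split: if_splits)
    then have "(\<Sum>b\<in>N w. y b) = (\<Sum>b\<in>{u, v}. y b) + (\<Sum>b\<in>?A \<union> ?B. y b)"
      unfolding N by (intro sum.union_disjoint) auto
    also have "?A \<inter> ?B = {}" using dp p(2) by (auto simp: nth_eq_iff_index_eq split: if_splits)
    then have "(\<Sum>b\<in>?A \<union> ?B. y b) = (\<Sum>b\<in>?A. y b) + (\<Sum>b\<in>?B. y b)" by (intro sum.union_disjoint) auto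
    also have "(\<Sum>b\<in>{u, v}. y b) = 2" using d yuv by simp
    also have "(\<Sum>b\<in>?A. y b) = pathw q ?s i"
      using fanw_path[OF fl p(1), of "i - 1"] p(2) pathw_boundary(1)[OF q(1), of ?s] by (cases i) (auto simp: y_def)
    also have "(\<Sum>b\<in>?B. y b) = pathw q ?s (Suc (Suc i))"
    proof (cases "Suc i < ?s")
      case True
      then show ?thesis using fanw_path[OF fl p(1), of "Suc i"] by (simp add: y_def)
    next
      case False
      then have "Suc (Suc i) = ?s + 1" using p(2) by simp
      then show ?thesis using False pathw_boundary(2)[OF q(1), of ?s] by simp
    qed
    finally have "(\<Sum>b\<in>N w. y b) = 2 + pathw q ?s i + pathw q ?s (Suc (Suc i))" by simp
    also have "\<dots> = (q + 1 / q) * pathw q ?s (Suc i)" using pathw_rec[OF q, of "Suc i" ?s] p(2) by simp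
    finally show ?thesis using fanw_path[OF fl p(1,2)] p(3) by (simp add: y_def)
  qed
qed

text \<open>If the bound were attained, equality in \<open>qform_le\<close> along the edges at the
  dominating vertex \<open>u\<close> would make \<open>x\<close> a multiple of \<open>y\<close>,
  against strictness at \<open>u\<close>.\<close>

lemma graph_spectral_radius_less:
  assumes G: "finite (pverts G)" "sym (parcs G)" and u: "u \<in> pverts G"
    and dom: "\<And>w. w \<in> pverts G \<Longrightarrow> w \<noteq> u \<Longrightarrow> (u, w) \<in> parcs G"
    and y: "\<And>v. v \<in> pverts G \<Longrightarrow> y v > 0"
    and super: "\<And>v. v \<in> pverts G \<Longrightarrow> (\<Sum>w\<in>nbs (parcs G) (pverts G) v. y w) \<le> \<mu> * y v"
    and strict: "(\<Sum>w\<in>nbs (parcs G) (pverts G) u. y w) < \<mu> * y u"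
  shows "graph_spectral_radius G < \<mu>"
proof (rule ccontr)
  have ne: "pverts G \<noteq> {}" using u by auto
  assume "\<not> ?thesis"
  then have eq: "graph_spectral_radius G = \<mu>"
    using graph_spectral_radius_le[OF G(1) ne G(2) y super] by simp
  obtain x where x: "\<And>v. x v \<ge> 0" "\<exists>v\<in>pverts G. x v \<noteq> 0"
    "\<And>v. v \<in> pverts G \<Longrightarrow> graph_spectral_radius G * x v \<le> (\<Sum>w\<in>nbs (parcs G) (pverts G) v. x w)"
    using graph_spectral_radius_subsolution[OF G(1) ne] by blast
  let ?q = "qform (parcs G) (pverts G) x"
  have "\<mu> * (\<Sum>v\<in>pverts G. (x v)\<^sup>2) \<le> ?q" by (rule qform_ge) (use x eq in auto)
  moreover have "?q \<le> \<mu> * (\<Sum>v\<in>pverts G. (x v)\<^sup>2)" by (rule qform_le(1)[OF G y super])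
  ultimately have qe: "?q = \<mu> * (\<Sum>v\<in>pverts G. (x v)\<^sup>2)" by simp
  have prp: "x w * y u = x u * y w" if "w \<in> pverts G" for w
    using qform_le(2)[OF G y super qe dom[OF that] u that] by (cases "w = u") auto
  have xu: "x u > 0"
  proof (rule ccontr)
    assume "\<not> ?thesis"
    then have "x u = 0" using x(1)[of u] by simp
    then have "x w = 0" if "w \<in> pverts G" for w using prp[OF that] y[OF u] by auto
    then show False using x(2) by blast
  qed
  have "\<mu> * x u * y u \<le> (\<Sum>w\<in>nbs (parcs G) (pverts G) u. x w) * y u"
    using x(3)[OF u] eq y[OF u] by (intro mult_right_mono) auto
  also have "\<dots> = (\<Sum>w\<in>nbs (parcs G) (pverts G) u. x u * y w)"
    unfolding sum_distrib_right using prp by (intro sum.cong) (auto simp: nbs_def)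
  also have "\<dots> = x u * (\<Sum>w\<in>nbs (parcs G) (pverts G) u. y w)" by (simp add: sum_distrib_left)
  also have "\<dots> < x u * (\<mu> * y u)" using strict xu by simp
  finally show False by (simp add: algebra_simps)
qed

lemma fan_spectral_radius:
  assumes fl: "fan_list u v ps" and q: "0 < q" "q < 1"
  shows "1 + (\<Sum>s\<leftarrow>map length ps. pathsum q s) = q + 1 / q \<Longrightarrow> graph_spectral_radius (fan u v ps) = q + 1 / q"
    and "1 + (\<Sum>s\<leftarrow>map length ps. pathsum q s) < q + 1 / q \<Longrightarrow> graph_spectral_radius (fan u v ps) < q + 1 / q"
proof -
  let ?G = "fan u v ps"
  interpret pair_graph ?G by (rule pair_graph_fan[OF fl])
  have G: "finite (pverts ?G)" "sym (parcs ?G)" "u \<in> pverts ?G" "pverts ?G \<noteq> {}"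
    using arcs_symmetric by (auto intro: symI simp: pverts_fan)
  note eqs = fanw_equations[OF fl q]
  have yuv: "fanw q u v ps w = 1" if "w \<in> {u, v}" for w using that by (simp add: fanw_def)
  have split: "w \<in> {u, v} \<or> w \<in> set (concat ps)" if "w \<in> pverts ?G" for w
    using that by (simp add: pverts_fan del: set_concat)
  have rho: "0 \<le> q + 1 / q" using q by simp
  show "graph_spectral_radius ?G = q + 1 / q" if a: "1 + (\<Sum>s\<leftarrow>map length ps. pathsum q s) = q + 1 / q"
  proof (rule graph_spectral_radius_eqI[OF G(1,4,2) eqs(1) rho])
    fix w assume "w \<in> pverts ?G"
    from split[OF this] show "(\<Sum>b\<in>nbs (parcs ?G) (pverts ?G) w. fanw q u v ps b) = (q + 1 / q) * fanw q u v ps w"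
      using eqs(2)[of w] eqs(3)[of w] a yuv[of w] by (elim disjE) (simp_all del: set_concat)
  qed
  show "graph_spectral_radius ?G < q + 1 / q" if a: "1 + (\<Sum>s\<leftarrow>map length ps. pathsum q s) < q + 1 / q"
  proof (rule graph_spectral_radius_less[OF G(1,2,3) _ eqs(1)])
    show "(u, w) \<in> parcs ?G" if "w \<in> pverts ?G" "w \<noteq> u" for w
      using that by (auto simp: parcs_fan_iff pverts_fan simp del: set_concat)
    show "(\<Sum>b\<in>nbs (parcs ?G) (pverts ?G) u. fanw q u v ps b) < (q + 1 / q) * fanw q u v ps u"
      using eqs(2)[of u] a yuv[of u] by simp
    fix w assume "w \<in> pverts ?G"
    from split[OF this] show "(\<Sum>b\<in>nbs (parcs ?G) (pverts ?G) w. fanw q u v ps b) \<le> (q + 1 / q) * fanw q u v ps w"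
      using eqs(2)[of w] eqs(3)[of w] a yuv[of w] by (elim disjE) (simp_all del: set_concat)
  qed
qed

lemma pathsum_bounds:
  assumes q: "0 < q" "q < 1"
  shows "pathsum q s \<le> 2 * q / (1 - q)\<^sup>2 * real s" "2 / (q + 1 / q) * real s \<le> pathsum q s"
proof -
  have c: "0 \<le> 2 * q / (1 - q)\<^sup>2" "0 \<le> 2 * q / (1 - q)" using q by auto
  have "0 \<le> pathg q s" unfolding pathg_def using q by (intro divide_nonneg_pos) (auto simp: power_le_one add_pos_pos)
  then have "0 \<le> 2 * q / (1 - q) * pathg q s" using c by (intro mult_nonneg_nonneg)
  then have "real s - 2 * q / (1 - q) * pathg q s \<le> real s" by linarith
  then show "pathsum q s \<le> 2 * q / (1 - q)\<^sup>2 * real s" unfolding pathsum_def using c(1) by (rule mult_left_mono)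
  have rho: "0 < q + 1 / q" using q by (simp add: add_pos_pos)
  have nn: "0 \<le> pathw q s k" if "k \<le> s + 1" for k
    using pathw_pos[OF q, of k s] pathw_boundary[OF q(1), of s] that
    by (cases "k = 0"; cases "k = s + 1") auto
  have "2 / (q + 1 / q) \<le> pathw q s (Suc i)" if "i < s" for i
  proof -
    have "2 \<le> (q + 1 / q) * pathw q s (Suc i)"
      using pathw_rec[OF q, of "Suc i" s] nn[of i] nn[of "Suc (Suc i)"] that by simp
    then show ?thesis using rho by (simp add: pos_divide_le_eq mult.commute)
  qed
  then have "(\<Sum>i<s. 2 / (q + 1 / q)) \<le> (\<Sum>i<s. pathw q s (Suc i))" by (intro sum_mono) auto
  then show "2 / (q + 1 / q) * real s \<le> pathsum q s" using pathw_sum[OF q] by (simp add: mult.commute)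
qed

lemma sum_list_pathsum_bounds:
  assumes q: "0 < q" "q < 1"
  shows "(\<Sum>s\<leftarrow>ns. pathsum q s) \<le> 2 * q / (1 - q)\<^sup>2 * real (sum_list ns)"
    and "2 / (q + 1 / q) * real (sum_list ns) \<le> (\<Sum>s\<leftarrow>ns. pathsum q s)"
  by (induction ns) (use pathsum_bounds[OF q] in \<open>auto simp: distrib_left intro: add_mono\<close>)

text \<open>Intermediate values between q = 1/(N+10), where 1/q outweighs path sums of at most 3,
  and q = 1/3, where q + 1/q = 10/3 is below 1 + 0.6 N.\<close>

lemma exists_fan_parameter:
  assumes n: "sum_list ns \<ge> 6"
  shows "\<exists>q. 0 < q \<and> q < 1 \<and> 1 + (\<Sum>s\<leftarrow>ns. pathsum q s) = q + 1 / q"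
proof -
  define N where "N = real (sum_list ns)"
  have N: "N \<ge> 6" using n by (simp add: N_def)
  define h where "h q = 1 + (\<Sum>s\<leftarrow>ns. pathsum q s) - (q + 1 / q)" for q
  define q0 where "q0 = 1 / (N + 10)"
  have q0: "0 < q0" "q0 \<le> 1/16" using N by (auto simp: q0_def field_simps)
  have "h q0 \<le> 0"
  proof -
    have "(15/16)\<^sup>2 \<le> (1 - q0)\<^sup>2" using q0 by (intro power_mono) auto
    then have "2/3 \<le> (1 - q0)\<^sup>2" by (simp add: power2_eq_square)
    then have "2 * q0 / (1 - q0)\<^sup>2 \<le> 2 * q0 / (2/3)" using q0 by (intro divide_left_mono) auto
    then have "2 * q0 / (1 - q0)\<^sup>2 * N \<le> 3 * q0 * N" using N by (intro mult_right_mono) auto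
    also have "3 * q0 * N \<le> 3" using N by (simp add: q0_def field_simps)
    finally have "(\<Sum>s\<leftarrow>ns. pathsum q0 s) \<le> 3"
      using sum_list_pathsum_bounds(1)[of q0 ns] q0 by (simp add: N_def)
    moreover have "1 / q0 = N + 10" by (simp add: q0_def)
    ultimately show ?thesis using N q0 by (simp add: h_def)
  qed
  moreover have "0 \<le> h (1/3)"
    using sum_list_pathsum_bounds(2)[of "1/3" ns] N by (simp add: h_def N_def[symmetric])
  moreover have "continuous_on {q0..1/3} h"
  proof -
    have "continuous_on {q0..1/3} (\<lambda>q. pathsum q s)" for s
      unfolding pathsum_def pathg_def
      using q0 by (intro continuous_intros) (auto simp: add_nonneg_eq_0_iff)
    then have "continuous_on {q0..1/3} (\<lambda>q. \<Sum>s\<leftarrow>ns. pathsum q s)"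
      by (induction ns) (auto intro!: continuous_intros)
    then show ?thesis unfolding h_def using q0 by (intro continuous_intros) auto
  qed
  ultimately obtain q where "q0 \<le> q" "q \<le> 1/3" "h q = 0"
    using IVT'[of h q0 0 "1/3"] q0 by auto
  then show ?thesis using q0 by (intro exI[of _ q]) (auto simp: h_def)
qed

text \<open>The increments of \<open>pathg q\<close> are proportional to \<open>q\<^sup>k / ((1 + q\<^sup>k) (1 + q\<^sup>k\<^sup>+\<^sup>1))\<close>, which decreases in \<open>k\<close>.\<close>

lemma pathg_transfer:
  assumes q: "0 < q" "q < 1" and ab: "1 \<le> b" "b \<le> a"
  shows "pathg q (Suc a) + pathg q (b - 1) < pathg q a + pathg q b"
proof -
  define \<phi> where "\<phi> k = q ^ k * (1 - q) / ((1 + q ^ k) * (1 + q ^ Suc k))" for k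
  have pos: "0 < 1 + q ^ k" for k using q by (simp add: add_pos_pos)
  have diff: "pathg q (Suc s) - pathg q s = (1 + q) / q * \<phi> (Suc s)" for s
  proof -
    define t where "t = q ^ s"
    have p: "0 < 1 + q * t" "0 < 1 + q * (q * t)" using pos[of "Suc s"] pos[of "Suc (Suc s)"] by (simp_all add: t_def)
    have "pathg q (Suc s) - pathg q s = (1 - q * t) / (1 + q * (q * t)) - (1 - t) / (1 + q * t)"
      by (simp add: pathg_def t_def)
    also have "\<dots> = ((1 - q * t) * (1 + q * t) - (1 - t) * (1 + q * (q * t))) / ((1 + q * t) * (1 + q * (q * t)))"
      using p by (simp add: diff_frac_eq mult.commute)
    also have "(1 - q * t) * (1 + q * t) - (1 - t) * (1 + q * (q * t)) = (1 + q) * (t * (1 - q))"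
      by (simp add: algebra_simps)
    finally have "pathg q (Suc s) - pathg q s = (1 + q) * (t * (1 - q)) / ((1 + q * t) * (1 + q * (q * t)))" .
    moreover have "(1 + q) / q * \<phi> (Suc s) = (1 + q) * (t * (1 - q)) / ((1 + q * t) * (1 + q * (q * t)))"
      using q by (simp add: \<phi>_def t_def)
    ultimately show ?thesis by simp
  qed
  \<comment> \<open>Cleared of denominators, the claim is q (1 + t) < 1 + q^2 t with
    \<open>t = q ^ k\<close>, that is, (1 - q) (1 - q t) > 0.\<close>
  have dec: "\<phi> (Suc k) < \<phi> k" if "k \<ge> 1" for k
  proof -
    define t where "t = q ^ k"
    have t: "0 < t" "t < 1" using q that by (auto simp: t_def power_less_one_iff)
    have p: "0 < 1 + t" "0 < 1 + q * t" "0 < 1 + q * (q * t)" using q t by (simp_all add: add_pos_pos)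
    have "q * t < 1" using q t by (metis mult_less_cancel_left_pos mult.right_neutral less_trans)
    then have "0 < (1 - q) * (1 - q * t)" using q by simp
    then have "q * (1 + t) < 1 + q * (q * t)" by (simp add: algebra_simps)
    then have "q * (1 + t) * (t * (1 - q)) < (1 + q * (q * t)) * (t * (1 - q))"
      using t q by (intro mult_strict_right_mono) auto
    then have "q * (1 + t) * (t * (1 - q)) / ((1 + t) * ((1 + q * t) * (1 + q * (q * t))))
        < (1 + q * (q * t)) * (t * (1 - q)) / ((1 + t) * ((1 + q * t) * (1 + q * (q * t))))"
      using p by (intro divide_strict_right_mono mult_pos_pos) auto
    moreover have "q * (1 + t) * (t * (1 - q)) / ((1 + t) * ((1 + q * t) * (1 + q * (q * t))))
        = q * t * (1 - q) / ((1 + q * t) * (1 + q * (q * t)))"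
    proof -
      have "q * (1 + t) * (t * (1 - q)) = (1 + t) * (q * t * (1 - q))" by (simp only: mult_ac)
      then show ?thesis using p(1) by (simp only: mult_divide_mult_cancel_left)
    qed
    moreover have "(1 + q * (q * t)) * (t * (1 - q)) / ((1 + t) * ((1 + q * t) * (1 + q * (q * t))))
        = t * (1 - q) / ((1 + t) * (1 + q * t))"
    proof -
      have "(1 + t) * ((1 + q * t) * (1 + q * (q * t))) = (1 + q * (q * t)) * ((1 + t) * (1 + q * t))"
        by (simp only: mult_ac)
      then show ?thesis using p(3) by (simp only: mult_divide_mult_cancel_left)
    qed
    ultimately have "q * t * (1 - q) / ((1 + q * t) * (1 + q * (q * t))) < t * (1 - q) / ((1 + t) * (1 + q * t))"
      by simp
    then show ?thesis by (simp add: \<phi>_def t_def)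
  qed
  have mono: "\<phi> (Suc (b + j)) < \<phi> b" for j
  proof (induction j)
    case 0
    then show ?case using dec[OF ab(1)] by simp
  next
    case (Suc j)
    then show ?case using dec[of "Suc (b + j)"] by simp
  qed
  have "\<phi> (Suc a) < \<phi> b" using mono[of "a - b"] ab by simp
  then have "(1 + q) / q * \<phi> (Suc a) < (1 + q) / q * \<phi> b" using q by (intro mult_strict_left_mono) auto
  moreover have "Suc (b - 1) = b" using ab by simp
  ultimately show ?thesis using diff[of a] diff[of "b - 1"] by simp
qed

section \<open>Linear forests\<close>

lemma gpath_nth: "gpath E p \<Longrightarrow> Suc i < length p \<Longrightarrow> (p ! i, p ! Suc i) \<in> E"
  by (simp add: gpath_def successively_conv_nth)

lemma path_arcs_subset_gpath:
  assumes "gpath E p" "sym E" shows "path_arcs p \<subseteq> E"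
proof
  fix e assume "e \<in> path_arcs p"
  then obtain i j where e: "e = (p ! i, p ! j)" "i < length p" "j < length p" "j = Suc i \<or> i = Suc j"
    by (auto simp: path_arcs_def)
  then show "e \<in> E" using gpath_nth[OF assms(1)] assms(2) by (auto dest: symD)
qed

lemma chord_gives_cycle:
  assumes p: "gpath E p" and ij: "i < j" "j < length p" "(p ! j, p ! i) \<in> E"
  obtains c where "cycle_list E c" "set c \<subseteq> set p" "length c = Suc (j - i)"
proof -
  let ?c = "take (Suc (j - i)) (drop i p)"
  have split: "p = take i p @ ?c @ drop (Suc (j - i)) (drop i p)" by (metis append_take_drop_id)
  have len: "length ?c = Suc (j - i)" using ij by simp
  then have ne: "?c \<noteq> []" by auto
  have "gpath E (?c @ drop (Suc (j - i)) (drop i p))"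
    using p split ne gpath_append[of E "take i p" "?c @ drop (Suc (j - i)) (drop i p)"] by (metis append_is_Nil_conv)
  then have g: "gpath E ?c" using ne gpath_append[of E ?c "drop (Suc (j - i)) (drop i p)"] by auto
  have "hd ?c = p ! i" using ij ne by (simp add: hd_drop_conv_nth)
  moreover have "last ?c = p ! j" using ij ne len by (simp add: last_conv_nth)
  ultimately have "cycle_list E ?c" using g ij(3) by (simp add: cycle_list_def)
  moreover have "set ?c \<subseteq> set p" by (meson in_set_dropD in_set_takeD subsetI)
  ultimately show thesis using that len by blast
qed

text \<open>A longest path in \<open>W\<close> is a component and can be split off: a chord would
  close a cycle, its ends cannot be continued, and its inner vertices already have their two
  neighbours on it.\<close>

lemma linear_forest_decomposition:
  assumes "finite W" "sym E" "irrefl E"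
    and "\<And>a. a \<in> W \<Longrightarrow> card {b \<in> W. (a, b) \<in> E} \<le> 2"
    and "\<And>c. cycle_list E c \<Longrightarrow> length c \<ge> 3 \<Longrightarrow> \<not> set c \<subseteq> W"
  shows "\<exists>ps. distinct (concat ps) \<and> [] \<notin> set ps \<and> set (concat ps) = W \<and>
    (\<forall>a\<in>W. \<forall>b\<in>W. (a, b) \<in> E \<longleftrightarrow> (a, b) \<in> forest_arcs ps)"
  using assms
proof (induction "card W" arbitrary: W rule: less_induct)
  case less
  note fin = less.prems(1) and sE = less.prems(2) and iE = less.prems(3) and deg = less.prems(4) and acyc = less.prems(5)
  have E: "(a, b) \<in> E \<longleftrightarrow> (b, a) \<in> E" for a b using sE by (meson symD)
  show ?case
  proof (cases "W = {}")
    case True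
    then show ?thesis by (intro exI[of _ "[]"]) auto
  next
    case False
    then obtain w where w: "w \<in> W" by blast
    let ?P = "\<lambda>p. gpath E p \<and> set p \<subseteq> W"
    have bound: "length p < Suc (card W)" if "?P p" for p
      using that fin card_mono[of W "set p"] distinct_card[of p] by (simp add: gpath_def)
    have "?P [w]" using w by simp
    then obtain p where p: "gpath E p" "set p \<subseteq> W" and pmax: "\<And>q. ?P q \<Longrightarrow> length q \<le> length p"
      using ex_has_greatest_nat[of ?P "[w]" length "Suc (card W)"] bound by blast
    have pne: "p \<noteq> []" and dp: "distinct p" using p by (auto simp: gpath_def)
    have chord: "y = Suc x" if xy: "x < y" "y < length p" "(p ! y, p ! x) \<in> E" for x y
    proof (rule ccontr)
      assume "y \<noteq> Suc x"
      obtain c where c: "cycle_list E c" "set c \<subseteq> set p" "length c = Suc (y - x)"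
        by (rule chord_gives_cycle[OF p(1) xy])
      have "3 \<le> length c" using c(3) xy(1) \<open>y \<noteq> Suc x\<close> by simp
      then show False using acyc[OF c(1)] c(2) p(2) by blast
    qed
    have key: "(a, b) \<in> path_arcs p" if ab: "a \<in> set p" "b \<in> W" "(a, b) \<in> E" for a b
    proof -
      obtain i where i: "i < length p" "a = p ! i" using ab by (auto simp: in_set_conv_nth)
      show ?thesis
      proof (cases "b \<in> set p")
        case True
        then obtain j where j: "j < length p" "b = p ! j" by (auto simp: in_set_conv_nth)
        have "i \<noteq> j" using ab(3) iE i j by (auto simp: irrefl_def)
        have "j = Suc i \<or> i = Suc j"
        proof (rule ccontr)
          assume no: "\<not> ?thesis"
          consider "i < j" | "j < i" using \<open>i \<noteq> j\<close> by linarith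
          then show False
          proof cases
            case 1
            have "(p ! j, p ! i) \<in> E" using ab(3) i j E[of a b] by simp
            then show False using chord[OF 1 j(1)] no by blast
          next
            case 2
            have "(p ! i, p ! j) \<in> E" using ab(3) i j by simp
            then show False using chord[OF 2 i(1)] no by blast
          qed
        qed
        then show ?thesis using i j unfolding path_arcs_def by auto
      next
        case False
        have b1: "gpath E (b # p) \<longleftrightarrow> (b, hd p) \<in> E" using False p(1) pne gpath_append[of E "[b]" p] by auto
        have b2: "gpath E (p @ [b]) \<longleftrightarrow> (last p, b) \<in> E" using False p(1) pne gpath_append[of E p "[b]"] by auto
        have "i \<noteq> 0"
        proof
          assume "i = 0"
          then have "a = hd p" using i pne by (simp add: hd_conv_nth)
          then show False using b1 pmax[of "b # p"] p(2) ab E[of a b] by auto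
        qed
        moreover have "Suc i \<noteq> length p"
        proof
          assume "Suc i = length p"
          then have "a = last p" using i pne by (simp add: last_conv_nth flip: \<open>Suc i = length p\<close>)
          then show False using b2 pmax[of "p @ [b]"] p(2) ab by auto
        qed
        ultimately obtain k where k: "i = Suc k" "Suc i < length p" using i(1) by (cases i) auto
        have e: "(a, p ! k) \<in> E" "(a, p ! Suc i) \<in> E"
          using gpath_nth[OF p(1), of k] gpath_nth[OF p(1), of i] k i E by auto
        have m: "p ! k \<in> set p" "p ! Suc i \<in> set p" using k by auto
        have "p ! k \<noteq> p ! Suc i" using dp k by (simp add: nth_eq_iff_index_eq)
        moreover have "p ! k \<noteq> b" "p ! Suc i \<noteq> b" using m False by metis+
        ultimately have "card {p ! k, p ! Suc i, b} = 3" by simp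
        moreover have "{p ! k, p ! Suc i, b} \<subseteq> {b \<in> W. (a, b) \<in> E}" using m p(2) ab e by auto
        moreover have "finite {b \<in> W. (a, b) \<in> E}" using fin by simp
        ultimately have "3 \<le> card {b \<in> W. (a, b) \<in> E}" by (metis card_mono)
        then show ?thesis using deg[of a] ab(1) p(2) by auto
      qed
    qed
    let ?W = "W - set p"
    have "hd p \<in> set p" using pne by simp
    then have lt: "card ?W < card W" using fin p(2) by (intro psubset_card_mono) blast+
    have "\<exists>ps. distinct (concat ps) \<and> [] \<notin> set ps \<and> set (concat ps) = ?W \<and>
      (\<forall>a\<in>?W. \<forall>b\<in>?W. (a, b) \<in> E \<longleftrightarrow> (a, b) \<in> forest_arcs ps)"
    proof (rule less.hyps[OF lt _ sE iE])
      show "finite ?W" using fin by simp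
      show "card {b \<in> ?W. (a, b) \<in> E} \<le> 2" if "a \<in> ?W" for a
      proof -
        have "card {b \<in> ?W. (a, b) \<in> E} \<le> card {b \<in> W. (a, b) \<in> E}"
          using fin by (intro card_mono) auto
        then show ?thesis using deg[of a] that by simp
      qed
      show "\<not> set c \<subseteq> ?W" if "cycle_list E c" "length c \<ge> 3" for c
        using acyc[OF that] by blast
    qed
    then obtain ps where ps: "distinct (concat ps)" "[] \<notin> set ps" "set (concat ps) = ?W"
      "\<And>a b. a \<in> ?W \<Longrightarrow> b \<in> ?W \<Longrightarrow> (a, b) \<in> E \<longleftrightarrow> (a, b) \<in> forest_arcs ps"
      by metis
    have fa: "forest_arcs (p # ps) = path_arcs p \<union> forest_arcs ps" by (simp add: forest_arcs_def)
    have "(a, b) \<in> E \<longleftrightarrow> (a, b) \<in> forest_arcs (p # ps)" if ab: "a \<in> W" "b \<in> W" for a b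
    proof
      assume e: "(a, b) \<in> E"
      consider "a \<in> set p" | "b \<in> set p" | "a \<in> ?W" "b \<in> ?W" using ab by blast
      then show "(a, b) \<in> forest_arcs (p # ps)"
      proof cases
        case 1
        then show ?thesis using key[OF 1 ab(2) e] fa by blast
      next
        case 2
        then show ?thesis using key[OF 2 ab(1)] e E fa path_arcs_sym[of b a p] by blast
      next
        case 3
        then show ?thesis using ps(4) e fa by blast
      qed
    next
      assume "(a, b) \<in> forest_arcs (p # ps)"
      then consider "(a, b) \<in> path_arcs p" | "(a, b) \<in> forest_arcs ps" using fa by blast
      then show "(a, b) \<in> E"
      proof cases
        case 1
        then show ?thesis using path_arcs_subset_gpath[OF p(1) sE] by blast
      next
        case 2
        then show ?thesis using ps(3,4) forest_arcs_set[of a b ps] by blast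
      qed
    qed
    moreover have "distinct (concat (p # ps))" "[] \<notin> set (p # ps)" "set (concat (p # ps)) = W"
      using ps dp pne p(2) by auto
    ultimately show ?thesis by blast
  qed
qed

section \<open>The optimal partition into path lengths\<close>

text \<open>The path lengths of a fan without two disjoint cycles of length l: together with the
  apexes, one path on 2 l - 2 vertices or two paths on l - 1 vertices would yield such a
  pair.\<close>

definition admissible :: "nat \<Rightarrow> nat multiset \<Rightarrow> bool" where
  "admissible l M \<longleftrightarrow> (\<forall>s\<in>#M. 1 \<le> s \<and> s \<le> 2 * l - 3) \<and> size {#s \<in># M. l - 1 \<le> s#} \<le> 1"

lemma admissible_add_mset:
  assumes X: "\<And>s. s \<in># X \<Longrightarrow> 1 \<le> s \<and> s < l - 1" and c: "1 \<le> c" "c \<le> 2 * l - 3"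
  shows "admissible l (add_mset c X)"
proof -
  have "{#s \<in># X. l - 1 \<le> s#} = {#}"
  proof (rule ccontr)
    assume "\<not> ?thesis"
    then obtain s where "s \<in># {#s \<in># X. l - 1 \<le> s#}" by (rule multiset_nonemptyE)
    then show False using X[of s] by auto
  qed
  moreover have "size {#s \<in># add_mset c X. l - 1 \<le> s#} \<le> Suc (size {#s \<in># X. l - 1 \<le> s#})" by simp
  ultimately have "size {#s \<in># add_mset c X. l - 1 \<le> s#} \<le> 1" by (metis One_nat_def size_empty)
  moreover have "s \<le> 2 * l - 3" if "s \<in># X" for s using X[OF that] by linarith
  ultimately show ?thesis using X c by (auto simp: admissible_def)
qed

text \<open>Bounds the sum of squares, which every transfer increases, and so makes repeated
  transfers stop.\<close>

lemma sum_squares_le: "(\<Sum>s\<in>#M. s * s) \<le> sum_mset M * sum_mset (M :: nat multiset)"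
  by (induction M) (auto simp: algebra_simps)

text \<open>One vertex moves from a path of order \<open>b\<close> to one of order \<open>a\<close>.
  A path reduced to nothing is dropped, to keep zeros out of the multiset, and the sum of
  \<open>g\<close> stays correct since \<open>g 0 = 0\<close>.\<close>

lemma transfer_step:
  fixes g :: "nat \<Rightarrow> real"
  assumes g0: "g 0 = 0" and tr: "\<And>a b. 1 \<le> b \<Longrightarrow> b \<le> a \<Longrightarrow> g (Suc a) + g (b - 1) < g a + g b"
    and M: "M = add_mset a (add_mset b R)" and ab: "1 \<le> b" "b \<le> a"
  defines "M' \<equiv> add_mset (Suc a) (if b = 1 then R else add_mset (b - 1) R)"
  shows "sum_mset M' = sum_mset M" "(\<Sum>s\<in>#M'. g s) < (\<Sum>s\<in>#M. g s)" "(\<Sum>s\<in>#M. s * s) < (\<Sum>s\<in>#M'. s * s)"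
proof -
  obtain c where c: "b = Suc c" using ab by (cases b) auto
  show "sum_mset M' = sum_mset M" using c by (simp add: M'_def M)
  show "(\<Sum>s\<in>#M'. g s) < (\<Sum>s\<in>#M. g s)" using tr[OF ab] g0 c by (auto simp: M'_def M)
  have "c < a" using ab c by simp
  then show "(\<Sum>s\<in>#M. s * s) < (\<Sum>s\<in>#M'. s * s)" using c by (auto simp: M'_def M algebra_simps)
qed

text \<open>A longest path below 2 l - 3 may take a vertex from any other. Once it is full, two
  paths shorter than l - 2 can exchange a vertex, the longer growing to at most l - 2. If neither
  applies, at most one of the remaining lengths differs from l - 2, and this is the target.\<close>

lemma improvement:
  fixes g :: "nat \<Rightarrow> real"
  assumes l: "l \<ge> 3" and n: "n \<ge> 4 * l" and g0: "g 0 = 0"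
    and tr: "\<And>a b. 1 \<le> b \<Longrightarrow> b \<le> a \<Longrightarrow> g (Suc a) + g (b - 1) < g a + g b"
    and M: "admissible l M" "sum_mset M = n - 2" and ne: "M \<noteq> mset (target_lengths n (2 * l - 3) (l - 2))"
  shows "\<exists>M'. admissible l M' \<and> sum_mset M' = n - 2 \<and> (\<Sum>s\<in>#M'. g s) < (\<Sum>s\<in>#M. g s) \<and>
    (\<Sum>s\<in>#M. s * s) < (\<Sum>s\<in>#M'. s * s)"
proof -
  have "M \<noteq> {#}" using M(2) n l by auto
  define a where "a = Max (set_mset M)"
  have aM: "a \<in># M" using \<open>M \<noteq> {#}\<close> by (simp add: a_def)
  have amax: "s \<le> a" if "s \<in># M" for s using that by (simp add: a_def)
  define R0 where "R0 = M - {#a#}"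
  have MR: "M = add_mset a R0" using aM by (simp add: R0_def)
  have adm: "1 \<le> s" "s \<le> 2 * l - 3" if "s \<in># M" for s using M(1) that by (auto simp: admissible_def)
  have one: "size {#s \<in># R0. l - 1 \<le> s#} + (if l - 1 \<le> a then 1 else 0) \<le> 1"
    using M(1) by (auto simp: admissible_def MR split: if_splits)
  have small: "s < l - 1" if s: "s \<in># R0" for s
  proof (rule ccontr)
    assume "\<not> s < l - 1"
    then have "s \<in># {#s \<in># R0. l - 1 \<le> s#}" "l - 1 \<le> a" using s amax[of s] by (auto simp: MR)
    then have "{#s \<in># R0. l - 1 \<le> s#} \<noteq> {#}" by auto
    then have "size {#s \<in># R0. l - 1 \<le> s#} \<ge> 1" by (metis One_nat_def Suc_leI nonempty_has_size)
    moreover have "size {#s \<in># R0. l - 1 \<le> s#} + 1 \<le> 1" using one \<open>l - 1 \<le> a\<close> by (simp only: if_True)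
    ultimately show False by linarith
  qed
  have R0ne: "R0 \<noteq> {#}"
  proof
    assume "R0 = {#}"
    then have "n - 2 = a" using M(2) MR by simp
    then show False using adm(2)[OF aM] n l by linarith
  qed
  have finish: ?thesis if s: "M = add_mset c (add_mset b R)" "1 \<le> b" "b \<le> c"
    and adm': "admissible l (add_mset (Suc c) (if b = 1 then R else add_mset (b - 1) R))" for b c R
    using transfer_step[OF g0 tr s] adm' M(2)
    by (intro exI[of _ "add_mset (Suc c) (if b = 1 then R else add_mset (b - 1) R)"]) simp
  show ?thesis
  proof (cases "a < 2 * l - 3")
    case True
    obtain b R where R: "R0 = add_mset b R" using R0ne by (cases R0) auto
    have b: "b \<in># M" "b < l - 1" "1 \<le> b" "b \<le> a" using small[of b] adm(1)[of b] amax[of b] MR R by auto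
    show ?thesis
    proof (rule finish[OF _ b(3,4)])
      show "M = add_mset a (add_mset b R)" using MR R by simp
      show "admissible l (add_mset (Suc a) (if b = 1 then R else add_mset (b - 1) R))"
      proof (rule admissible_add_mset)
        fix s assume "s \<in># (if b = 1 then R else add_mset (b - 1) R)"
        then have "s \<in># R \<or> (s = b - 1 \<and> b \<noteq> 1)" by (auto split: if_splits)
        then show "1 \<le> s \<and> s < l - 1" using small[of s] adm(1)[of s] b MR R by auto
      qed (use True in auto)
    qed
  next
    case False
    then have a: "a = 2 * l - 3" using adm(2)[OF aM] by simp
    define S where "S = {#s \<in># R0. s < l - 2#}"
    have RS: "R0 = {#s \<in># R0. \<not> s < l - 2#} + S" by (simp add: S_def)
    have big: "{#s \<in># R0. \<not> s < l - 2#} = replicate_mset (size {#s \<in># R0. \<not> s < l - 2#}) (l - 2)"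
    proof -
      have "s = l - 2" if "s \<in># {#s \<in># R0. \<not> s < l - 2#}" for s using that small[of s] by auto
      then show ?thesis by (metis set_mset_subset_singletonD singletonI subsetI)
    qed
    define k where "k = size {#s \<in># R0. \<not> s < l - 2#}"
    have RS': "R0 = replicate_mset k (l - 2) + S" using RS big by (simp add: k_def)
    consider "S = {#}" | b where "S = {#b#}" | b c R where "S = add_mset b (add_mset c R)"
      by (cases S) (auto, metis multiset_cases)
    then show ?thesis
    proof cases
      case (3 b c R)
      define x y where "x = max b c" and "y = min b c"
      have S': "S = add_mset x (add_mset y R)" using 3 by (auto simp: x_def y_def max_def min_def)
      have xy: "x \<in># S" "y \<in># S" using S' by auto
      then have lt: "x < l - 2" "y < l - 2" "x \<in># R0" "y \<in># R0" by (auto simp: S_def)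
      have y: "1 \<le> y" "y \<le> x" using adm(1)[of y] lt MR by (auto simp: x_def y_def)
      let ?R = "add_mset a (replicate_mset k (l - 2) + R)"
      show ?thesis
      proof (rule finish[OF _ y])
        show "M = add_mset x (add_mset y ?R)" using MR RS' S' by simp
        let ?R' = "replicate_mset k (l - 2) + R"
        have "add_mset (Suc x) (if y = 1 then ?R else add_mset (y - 1) ?R)
          = add_mset a (add_mset (Suc x) (if y = 1 then ?R' else add_mset (y - 1) ?R'))"
          by (simp add: add_mset_commute)
        also have "admissible l \<dots>"
        proof (rule admissible_add_mset)
          fix s assume "s \<in># add_mset (Suc x) (if y = 1 then ?R' else add_mset (y - 1) ?R')"
          then have "s \<in># ?R' \<or> s = Suc x \<or> (s = y - 1 \<and> y \<noteq> 1)" by (auto split: if_splits)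
          moreover have "?R' \<subseteq># R0" by (simp add: RS' S')
          ultimately show "1 \<le> s \<and> s < l - 1"
            using small[of s] adm(1)[of s] lt y MR mset_subset_eqD[of ?R' R0 s] by auto
        qed (use a l in auto)
        finally show "admissible l (add_mset (Suc x) (if y = 1 then ?R else add_mset (y - 1) ?R))" .
      qed
    next
      have fin: False if R0: "R0 = replicate_mset \<alpha> (l - 2) + {#\<beta>#}" and \<beta>: "1 \<le> \<beta>" "\<beta> \<le> l - 2" for \<alpha> \<beta>
      proof -
        have "n - 2 = (2 * l - 3) + \<alpha> * (l - 2) + \<beta>" using M(2) MR R0 a by simp
        then have "\<alpha> = H_alpha n (2 * l - 3) (l - 2) \<and> \<beta> = H_beta n (2 * l - 3) (l - 2)"
        proof -
          have "1 \<le> 2 * l - 3" "1 \<le> l - 2" "2 * l - 3 + 2 * (l - 2) + 2 \<le> n" using l n by linarith+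
          from H_alpha_beta_iff[OF this, of \<beta> \<alpha>] \<open>n - 2 = _\<close> \<beta> show ?thesis by simp
        qed
        then have "M = mset (target_lengths n (2 * l - 3) (l - 2))"
          using MR R0 a by (simp add: target_lengths_def)
        with ne show False by simp
      qed
      {
        case 1
        \<comment> \<open>No shorter path is left, so one of those of length l - 2 is taken as the
          last path, with \<beta> = l - 2.\<close>
        then have "k \<noteq> 0" using RS' R0ne by auto
        then obtain j where "k = Suc j" by (cases k) auto
        moreover have "1 \<le> l - 2" using l by linarith
        ultimately show ?thesis using fin[of j "l - 2"] RS' 1 by simp
      next
        case (2 b)
        then have "b \<in># S" by simp
        then have "b \<in># R0" "b < l - 2" by (auto simp: S_def)
        then show ?thesis using fin[of k b] RS' 2 adm(1)[of b] MR by simp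
      }
    qed
  qed
qed

lemma optimal_partition:
  fixes g :: "nat \<Rightarrow> real"
  assumes l: "l \<ge> 3" and n: "n \<ge> 4 * l" and g0: "g 0 = 0"
    and tr: "\<And>a b. 1 \<le> b \<Longrightarrow> b \<le> a \<Longrightarrow> g (Suc a) + g (b - 1) < g a + g b"
    and M: "admissible l M" "sum_mset M = n - 2" and ne: "M \<noteq> mset (target_lengths n (2 * l - 3) (l - 2))"
  shows "(\<Sum>s\<in>#mset (target_lengths n (2 * l - 3) (l - 2)). g s) < (\<Sum>s\<in>#M. g s)"
  using M ne
proof (induction "(n - 2) * (n - 2) - (\<Sum>s\<in>#M. s * s)" arbitrary: M rule: less_induct)
  case less
  obtain M' where M': "admissible l M'" "sum_mset M' = n - 2" "(\<Sum>s\<in>#M'. g s) < (\<Sum>s\<in>#M. g s)"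
    "(\<Sum>s\<in>#M. s * s) < (\<Sum>s\<in>#M'. s * s)"
    using improvement[OF l n g0 tr less.prems] by blast
  show ?case
  proof (cases "M' = mset (target_lengths n (2 * l - 3) (l - 2))")
    case True
    then show ?thesis using M'(3) by simp
  next
    case False
    have "(\<Sum>s\<in>#M'. s * s) \<le> (n - 2) * (n - 2)" using sum_squares_le[of M'] M'(2) by simp
    then have "(n - 2) * (n - 2) - (\<Sum>s\<in>#M'. s * s) < (n - 2) * (n - 2) - (\<Sum>s\<in>#M. s * s)"
      using M'(4) by linarith
    then have "(\<Sum>s\<in>#mset (target_lengths n (2 * l - 3) (l - 2)). g s) < (\<Sum>s\<in>#M'. g s)"
      using less.hyps M'(1,2) False by blast
    then show ?thesis using M'(3) by simp
  qed
qed

section \<open>Comparison with the extremal fan\<close>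

lemma target_lengths_props:
  assumes "l \<ge> 3" "n \<ge> 4 * l"
  shows "admissible l (mset (target_lengths n (2 * l - 3) (l - 2)))"
    and "sum_list (target_lengths n (2 * l - 3) (l - 2)) = n - 2"
proof -
  define \<alpha> \<beta> where "\<alpha> = H_alpha n (2 * l - 3) (l - 2)" and "\<beta> = H_beta n (2 * l - 3) (l - 2)"
  have "1 \<le> 2 * l - 3" "1 \<le> l - 2" "2 * l - 3 + 2 * (l - 2) + 2 \<le> n" using assms by linarith+
  from H_alpha_beta_iff[OF this, of \<beta> \<alpha>]
  have ab: "1 \<le> \<beta>" "\<beta> \<le> l - 2" "n - 2 = 2 * l - 3 + \<alpha> * (l - 2) + \<beta>" by (simp_all add: \<alpha>_def \<beta>_def)
  have T: "target_lengths n (2 * l - 3) (l - 2) = (2 * l - 3) # replicate \<alpha> (l - 2) @ [\<beta>]"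
    by (simp add: target_lengths_def \<alpha>_def \<beta>_def)
  show "sum_list (target_lengths n (2 * l - 3) (l - 2)) = n - 2"
    unfolding T using ab(3) by (simp add: sum_list_replicate)
  have "admissible l (add_mset (2 * l - 3) (mset (replicate \<alpha> (l - 2) @ [\<beta>])))"
    by (rule admissible_add_mset) (use ab assms in \<open>auto split: if_splits\<close>)
  then show "admissible l (mset (target_lengths n (2 * l - 3) (l - 2)))" unfolding T by simp
qed

lemma admissible_iff_paths:
  assumes fl: "fan_list u v ps" and l: "l \<ge> 3"
  shows "admissible l (mset (map length ps)) \<longleftrightarrow>
    (\<forall>p\<in>set ps. length p \<le> 2 * l - 3) \<and>
    (\<forall>p\<in>set ps. \<forall>q\<in>set ps. p \<noteq> q \<longrightarrow> length p < l - 1 \<or> length q < l - 1)"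
proof -
  let ?F = "filter (\<lambda>p. l - 1 \<le> length p) ps"
  have sz: "size {#s \<in># mset (map length ps). l - 1 \<le> s#} = length ?F"
    by (induction ps) auto
  have d: "distinct ?F" using fan_list_distinct[OF fl] by simp
  have pos: "1 \<le> length p" if "p \<in> set ps" for p
    using fl that by (cases p) (auto simp: fan_list_def)
  have "length ?F \<le> 1 \<longleftrightarrow> (\<forall>p\<in>set ?F. \<forall>q\<in>set ?F. p = q)"
    using d card_le_Suc0_iff_eq[of "set ?F"] distinct_card[OF d] by simp
  also have "\<dots> \<longleftrightarrow> (\<forall>p\<in>set ps. \<forall>q\<in>set ps. p \<noteq> q \<longrightarrow> length p < l - 1 \<or> length q < l - 1)"
    unfolding set_filter not_le[symmetric] by blast
  finally have "length ?F \<le> 1 \<longleftrightarrow> \<dots>" .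
  moreover have "(\<forall>s\<in>#mset (map length ps). 1 \<le> s \<and> s \<le> 2 * l - 3) \<longleftrightarrow> (\<forall>p\<in>set ps. length p \<le> 2 * l - 3)"
    using pos by auto
  ultimately show ?thesis unfolding admissible_def sz by (simp only:)
qed

text \<open>The linear part depends on the number of vertices only, so that between partitions of n
  - 2 a smaller sum of \<open>pathg\<close> means a larger sum of \<open>pathsum\<close>.\<close>

lemma sum_pathsum:
  "(\<Sum>s\<in>#M. pathsum q s) = 2 * q / (1 - q)\<^sup>2 * (real (sum_mset M) - 2 * q / (1 - q) * (\<Sum>s\<in>#M. pathg q s))"
proof -
  have "(\<Sum>s\<in>#M. C * (real s - D * g s)) = C * (real (sum_mset M) - D * (\<Sum>s\<in>#M. g s))"
    for C D :: real and g :: "nat \<Rightarrow> real"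
    by (induction M) (simp_all add: algebra_simps)
  then show ?thesis by (simp only: pathsum_def)
qed

lemma pathsum_less:
  assumes q: "0 < q" "q < 1" and l: "l \<ge> 3" and n: "n \<ge> 4 * l"
    and M: "admissible l (mset ns)" "sum_list ns = n - 2"
    and ne: "mset ns \<noteq> mset (target_lengths n (2 * l - 3) (l - 2))"
  shows "(\<Sum>s\<leftarrow>ns. pathsum q s) < (\<Sum>s\<leftarrow>target_lengths n (2 * l - 3) (l - 2). pathsum q s)"
proof -
  let ?T = "target_lengths n (2 * l - 3) (l - 2)"
  have s: "sum_mset (mset ns) = n - 2" "sum_mset (mset ?T) = n - 2"
    using M(2) target_lengths_props(2)[OF l n] by (simp_all add: sum_mset_sum_list)
  have "(\<Sum>s\<in>#mset ?T. pathg q s) < (\<Sum>s\<in>#mset ns. pathg q s)"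
    by (rule optimal_partition[OF l n _ pathg_transfer[OF q] M(1) s(1) ne]) (simp add: pathg_def)
  then have "2 * q / (1 - q) * (\<Sum>s\<in>#mset ?T. pathg q s) < 2 * q / (1 - q) * (\<Sum>s\<in>#mset ns. pathg q s)"
    using q by (intro mult_strict_left_mono) auto
  then have "(\<Sum>s\<in>#mset ns. pathsum q s) < (\<Sum>s\<in>#mset ?T. pathsum q s)"
    unfolding sum_pathsum s using q by (intro mult_strict_left_mono) auto
  then show ?thesis by (simp add: sum_mset_sum_list flip: mset_map)
qed

section \<open>Change of the quadratic form under an exchange of edges\<close>

lemma qform_insert:
  assumes "finite S" "r \<notin> S" "sym E" "irrefl E"
  shows "qform E (insert r S) x = qform E S x + 2 * (x r * (\<Sum>w\<in>nbs E S r. x w))"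
proof -
  have Er: "(a, b) \<in> E \<longleftrightarrow> (b, a) \<in> E" for a b using assms(3) by (meson symD)
  have rr: "(r, r) \<notin> E" using assms(4) by (auto simp: irrefl_def)
  let ?e = "\<lambda>a b. if (a, b) \<in> E then x a * x b else 0"
  have q: "qform E T x = (\<Sum>a\<in>T. \<Sum>b\<in>T. ?e a b)" if "finite T" for T
    unfolding qform_def using that by (simp add: sum_nbs)
  have "qform E (insert r S) x = (\<Sum>b\<in>S. ?e r b) + (\<Sum>a\<in>S. ?e a r + (\<Sum>b\<in>S. ?e a b))"
    using assms rr by (simp add: q)
  also have "\<dots> = (\<Sum>b\<in>S. ?e r b) + (\<Sum>a\<in>S. ?e a r) + qform E S x"
    by (simp only: sum.distrib q[OF assms(1)] add.assoc)
  also have "(\<Sum>a\<in>S. ?e a r) = (\<Sum>b\<in>S. ?e r b)"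
    by (rule sum.cong[OF refl]) (simp add: Er[of r] mult.commute)
  also have "(\<Sum>b\<in>S. ?e r b) = x r * (\<Sum>w\<in>nbs E S r. x w)"
    by (simp add: sum_nbs[OF assms(1)] sum_distrib_left if_distrib cong: if_cong)
  finally show ?thesis by simp
qed

text \<open>Vertices of degree at most 16 are removed one at a time, each taking at most 2 * 16 M
  times its own weight. Counting arcs would only give 16 M^2 times the number of vertices, which
  cannot be set against a gain proportional to the total weight.\<close>

lemma qform_degenerate:
  assumes fin: "finite S" and E: "sym E" "irrefl E"
    and sparse: "\<And>T. T \<subseteq> S \<Longrightarrow> card (E \<inter> T \<times> T) \<le> 16 * card T"
    and x: "\<And>v. v \<in> S \<Longrightarrow> 0 \<le> x v" "\<And>v. v \<in> S \<Longrightarrow> x v \<le> M"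
  shows "qform E S x \<le> 32 * M * (\<Sum>v\<in>S. x v)"
  using fin sparse x
proof (induction "card S" arbitrary: S)
  case 0
  then show ?case by (simp add: qform_def)
next
  case (Suc k)
  have "\<exists>r\<in>S. card (nbs E S r) \<le> 16"
  proof (rule ccontr)
    assume "\<not> ?thesis"
    then have "17 \<le> card (nbs E S r)" if "r \<in> S" for r using that by force
    then have "(\<Sum>r\<in>S. 17) \<le> (\<Sum>r\<in>S. card (nbs E S r))" by (intro sum_mono)
    also have "\<dots> = card (E \<inter> S \<times> S)" unfolding card_arcs_sum[OF Suc.prems(1)] nbs_def ..
    also have "\<dots> \<le> 16 * card S" by (rule Suc.prems(2)) simp
    finally show False using Suc.hyps(2) by simp
  qed
  then obtain r where r: "r \<in> S" "card (nbs E S r) \<le> 16" by blast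
  let ?S = "S - {r}"
  have S: "S = insert r ?S" using r by auto
  have M: "0 \<le> M" using Suc.prems(3,4)[OF r(1)] by linarith
  have "qform E ?S x \<le> 32 * M * (\<Sum>v\<in>?S. x v)"
  proof (rule Suc.hyps(1))
    show "k = card ?S" using Suc.hyps(2) Suc.prems(1) r(1) by simp
    show "card (E \<inter> T \<times> T) \<le> 16 * card T" if "T \<subseteq> ?S" for T
      by (rule Suc.prems(2)) (use that in blast)
  qed (use Suc.prems in auto)
  moreover have "(\<Sum>w\<in>nbs E ?S r. x w) \<le> 16 * M"
  proof -
    have "(\<Sum>w\<in>nbs E ?S r. x w) \<le> (\<Sum>w\<in>nbs E ?S r. M)"
      using Suc.prems(4) by (intro sum_mono) (auto simp: nbs_def)
    also have "\<dots> = real (card (nbs E ?S r)) * M" by simp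
    also have "card (nbs E ?S r) \<le> card (nbs E S r)"
      using Suc.prems(1) by (intro card_mono) (auto simp: nbs_def)
    then have "real (card (nbs E ?S r)) * M \<le> 16 * M" using r(2) M by (intro mult_right_mono) auto
    finally show ?thesis .
  qed
  then have "x r * (\<Sum>w\<in>nbs E ?S r. x w) \<le> x r * (16 * M)" using Suc.prems(3)[OF r(1)] by (rule mult_left_mono)
  moreover have "qform E S x = qform E ?S x + 2 * (x r * (\<Sum>w\<in>nbs E ?S r. x w))"
    using qform_insert[of ?S r E x] Suc.prems(1) E S by simp
  moreover have "(\<Sum>v\<in>S. x v) = x r + (\<Sum>v\<in>?S. x v)" using Suc.prems(1) r by (simp add: sum.remove)
  ultimately show ?case by (simp add: algebra_simps)
qed

text \<open>The quadratic form over a bare set of ordered pairs, so that arc sets can be split,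
  compared and reversed; an edge of a symmetric set counts twice.\<close>

definition arc_weight :: "('a \<Rightarrow> real) \<Rightarrow> ('a \<times> 'a) set \<Rightarrow> real" where
  "arc_weight x F = (\<Sum>(a, b)\<in>F. x a * x b)"

lemma qform_arc_weight: "finite V \<Longrightarrow> qform E V x = arc_weight x (E \<inter> V \<times> V)"
proof -
  assume V: "finite V"
  have "E \<inter> V \<times> V = Sigma V (nbs E V)" by (auto simp: nbs_def)
  then show ?thesis using V by (simp add: qform_def arc_weight_def sum.Sigma)
qed

lemma arc_weight_converse: "arc_weight x (F\<inverse>) = arc_weight x F"
proof -
  have "F\<inverse> = prod.swap ` F" by auto
  then have "arc_weight x (F\<inverse>) = (\<Sum>p\<in>F. (\<lambda>(a, b). x a * x b) (prod.swap p))"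
    unfolding arc_weight_def by (simp add: sum.reindex)
  also have "\<dots> = arc_weight x F" unfolding arc_weight_def by (rule sum.cong) (auto simp: mult.commute)
  finally show ?thesis .
qed

lemma arc_weight_mono:
  assumes "finite F'" "F \<subseteq> F'" "\<And>a b. (a, b) \<in> F' \<Longrightarrow> 0 \<le> x a \<and> 0 \<le> x b"
  shows "arc_weight x F \<le> arc_weight x F'"
  unfolding arc_weight_def using assms by (intro sum_mono2) auto

lemma arc_weight_Un: "finite F \<Longrightarrow> finite F' \<Longrightarrow> F \<inter> F' = {} \<Longrightarrow> arc_weight x (F \<union> F') = arc_weight x F + arc_weight x F'"
  unfolding arc_weight_def by (rule sum.union_disjoint)

text \<open>\<open>E'\<close> arises from \<open>E\<close> by joining every vertex of \<open>R\<close> to exactly \<open>u\<close> and \<open>v\<close>: each \<open>r\<close> gains at least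
  \<open>x r * x v\<close> and loses at most \<open>18 * M * x r\<close>, as \<open>E\<close> restricted to \<open>R\<close> is 16-degenerate.\<close>

lemma arc_weight_exchange:
  fixes x :: "'a \<Rightarrow> real"
  assumes fin: "finite V" and E: "E \<subseteq> V \<times> V" "sym E" "irrefl E" and E': "E' \<subseteq> V \<times> V"
    and V: "V = {u, v} \<union> A \<union> R" "u \<noteq> v" "{u, v} \<inter> (A \<union> R) = {}" "A \<inter> R = {}"
    and miss: "\<And>r. r \<in> R \<Longrightarrow> (u, r) \<notin> E \<or> (v, r) \<notin> E"
    and few: "\<And>r. r \<in> R \<Longrightarrow> card (nbs E A r) \<le> 2"
    and sparse: "\<And>T. T \<subseteq> V \<Longrightarrow> card (E \<inter> T \<times> T) \<le> 16 * card T"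
    and inc: "{(u, v), (v, u)} \<union> {u, v} \<times> R \<union> R \<times> {u, v} \<subseteq> E'"
    and lost: "E - E' \<subseteq> R \<times> A \<union> A \<times> R \<union> R \<times> R"
    and x: "\<And>w. w \<in> V \<Longrightarrow> 0 \<le> x w" "\<And>w. w \<in> A \<union> R \<Longrightarrow> x w \<le> M" "x v \<le> x u"
  shows "qform E V x + 2 * (x v - 18 * M) * (\<Sum>r\<in>R. x r) + (if (u, v) \<in> E then 0 else 2 * (x u * x v)) \<le> qform E' V x"
proof -
  have Es: "(a, b) \<in> E \<longleftrightarrow> (b, a) \<in> E" for a b using E(2) by (meson symD)
  have fR: "finite R" "finite A" using fin V(1) by auto
  have RV: "R \<subseteq> V" "A \<subseteq> V" "u \<in> V" "v \<in> V" using V(1) by auto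
  have fE: "finite E" "finite E'" using E(1) E' fin by (meson finite_SigmaI finite_subset)+
  have nn: "0 \<le> x a \<and> 0 \<le> x b" if "(a, b) \<in> E \<union> E'" for a b using that E(1) E' x(1) by auto
  define B where "B = E \<inter> R \<times> A"
  define C where "C = E \<inter> R \<times> R"
  have fBC: "finite B" "finite C" "finite (B\<inverse>)" using fE by (auto simp: B_def C_def)
  have "arc_weight x (E - E') \<le> arc_weight x (B \<union> B\<inverse> \<union> C)"
  proof (rule arc_weight_mono)
    show "finite (B \<union> B\<inverse> \<union> C)" using fBC by simp
    show "E - E' \<subseteq> B \<union> B\<inverse> \<union> C" using lost Es unfolding B_def C_def by blast
    show "0 \<le> x a \<and> 0 \<le> x b" if "(a, b) \<in> B \<union> B\<inverse> \<union> C" for a b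
      using that nn Es unfolding B_def C_def by blast
  qed
  also have "\<dots> = 2 * arc_weight x B + arc_weight x C"
  proof -
    have "B \<inter> B\<inverse> = {}" "(B \<union> B\<inverse>) \<inter> C = {}" using V(4) unfolding B_def C_def by auto
    then show ?thesis using fBC by (simp add: arc_weight_Un arc_weight_converse)
  qed
  also have "arc_weight x B \<le> (\<Sum>r\<in>R. x r * (2 * M))"
  proof -
    have "B = Sigma R (nbs E A)" by (auto simp: B_def nbs_def)
    then have "arc_weight x B = (\<Sum>r\<in>R. \<Sum>a\<in>nbs E A r. x r * x a)"
      using fR by (simp add: arc_weight_def sum.Sigma)
    also have "\<dots> \<le> (\<Sum>r\<in>R. x r * (2 * M))"
    proof (rule sum_mono)
      fix r assume r: "r \<in> R"
      have M: "0 \<le> M" using x(1,2)[of r] r RV by force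
      have "(\<Sum>a\<in>nbs E A r. x a) \<le> (\<Sum>a\<in>nbs E A r. M)" using x(2) by (intro sum_mono) (auto simp: nbs_def)
      also have "\<dots> = real (card (nbs E A r)) * M" by simp
      also have "\<dots> \<le> 2 * M" using few[OF r] M by (intro mult_right_mono) auto
      finally have "x r * (\<Sum>a\<in>nbs E A r. x a) \<le> x r * (2 * M)" using x(1)[of r] r RV by (intro mult_left_mono) auto
      then show "(\<Sum>a\<in>nbs E A r. x r * x a) \<le> x r * (2 * M)" by (simp add: sum_distrib_left)
    qed
    finally show ?thesis .
  qed
  also have "arc_weight x C \<le> 32 * M * (\<Sum>r\<in>R. x r)"
  proof -
    have "qform E R x \<le> 32 * M * (\<Sum>r\<in>R. x r)"
      by (rule qform_degenerate[OF fR(1) E(2,3)]) (use sparse RV x in auto)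
    then show ?thesis using qform_arc_weight[OF fR(1), of E x] by (simp add: C_def)
  qed
  finally have "arc_weight x (E - E') \<le> 2 * (\<Sum>r\<in>R. x r * (2 * M)) + 32 * M * (\<Sum>r\<in>R. x r)" by simp
  \<comment> \<open>4 M from the arcs between \<open>R\<close> and \<open>A\<close> in both
    directions and 32 M from those within \<open>R\<close>: twice the 18 of the gain
    condition.\<close>
  then have lo: "arc_weight x (E - E') \<le> 36 * M * (\<Sum>r\<in>R. x r)"
    unfolding sum_distrib_right[symmetric] by (simp add: algebra_simps)
  \<comment> \<open>An apex that \<open>r\<close> is not yet joined to, with \<open>u\<close> as the
    choice when both are missing; either weighs at least \<open>x v\<close>.\<close>
  define ms where "ms r = (if (u, r) \<in> E then v else u)" for r
  define D where "D = (\<lambda>r. (r, ms r)) ` R"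
  define D0 where "D0 = (if (u, v) \<in> E then {} else {(u, v), (v, u)})"
  have fD: "finite D" "finite (D\<inverse>)" "finite D0" using fR by (auto simp: D_def D0_def)
  have msr: "(r, ms r) \<notin> E" "ms r \<in> {u, v}" "x v \<le> x (ms r)" if "r \<in> R" for r
    using miss[OF that] Es x(3) by (auto simp: ms_def)
  have "2 * (x v * (\<Sum>r\<in>R. x r)) + (if (u, v) \<in> E then 0 else 2 * (x u * x v)) \<le> arc_weight x (D \<union> D\<inverse> \<union> D0)"
  proof -
    have "x v * (\<Sum>r\<in>R. x r) = (\<Sum>r\<in>R. x r * x v)" by (simp add: sum_distrib_left mult.commute)
    also have "\<dots> \<le> (\<Sum>r\<in>R. x r * x (ms r))" using msr(3) x(1) RV by (intro sum_mono mult_left_mono) auto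
    also have "\<dots> = arc_weight x D" unfolding arc_weight_def D_def by (subst sum.reindex) (auto simp: inj_on_def)
    finally have 1: "x v * (\<Sum>r\<in>R. x r) \<le> arc_weight x D" .
    have "D \<subseteq> R \<times> {u, v}" "D0 \<subseteq> {u, v} \<times> {u, v}" using msr(2) by (auto simp: D_def D0_def)
    then have "D \<inter> D\<inverse> = {}" "(D \<union> D\<inverse>) \<inter> D0 = {}" using V(3) by auto
    then have "arc_weight x (D \<union> D\<inverse> \<union> D0) = 2 * arc_weight x D + arc_weight x D0"
      using fD by (simp add: arc_weight_Un arc_weight_converse)
    moreover have "arc_weight x D0 = (if (u, v) \<in> E then 0 else 2 * (x u * x v))"
      using V(2) by (simp add: arc_weight_def D0_def mult.commute)
    ultimately show ?thesis using 1 by simp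
  qed
  also have "\<dots> \<le> arc_weight x (E' - E)"
  proof (rule arc_weight_mono)
    show "finite (E' - E)" using fE by simp
    show "D \<union> D\<inverse> \<union> D0 \<subseteq> E' - E"
    proof -
      have "(r, ms r) \<in> E' - E \<and> (ms r, r) \<in> E' - E" if "r \<in> R" for r
        using msr[OF that] that inc Es by blast
      then have "D \<union> D\<inverse> \<subseteq> E' - E" unfolding D_def by auto
      moreover have "D0 \<subseteq> E' - E" using inc Es unfolding D0_def by auto
      ultimately show ?thesis by blast
    qed
  qed (use nn in auto)
  finally have hi: "2 * (x v * (\<Sum>r\<in>R. x r)) + (if (u, v) \<in> E then 0 else 2 * (x u * x v)) \<le> arc_weight x (E' - E)" .
  have "qform E V x = arc_weight x ((E \<inter> E') \<union> (E - E'))"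
    using qform_arc_weight[OF fin, of E x] E(1) by (simp add: Int_absorb2 Int_Diff_Un)
  also have "\<dots> = arc_weight x (E \<inter> E') + arc_weight x (E - E')"
    using fE by (intro arc_weight_Un) auto
  finally have 1: "qform E V x = arc_weight x (E \<inter> E') + arc_weight x (E - E')" .
  have "qform E' V x = arc_weight x ((E' \<inter> E) \<union> (E' - E))"
    using qform_arc_weight[OF fin, of E' x] E' by (simp add: Int_absorb2 Int_Diff_Un)
  also have "\<dots> = arc_weight x (E' \<inter> E) + arc_weight x (E' - E)"
    using fE by (intro arc_weight_Un) auto
  finally have 2: "qform E' V x = arc_weight x (E \<inter> E') + arc_weight x (E' - E)" by (simp add: Int_commute)
  have "2 * (x v - 18 * M) * (\<Sum>r\<in>R. x r) = 2 * (x v * (\<Sum>r\<in>R. x r)) - 36 * M * (\<Sum>r\<in>R. x r)"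
    by (simp add: algebra_simps)
  then show ?thesis using 1 2 lo hi by linarith
qed

section \<open>Two disjoint cycles from long paths under the apexes\<close>

lemma gpath_take: "gpath E p \<Longrightarrow> 0 < k \<Longrightarrow> gpath E (take k p)"
  using gpath_append[of E "take k p" "drop k p"] by (cases "p = []") (auto simp: gpath_def)

lemma gpath_drop: "gpath E p \<Longrightarrow> k < length p \<Longrightarrow> gpath E (drop k p)"
  using gpath_append[of E "take k p" "drop k p"] by (auto simp: gpath_def)

lemma path_arcs_gpath:
  assumes "p \<noteq> []" "distinct p" "path_arcs p \<subseteq> E" shows "gpath E p"
proof -
  have "(p ! i, p ! Suc i) \<in> E" if "Suc i < length p" for i
  proof -
    have "(p ! i, p ! Suc i) \<in> path_arcs p"
      unfolding path_arcs_iff using that by (intro exI[of _ i] exI[of _ "Suc i"]) auto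
    then show ?thesis using assms(3) by blast
  qed
  then show ?thesis using assms by (simp add: gpath_def successively_conv_nth)
qed

text \<open>Each apex closes l - 1 consecutive vertices to a cycle; together with
  \<open>two_cycles_from_long_path\<close> this complements
  \<open>fan_no_two_cycles\<close>.\<close>

lemma two_cycles_from_paths:
  assumes p: "gpath E p" "l - 1 \<le> length p" and q: "gpath E q" "l - 1 \<le> length q" and l: "l \<ge> 2"
    and dis: "set p \<inter> set q = {}" "u \<noteq> v" "{u, v} \<inter> (set p \<union> set q) = {}"
    and adj: "\<And>w. w \<in> set p \<union> set q \<Longrightarrow> (u, w) \<in> E \<and> (w, u) \<in> E \<and> (v, w) \<in> E \<and> (w, v) \<in> E"
  shows "two_cycles E l"
proof -
  let ?r = "take (l - 1) p" and ?s = "take (l - 1) q"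
  have sub: "set ?r \<subseteq> set p" "set ?s \<subseteq> set q" by (simp_all add: set_take_subset)
  have "cycle_list E (u # ?r)"
    by (rule apex_cycle[OF gpath_take[OF p(1)]]) (use l dis sub adj in auto)
  moreover have "cycle_list E (v # ?s)"
    by (rule apex_cycle[OF gpath_take[OF q(1)]]) (use l dis sub adj in auto)
  moreover have "length (u # ?r) = l" "length (v # ?s) = l" using p q l by auto
  moreover have "set (u # ?r) \<inter> set (v # ?s) = {}" using dis sub by auto
  ultimately show ?thesis unfolding two_cycles_def by blast
qed

lemma two_cycles_from_long_path:
  assumes p: "gpath E p" "2 * l - 2 \<le> length p" and l: "l \<ge> 2"
    and dis: "u \<noteq> v" "{u, v} \<inter> set p = {}"
    and adj: "\<And>w. w \<in> set p \<Longrightarrow> (u, w) \<in> E \<and> (w, u) \<in> E \<and> (v, w) \<in> E \<and> (w, v) \<in> E"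
  shows "two_cycles E l"
proof -
  have d: "distinct p" using p by (simp add: gpath_def)
  have "set (take (l - 1) p) \<inter> set (drop (l - 1) p) = {}"
    using d by (metis append_take_drop_id distinct_append)
  moreover have "set (take (l - 1) p) \<subseteq> set p" "set (drop (l - 1) p) \<subseteq> set p"
    by (simp_all add: set_take_subset set_drop_subset)
  ultimately show ?thesis
    using gpath_take[OF p(1), of "l - 1"] gpath_drop[OF p(1), of "l - 1"] p(2) l dis adj
    by (intro two_cycles_from_paths[where p = "take (l - 1) p" and q = "drop (l - 1) p" and u = u and v = v]) (auto; blast)+
qed

context drawing
begin

text \<open>With \<mu> = q + 1/q, \<rho> the spectral radius and x the normalised subsolution,
  \<rho> |x|^2 \<le> \<open>qform\<close> of \<open>G\<close> \<le> \<open>qform\<close> of the fan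
  \<le> \<mu> |x|^2 \<le> \<rho> |x|^2. So all are equalities: proportionality makes x positive,
  then a vanishing gain at \<open>R\<close> leaves \<open>R\<close> empty, and a vanishing gain at
  the apexes makes them adjacent.\<close>

lemma spectral_extremal:
  assumes l: "l \<ge> 3" and n: "card V = n" "real n \<ge> 2.16 * 10 ^ 17" "n \<ge> 4 * l"
    and free: "\<not> two_cycles E l"
    and q: "0 < q" "q < 1"
    and qT: "1 + (\<Sum>s\<leftarrow>target_lengths n (2 * l - 3) (l - 2). pathsum q s) = q + 1 / q"
    and ge: "q + 1 / q \<le> graph_spectral_radius G"
  shows "graph_spectral_radius G = q + 1 / q"
    and "\<exists>u v ps. fan_list u v ps \<and> G = fan u v ps \<and> mset (map length ps) = mset (target_lengths n (2 * l - 3) (l - 2))"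
proof -
  let ?T = "target_lengths n (2 * l - 3) (l - 2)"
  define \<mu> where "\<mu> = q + 1 / q"
  let ?\<rho> = "graph_spectral_radius G"
  have Es: "(a, b) \<in> E \<longleftrightarrow> (b, a) \<in> E" for a b using symE by (meson symD)
  have EV: "E \<subseteq> V \<times> V" using edge_verts by auto
  have Vne: "V \<noteq> {}" using n l by auto
  have \<mu>: "0 < \<mu>" using q by (simp add: \<mu>_def add_pos_pos)
  \<comment> \<open>Each path vertex of the target has weight at least 2 / \<mu> on average along
    its path, and there are n - 2 of them, while their total is \<mu> - 1.\<close>
  have mu2: "2 * real n - 4 \<le> \<mu>\<^sup>2"
  proof -
    have "2 / \<mu> * real (n - 2) \<le> \<mu>"
      using sum_list_pathsum_bounds(2)[OF q, of ?T] qT target_lengths_props(2)[OF l n(3)] by (simp add: \<mu>_def)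
    then have "2 * real (n - 2) \<le> \<mu> * \<mu>" using \<mu> by (simp add: field_simps)
    then show ?thesis using n l by (simp add: power2_eq_square of_nat_diff)
  qed
  obtain x0 where x0: "\<And>w. x0 w \<ge> 0" "\<exists>w\<in>V. x0 w \<noteq> 0" "\<And>w. w \<in> V \<Longrightarrow> ?\<rho> * x0 w \<le> (\<Sum>b\<in>nbs E V w. x0 b)"
    using graph_spectral_radius_subsolution[OF finiteV Vne] by blast
  have "Max (x0 ` V) \<in> x0 ` V" using finiteV Vne by (intro Max_in) auto
  then obtain u where "u \<in> V" "Max (x0 ` V) = x0 u" by (rule imageE) blast
  then have u: "u \<in> V" "\<And>w. w \<in> V \<Longrightarrow> x0 w \<le> x0 u" using finiteV by (metis Max_ge finite_imageI imageI)+
  obtain w0 where "w0 \<in> V" "x0 w0 \<noteq> 0" using x0(2) by blast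
  then have xu0: "0 < x0 u" using x0(1)[of w0] u(2)[of w0] by simp
  define x where "x w = x0 w / x0 u" for w
  have xge: "0 \<le> x w" for w using x0(1) xu0 by (simp add: x_def)
  have xu: "x u = 1" using xu0 by (simp add: x_def)
  have xsub: "?\<rho> * x w \<le> (\<Sum>b\<in>nbs E V w. x b)" if "w \<in> V" for w
    using divide_right_mono[OF x0(3)[OF that], of "x0 u"] xu0 by (simp add: x_def sum_divide_distrib)
  interpret S: sparse_subsolution V E x ?\<rho> u
  proof
    show "finite V" "sym E" "irrefl E" "u \<in> V" "x u = 1" using finiteV symE irreflE u xu by auto
    show "card (E \<inter> S \<times> S) \<le> 16 * card S" if "S \<subseteq> V" for S
      using sparse[OF that] by (cases "S = {}") auto
    show "card {w \<in> V. (a, w) \<in> E \<and> (b, w) \<in> E \<and> (c, w) \<in> E} \<le> 2" if "distinct [a, b, c]" for a b c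
      by (rule codegree3[OF that])
    show "0 \<le> x w" for w by (rule xge)
    show "x w \<le> 1" if "w \<in> V" for w using u(2)[OF that] xu0 by (simp add: x_def)
    show "?\<rho> * x w \<le> (\<Sum>b\<in>nbs E V w. x b)" if "w \<in> V" for w by (rule xsub[OF that])
    show "0 < ?\<rho>" using ge \<mu> by (simp add: \<mu>_def)
    have "\<mu>\<^sup>2 \<le> ?\<rho>\<^sup>2" using ge \<mu> by (intro power_mono) (auto simp: \<mu>_def)
    then show "2 * real (card V) - 4 \<le> ?\<rho>\<^sup>2" using mu2 n(1) by linarith
    show "2.16 * 10 ^ 17 \<le> real (card V)" using n by simp
  qed
  obtain v M where vM: "v \<in> V" "v \<noteq> u" "0 \<le> M" "18 * M < x v" "\<And>z. z \<in> V - {u, v} \<Longrightarrow> x z \<le> M"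
    "2 * real (card (nbs E V u \<inter> nbs E V v)) \<ge> real (card V)"
    by (rule S.dominating_pair) blast
  define A where "A = nbs E V u \<inter> nbs E V v"
  define R where "R = V - {u, v} - A"
  have Aiff: "w \<in> A \<longleftrightarrow> (u, w) \<in> E \<and> (v, w) \<in> E" for w using EV by (auto simp: A_def nbs_def)
  have AV: "A \<subseteq> V" by (auto simp: A_def nbs_def)
  have uvA: "u \<notin> A" "v \<notin> A" using edge_neq by (auto simp: Aiff)
  have fA: "finite A" "finite R" using finiteV AV finite_subset by (auto simp: R_def)
  have cardA: "2 * l - 2 \<le> card A" "3 \<le> card A" using vM(6) n l by (auto simp: A_def)
  have Aadj: "(u, w) \<in> E \<and> (w, u) \<in> E \<and> (v, w) \<in> E \<and> (w, v) \<in> E" if "w \<in> A" for w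
    using that Es Aiff by blast
  have degA: "card {b \<in> A. (z, b) \<in> E} \<le> 2" if "z \<noteq> u" "z \<noteq> v" for z
  proof -
    have "{b \<in> A. (z, b) \<in> E} = {w \<in> V. (u, w) \<in> E \<and> (v, w) \<in> E \<and> (z, w) \<in> E}" using AV Aiff by auto
    then show ?thesis using codegree3[of u v z] that vM(2) by simp
  qed
  have long: "length p < 2 * l - 2" if p: "gpath E p" "set p \<subseteq> A" for p
  proof (rule ccontr)
    assume "\<not> ?thesis"
    then have "two_cycles E l"
      using p Aadj uvA vM(2) l by (intro two_cycles_from_long_path[OF p(1), of l u v]) auto
    then show False using free by simp
  qed
  have acyclic: "\<not> set c \<subseteq> A" if c: "cycle_list E c" "length c \<ge> 3" for c
  proof
    assume cA: "set c \<subseteq> A"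
    have g: "gpath E c" "(last c, hd c) \<in> E" using c by (auto simp: cycle_list_def)
    have "card (set c) = length c" using g by (simp add: gpath_def distinct_card)
    \<comment> \<open>A cycle through all of \<open>A\<close> would contain a path on at least 2 l -
      2 vertices of \<open>A\<close>. Hence some common neighbour \<open>w\<close> is off the cycle,
      and u, w, v links the apexes for a K_5 subdivision, whether or not they are adjacent.\<close>
    then have "set c \<noteq> A" using long[OF g(1) cA] cardA by auto
    then obtain w where w: "w \<in> A" "w \<notin> set c" using cA by blast
    have neq: "u \<noteq> w" "v \<noteq> w" using w uvA by auto
    show False
    proof (rule no_linked_apexes_over_cycle[OF g(1) c(2) g(2), of u v "[u, w, v]"])
      show "gpath E [u, w, v]" using neq vM(2) Aadj[OF w(1)] by (simp add: gpath_def)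
      show "set [u, w, v] \<inter> set c = {}" using w cA uvA by auto
    qed (use Aadj cA vM(2) in auto)
  qed
  obtain psA where psA: "distinct (concat psA)" "[] \<notin> set psA" "set (concat psA) = A"
    "\<And>a b. a \<in> A \<Longrightarrow> b \<in> A \<Longrightarrow> (a, b) \<in> E \<longleftrightarrow> (a, b) \<in> forest_arcs psA"
    using linear_forest_decomposition[OF fA(1) symE irreflE degA acyclic] uvA by metis
  obtain rs where rs: "set rs = R" "distinct rs" using finite_distinct_list[OF fA(2)] by blast
  \<comment> \<open>Vertices outside \<open>A\<close> become paths of order 1, which meet the length
    conditions since l \<ge> 3.\<close>
  define ps where "ps = psA @ map (\<lambda>r. [r]) rs"
  have cps: "concat ps = concat psA @ rs" by (simp add: ps_def concat_map_singleton)
  have sps: "set (concat ps) = A \<union> R" using psA(3) rs by (simp only: cps set_append)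
  have Vd: "V = {u, v} \<union> A \<union> R" using u(1) vM(1) AV by (auto simp: R_def)
  have Vdis: "{u, v} \<inter> (A \<union> R) = {}" "A \<inter> R = {}" using uvA by (auto simp: R_def)
  have fl: "fan_list u v ps"
    unfolding fan_list_def using psA(1-3) rs Vdis vM(2) sps by (auto simp: cps ps_def simp del: set_concat)
  let ?G = "fan u v ps"
  have VG: "pverts ?G = V" using sps Vd by (simp only: pverts_fan Un_assoc)
  have fa: "forest_arcs ps = forest_arcs psA" by (auto simp: forest_arcs_def ps_def path_arcs_def)
  have faA: "forest_arcs psA \<subseteq> E"
  proof
    fix e assume e: "e \<in> forest_arcs psA"
    obtain a b where ab: "e = (a, b)" by (cases e)
    then show "e \<in> E" using e forest_arcs_set[of a b psA] psA(3,4) by auto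
  qed
  have pA: "gpath E p" "set p \<subseteq> A" if "p \<in> set psA" for p
  proof -
    show "set p \<subseteq> A" using that psA(3) by auto
    have "path_arcs p \<subseteq> E" using that faA by (auto simp: forest_arcs_def)
    moreover have "p \<noteq> []" "distinct p" using that psA(1,2) by (auto simp: distinct_concat_iff)
    ultimately show "gpath E p" by (intro path_arcs_gpath) auto
  qed
  have inA: "p \<in> set psA" if "p \<in> set ps" "length p \<ge> 2" for p using that by (auto simp: ps_def)
  have adm: "admissible l (mset (map length ps))"
    unfolding admissible_iff_paths[OF fl l]
  proof (intro conjI ballI impI)
    fix p assume p: "p \<in> set ps"
    show "length p \<le> 2 * l - 3"
    proof (cases "length p \<ge> 2")
      case True
      then show ?thesis using long[OF pA[OF inA[OF p True]]] by simp
    qed (use l in auto)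
    fix r assume r: "r \<in> set ps" "p \<noteq> r"
    show "length p < l - 1 \<or> length r < l - 1"
    proof (rule ccontr)
      assume "\<not> ?thesis"
      then have len: "l - 1 \<le> length p" "l - 1 \<le> length r" by auto
      then have pr: "p \<in> set psA" "r \<in> set psA" using inA p r l by auto
      have "set p \<inter> set r = {}" using fan_list_disjoint[OF fl p r(1)] r(2) by blast
      then have "two_cycles E l"
        using pA[OF pr(1)] pA[OF pr(2)] len l uvA vM(2) Aadj
        by (intro two_cycles_from_paths[where p = p and q = r and u = u and v = v]) auto
      then show False using free by simp
    qed
  qed
  have sum: "sum_list (map length ps) = n - 2"
    using card_fan[OF fl] VG n(1) by simp
  have opt: "(\<Sum>s\<leftarrow>map length ps. pathsum q s) < (\<Sum>s\<leftarrow>?T. pathsum q s)" if "mset (map length ps) \<noteq> mset ?T"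
    by (rule pathsum_less[OF q l n(3) adm sum that])
  have eqT: "(\<Sum>s\<leftarrow>map length ps. pathsum q s) = (\<Sum>s\<leftarrow>?T. pathsum q s)" if "mset (map length ps) = mset ?T"
    using that by (metis mset_map sum_mset_sum_list)
  \<comment> \<open>For the target lengths equality holds, otherwise \<open>opt\<close> is strict;
    in both cases the weights \<open>?y\<close> form a supersolution at the apexes.\<close>
  have le: "1 + (\<Sum>s\<leftarrow>map length ps. pathsum q s) \<le> \<mu>"
    using opt eqT qT unfolding \<mu>_def by (cases "mset (map length ps) = mset ?T") auto
  let ?E = "parcs ?G" and ?y = "fanw q u v ps"
  interpret F: pair_graph ?G by (rule pair_graph_fan[OF fl])
  have symF: "sym ?E" by (rule symI) (metis F.arcs_symmetric)
  note eqs = fanw_equations[OF fl q, unfolded VG]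
  have yuv: "?y w = 1" if "w \<in> {u, v}" for w using that by (simp add: fanw_def)
  have super: "(\<Sum>b\<in>nbs ?E V w. ?y b) \<le> \<mu> * ?y w" if w: "w \<in> V" for w
  proof (cases "w \<in> {u, v}")
    case True
    then show ?thesis using eqs(2)[OF True] yuv[OF True] le by simp
  next
    case False
    then have "w \<in> set (concat ps)" using w Vd sps by auto
    then show ?thesis using eqs(3)[of w] by (simp add: \<mu>_def)
  qed
  have arcs: "?E = {(u, v), (v, u)} \<union> {u, v} \<times> (A \<union> R) \<union> (A \<union> R) \<times> {u, v} \<union> forest_arcs psA"
    by (simp only: fan_def pair_pre_digraph.simps sps fa)
  have xR: "0 \<le> (\<Sum>r\<in>R. x r)" using xge by (intro sum_nonneg) auto
  have exch: "qform E V x + 2 * (x v - 18 * M) * (\<Sum>r\<in>R. x r) + (if (u, v) \<in> E then 0 else 2 * (x u * x v)) \<le> qform ?E V x"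
  proof (rule arc_weight_exchange[OF finiteV EV symE irreflE _ Vd _ Vdis])
    show "?E \<subseteq> V \<times> V" using F.in_arcsD1 F.in_arcsD2 VG by auto
    show "u \<noteq> v" using vM(2) by simp
    show "(u, r) \<notin> E \<or> (v, r) \<notin> E" if "r \<in> R" for r using that Aiff by (auto simp: R_def)
    show "card (nbs E A r) \<le> 2" if "r \<in> R" for r using degA[of r] that by (auto simp: R_def nbs_def)
    show "card (E \<inter> T \<times> T) \<le> 16 * card T" if "T \<subseteq> V" for T by (rule S.sparse[OF that])
    show "{(u, v), (v, u)} \<union> {u, v} \<times> R \<union> R \<times> {u, v} \<subseteq> ?E" unfolding arcs by auto
    show "E - ?E \<subseteq> R \<times> A \<union> A \<times> R \<union> R \<times> R"
    proof
      fix e assume e: "e \<in> E - ?E"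
      obtain a b where ab: "e = (a, b)" by (cases e)
      have abV: "a \<in> V" "b \<in> V" "a \<noteq> b" "(a, b) \<in> E" "(a, b) \<notin> ?E" using e ab EV edge_neq by auto
      have "a \<notin> {u, v}" "b \<notin> {u, v}" using abV Vd unfolding arcs by auto
      then have "a \<in> A \<union> R" "b \<in> A \<union> R" using abV Vd by auto
      moreover have "\<not> (a \<in> A \<and> b \<in> A)" using psA(4)[of a b] abV unfolding arcs by auto
      ultimately show "e \<in> R \<times> A \<union> A \<times> R \<union> R \<times> R" unfolding ab by auto
    qed
    show "0 \<le> x w" for w by (rule xge)
    show "x w \<le> M" if "w \<in> A \<union> R" for w using vM(5)[of w] that Vd Vdis by auto
    show "x v \<le> x u" using S.x1[OF vM(1)] xu by simp
  qed
  define ss where "ss = (\<Sum>w\<in>V. (x w)\<^sup>2)"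
  have ss: "0 < ss" unfolding ss_def using finiteV u(1) xu by (intro sum_pos2[of V u]) auto
  have lo: "?\<rho> * ss \<le> qform E V x" unfolding ss_def by (rule qform_ge) (use xge xsub in auto)
  have hi: "qform ?E V x \<le> \<mu> * ss" unfolding ss_def by (rule qform_le(1)[OF finiteV symF eqs(1) super])
  have mr: "\<mu> * ss \<le> ?\<rho> * ss" using ge ss by (intro mult_right_mono) (auto simp: \<mu>_def)
  have ex0: "0 \<le> 2 * (x v - 18 * M) * (\<Sum>r\<in>R. x r)" using vM(4) xR by simp
  have ex1: "0 \<le> (if (u, v) \<in> E then 0 else 2 * (x u * x v))" using xge by simp
  have eq: "qform ?E V x = \<mu> * ss" "?\<rho> * ss = \<mu> * ss" "2 * (x v - 18 * M) * (\<Sum>r\<in>R. x r) = 0"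
    "(if (u, v) \<in> E then 0 else 2 * (x u * x v)) = 0"
    using lo hi mr ex0 ex1 exch by linarith+
  show rho: "?\<rho> = q + 1 / q" using eq(2) ss by (simp add: \<mu>_def)
  \<comment> \<open>Equality makes \<open>x\<close> proportional to the positive \<open>?y\<close>
    along the edges of the fan at \<open>u\<close>, and these reach every vertex.\<close>
  have xpos: "0 < x w" if w: "w \<in> V" for w
  proof (cases "w = u")
    case False
    then have "(u, w) \<in> ?E" using w Vd unfolding arcs by auto
    then have "x u * ?y w = x w * ?y u"
      using qform_le(2)[OF finiteV symF eqs(1) super eq(1)[unfolded ss_def]] u(1) w by blast
    then show ?thesis using xu yuv[of u] eqs(1)[OF w] by simp
  qed (use xu in simp)
  have R0: "R = {}"
  proof (rule ccontr)
    assume "R \<noteq> {}"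
    then have "0 < (\<Sum>r\<in>R. x r)" using fA(2) xpos by (intro sum_pos) (auto simp: R_def)
    then show False using eq(3) vM(4) by simp
  qed
  have uvE: "(u, v) \<in> E"
  proof (rule ccontr)
    assume "(u, v) \<notin> E"
    then show False using eq(4) xpos[OF vM(1)] xu by simp
  qed
  have "?E \<subseteq> E" unfolding arcs R0 using uvE Es Aadj faA by auto
  moreover have "E \<subseteq> ?E"
  proof
    fix e assume e: "e \<in> E"
    obtain a b where ab: "e = (a, b)" by (cases e)
    have "a \<in> V" "b \<in> V" "a \<noteq> b" using e ab EV edge_neq by auto
    then show "e \<in> ?E" using e psA(4)[of a b] Vd R0 unfolding ab arcs by auto
  qed
  ultimately have GG: "G = ?G" using VG by (intro pair_pre_digraph.equality) auto
  have "mset (map length ps) = mset ?T"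
  proof (rule ccontr)
    assume "mset (map length ps) \<noteq> mset ?T"
    then have "1 + (\<Sum>s\<leftarrow>map length ps. pathsum q s) < q + 1 / q" using opt qT by simp
    then have "graph_spectral_radius ?G < q + 1 / q" by (rule fan_spectral_radius(2)[OF fl q])
    then show False using rho GG by simp
  qed
  then show "\<exists>u v ps. fan_list u v ps \<and> G = fan u v ps \<and> mset (map length ps) = mset ?T"
    using fl GG by blast
qed

end

section \<open>Attainment by the target and the final identification\<close>

lemma target_fan_planar_free:
  assumes l: "l \<ge> 3" and n: "n \<ge> 4 * l" and fl: "fan_list u v ps"
    and T: "mset (map length ps) = mset (target_lengths n (2 * l - 3) (l - 2))"
  shows "planar_free_graph n (copies 2 (cycle_graph l)) (fan u v ps)"
proof -
  have g: "pair_graph (fan u v ps)" by (rule pair_graph_fan[OF fl])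
  have "ps \<noteq> []" using T by (auto simp: target_lengths_def)
  then have p: "planar (fan u v ps)" by (rule planar_fan[OF fl])
  have "sum_list (map length ps) = n - 2"
    using T target_lengths_props(2)[OF l n] by (metis sum_mset_sum_list)
  then have c: "card (pverts (fan u v ps)) = n" using card_fan[OF fl] l n by simp
  have "admissible l (mset (map length ps))" using T target_lengths_props(1)[OF l n] by simp
  then have "\<not> two_cycles (parcs (fan u v ps)) l"
    unfolding admissible_iff_paths[OF fl l] by (intro fan_no_two_cycles[OF fl l]) auto
  then show ?thesis
    using g p c free_of_two_cycles_iff[OF g l] by (simp add: planar_free_graph_def)
qed

lemma target_fan_radius:
  assumes fl: "fan_list u v ps" and T: "mset (map length ps) = mset ns"
    and q: "0 < q" "q < 1" and qT: "1 + (\<Sum>s\<leftarrow>ns. pathsum q s) = q + 1 / q"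
  shows "graph_spectral_radius (fan u v ps) = q + 1 / q"
proof (rule fan_spectral_radius(1)[OF fl q])
  have "(\<Sum>s\<leftarrow>map length ps. pathsum q s) = (\<Sum>s\<leftarrow>ns. pathsum q s)"
    using T by (metis mset_map sum_mset_sum_list)
  then show "1 + (\<Sum>s\<leftarrow>map length ps. pathsum q s) = q + 1 / q" using qT by simp
qed

lemma planar_free_radius:
  fixes G :: "'a pair_pre_digraph"
  assumes l: "l \<ge> 3" and n: "real n \<ge> 2.16 * 10 ^ 17" "n \<ge> 4 * l"
    and q: "0 < q" "q < 1"
    and qT: "1 + (\<Sum>s\<leftarrow>target_lengths n (2 * l - 3) (l - 2). pathsum q s) = q + 1 / q"
    and G: "planar_free_graph n (copies 2 (cycle_graph l)) G"
  shows "graph_spectral_radius G \<le> q + 1 / q"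
    and "graph_spectral_radius G = q + 1 / q \<Longrightarrow> \<exists>u v ps. fan_list u v ps \<and> G = fan u v ps \<and>
      mset (map length ps) = mset (target_lengths n (2 * l - 3) (l - 2))"
proof -
  have g: "pair_graph G" and c: "card (pverts G) = n" and free: "\<not> two_cycles (parcs G) l"
    using G free_of_two_cycles_iff[OF _ l, of G] by (auto simp: planar_free_graph_def)
  obtain pt \<gamma> where d: "planar_drawing G pt \<gamma>" using G by (auto simp: planar_free_graph_def planar_def)
  interpret drawing G pt \<gamma> by (rule drawing.intro[OF g d])
  note ext = spectral_extremal[OF l c n free q qT]
  show "graph_spectral_radius G \<le> q + 1 / q" using ext(1) by (cases "q + 1 / q \<le> graph_spectral_radius G") auto
  show "\<exists>u v ps. fan_list u v ps \<and> G = fan u v ps \<and>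
      mset (map length ps) = mset (target_lengths n (2 * l - 3) (l - 2))"
    if "graph_spectral_radius G = q + 1 / q" using ext(2) that by simp
qed

lemma exists_nat_paths: "\<exists>ps. map length ps = ns \<and> concat ps = [k..<k + sum_list ns]"
proof (induction ns arbitrary: k)
  case (Cons m ns)
  obtain ps where "map length ps = ns" "concat ps = [k + m..<k + m + sum_list ns]" using Cons by blast
  then show ?case
    by (intro exI[of _ "[k..<k + m] # ps"]) (use upt_add_eq_append[of k "k + m" "sum_list ns"] in \<open>simp add: add.assoc\<close>)
qed simp

theorem theorem1p2:
  fixes l n :: nat
  assumes "l \<ge> 3"
    and "real n \<ge> max (2.16 * 10 ^ 17) (9 * 2 ^ (l - 1) + 3)"
  shows "extremal_graph n (copies 2 (cycle_graph l))
           (graph_join (complete_graph 2) (H_graph n (2 * l - 3) (l - 2)))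
         \<and> (\<forall>G :: 'a pair_pre_digraph.
              extremal_graph n (copies 2 (cycle_graph l)) G \<longrightarrow>
              isomorphic G (graph_join (complete_graph 2) (H_graph n (2 * l - 3) (l - 2))))"
proof -
  let ?F = "copies 2 (cycle_graph l)" and ?T = "target_lengths n (2 * l - 3) (l - 2)"
  note l = assms(1)
  have big: "real n \<ge> 2.16 * 10 ^ 17" using assms(2) by simp
  \<comment> \<open>From l \<le> 2^(l-1) and the second bound on \<open>n\<close>. It makes H(2l-3,
    l-2) well defined and gives the common neighbourhood, which has at least n/2 vertices, room for
    2 l - 2 of them.\<close>
  have nl: "n \<ge> 4 * l"
  proof -
    have "l - 1 < 2 ^ (l - 1)" by (rule less_exp)
    then have "real l \<le> 2 ^ (l - 1)" using l
      by (metis (mono_tags, lifting) Suc_leI Suc_pred' less_le_trans of_nat_le_iff of_nat_numeral of_nat_power zero_less_numeral)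
    then have "4 * real l \<le> 9 * 2 ^ (l - 1) + 3" by linarith
    then have "real (4 * l) \<le> real n" using assms(2) by simp
    then show ?thesis by (simp only: of_nat_le_iff)
  qed
  have sT: "sum_list ?T = n - 2" by (rule target_lengths_props(2)[OF l nl])
  have "sum_list ?T \<ge> 6" using sT nl l by simp
  then obtain q where q: "0 < q" "q < 1" and qT: "1 + (\<Sum>s\<leftarrow>?T. pathsum q s) = q + 1 / q"
    using exists_fan_parameter by blast
  have T0: "0 \<notin> set ?T"
    using target_lengths_props(1)[OF l nl] by (auto simp: admissible_def)
  note radius = target_fan_radius[OF _ _ q qT]
  note main = planar_free_radius[OF l big nl q qT]
  \<comment> \<open>The maximum defining \<open>spex_planar\<close> ranges over graphs on
    \<open>nat\<close>, so the target is realised there as well: apexes 0 and 1, paths on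
    consecutive numbers from 2 on.\<close>
  obtain ps :: "nat list list" where ps: "map length ps = ?T" "concat ps = [2..<2 + sum_list ?T]"
    using exists_nat_paths by blast
  have "[] \<notin> set ps" using T0 ps(1) by (metis imageI length_0_conv list.set_map)
  moreover have "distinct (0 # 1 # concat ps)"
    unfolding ps(2) by (simp only: distinct.simps list.set set_upt distinct_upt) auto
  ultimately have fl: "fan_list 0 1 ps" unfolding fan_list_def by blast
  have spex: "spex_planar n ?F = q + 1 / q"
    unfolding spex_planar_def
  proof (rule Max_eqI)
    show "finite {graph_spectral_radius G | G :: nat pair_pre_digraph. planar_free_graph n ?F G}"
      by (rule finite_spectral_radii)
    show "y \<le> q + 1 / q" if "y \<in> {graph_spectral_radius G | G :: nat pair_pre_digraph. planar_free_graph n ?F G}" for y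
      using that main(1) by auto
    have "planar_free_graph n ?F (fan 0 1 ps)" by (rule target_fan_planar_free[OF l nl fl]) (simp add: ps)
    moreover have "graph_spectral_radius (fan 0 1 ps) = q + 1 / q" by (rule radius[OF fl]) (simp add: ps)
    ultimately show "q + 1 / q \<in> {graph_spectral_radius G | G :: nat pair_pre_digraph. planar_free_graph n ?F G}"
      by force
  qed
  have "2 * l - 3 \<ge> 1" "l - 2 \<ge> 1" using l by linarith+
  then obtain ts where ts: "fan_list (Inl 0) (Inl 1) ts" "map length ts = ?T"
    "graph_join (complete_graph 2) (H_graph n (2 * l - 3) (l - 2)) = fan (Inl 0) (Inl 1) ts"
    by (rule target_is_fan)
  have "extremal_graph n ?F (fan (Inl 0) (Inl 1) ts)"
    unfolding extremal_graph_def spex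
    using target_fan_planar_free[OF l nl ts(1)] radius[OF ts(1)] ts(2) by simp
  moreover have "isomorphic G (fan (Inl 0) (Inl 1) ts)" if "extremal_graph n ?F G" for G :: "'a pair_pre_digraph"
  proof -
    have G: "planar_free_graph n ?F G" "graph_spectral_radius G = q + 1 / q"
      using that unfolding extremal_graph_def spex by auto
    obtain u v ps where f: "fan_list u v ps" "G = fan u v ps" "mset (map length ps) = mset ?T"
      using main(2)[OF G] by blast
    show ?thesis unfolding f(2) by (rule isomorphic_fan[OF f(1) ts(1)]) (simp only: f(3) ts(2))
  qed
  ultimately show ?thesis unfolding ts(3) by blast
qed

end
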